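(* Fix $\alpha\in(2,3]$ and let $\beta=\frac{2}{\alpha-1}$. Let $R$ be an aperiodic random walk on $\mathbb{Z}$ with step $\xi$ such that $\mathbb{E}\xi=0$ and $\mathbb{P}(|\xi|>t)\le c\,t^{-\alpha}$ for some constant $c$ and all $t>0$. Let $(A_n)$ be the DLA process with respect to $R$ and $D_n=\operatorname{diam}A_n$. Then almost surely $D_n\le n^{\beta+o(1)}$ as $n\to\infty$.
   Context: $R=(R_0,R_1,\dots)$ is a random walk on $\mathbb{Z}$ with i.i.d. steps distributed as an integer-valued variable $\xi$; $\mathbb{P}_x$ is its law started at $x$, and $p_{x,y}=\mathbb{P}(\xi=y-x)$. The walk is aperiodic if for all $x,y\in\mathbb{Z}$ there is $n$ with $\mathbb{P}_x(R_n=y)\ne0$. For $A\subset\mathbb{Z}$, $T_A=\min\{n>0:R_n\in A\}$, and $T_x=T_{\{x\}}$. $\operatorname{diam}A=\max A-\min A$. (The walks considered here are recurrent.) For $A\subset\mathbb{Z}$ finite nonempty, $x\notin A$, $a\in A$, the limits $\mathbb{P}_{\pm\infty}(T_x<T_A):=\lim_{y\to\pm\infty}\mathbb{P}_y(T_x<T_A)$ exist; put $\mathbb{P}_\infty(T_x<T_A)=\frac12\big(\mathbb{P}_{+\infty}(T_x<T_A)+\mathbb{P}_{-\infty}(T_x<T_A)\big)$ and define the gluing measure $$\mu(x,a;A)=\frac{p_{x,a}\,\mathbb{P}_\infty(T_x<T_A)}{\mathbb{P}_x(T_A<T_x)}.$$ The DLA process with respect to $R$ is the Markov chain of random finite sets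 $A_0=\{0\}\subset A_1\subset A_2\subset\cdots$ such that for all $n\ge0$, finite $A\subset\mathbb{Z}$ and $x\in\mathbb{Z}\setminus A$, $\mathbb{P}(A_{n+1}=A\cup\{x\}\mid A_n=A)=\sum_{a\in A}\mu(x,a;A)$. "$D_n\le n^{\beta+o(1)}$ almost surely" means $\limsup_{n\to\infty}\frac{\log D_n}{\log n}\le\beta$ almost surely. *)

theory Defs
  imports "HOL-Probability.Probability"
begin

text \<open>A step distribution is an \<^typ>\<open>int pmf\<close>; \<open>walk_law \<xi> x\<close> is the path law $P_x$ of the walk
  started at \<open>x\<close>, a measure on trajectories \<^typ>\<open>nat \<Rightarrow> int\<close>.\<close>

definition walk :: "int \<Rightarrow> (nat \<Rightarrow> int) \<Rightarrow> nat \<Rightarrow> int" where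
  "walk x s = (\<lambda>n. x + (\<Sum>i<n. s i))"

definition walk_law :: "int pmf \<Rightarrow> int \<Rightarrow> (nat \<Rightarrow> int) measure" where
  "walk_law \<xi> x =
     distr (PiM UNIV (\<lambda>_::nat. measure_pmf \<xi>)) (PiM UNIV (\<lambda>_. count_space UNIV)) (walk x)"

definition step_prob :: "int pmf \<Rightarrow> int \<Rightarrow> int \<Rightarrow> real" where
  "step_prob \<xi> x y = pmf \<xi> (y - x)"

definition aperiodic_walk :: "int pmf \<Rightarrow> bool" where
  "aperiodic_walk \<xi> \<longleftrightarrow> (\<forall>x y. \<exists>n. \<P>(R in walk_law \<xi> x. R n = y) \<noteq> 0)"

text \<open>The time is \<^term>\<open>\<infinity>\<close> if the set is never hit, since \<^prop>\<open>Inf {} = (\<infinity>::enat)\<close>.\<close>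

definition hit_time :: "int set \<Rightarrow> (nat \<Rightarrow> int) \<Rightarrow> enat" where
  "hit_time A R = Inf {enat n | n. n > 0 \<and> R n \<in> A}"

definition hit_point_first :: "int pmf \<Rightarrow> int \<Rightarrow> int set \<Rightarrow> int \<Rightarrow> real" where
  "hit_point_first \<xi> x A y = \<P>(R in walk_law \<xi> y. hit_time {x} R < hit_time A R)"

definition hit_set_first :: "int pmf \<Rightarrow> int \<Rightarrow> int set \<Rightarrow> int \<Rightarrow> real" where
  "hit_set_first \<xi> x A y = \<P>(R in walk_law \<xi> y. hit_time A R < hit_time {x} R)"

definition hit_point_first_infinity :: "int pmf \<Rightarrow> int \<Rightarrow> int set \<Rightarrow> real" where
  "hit_point_first_infinity \<xi> x A =
     (Lim at_top (hit_point_first \<xi> x A) + Lim at_bot (hit_point_first \<xi> x A)) / 2"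

definition gluing_measure :: "int pmf \<Rightarrow> int \<Rightarrow> int \<Rightarrow> int set \<Rightarrow> real" where
  "gluing_measure \<xi> x a A =
     step_prob \<xi> x a * hit_point_first_infinity \<xi> x A / hit_set_first \<xi> x A x"

text \<open>The conditional probabilities are constrained only where the conditioning event has
  positive probability.\<close>

locale dla_process = prob_space M
  for M :: "'w measure" and \<xi> :: "int pmf" and A :: "nat \<Rightarrow> 'w \<Rightarrow> int set" +
  assumes random_finite_set: "\<And>n. A n \<in> measurable M (count_space {B. finite B})"
    and start: "AE \<omega> in M. A 0 \<omega> = {0}"
    and increasing: "\<And>n. AE \<omega> in M. A n \<omega> \<subset> A (Suc n) \<omega>"
    and markov: "\<And>n (B :: nat \<Rightarrow> int set) C.
      \<P>(\<omega> in M. \<forall>k\<le>n. A k \<omega> = B k) > 0 \<Longrightarrow>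
      \<P>(\<omega> in M. A (Suc n) \<omega> = C \<bar> \<forall>k\<le>n. A k \<omega> = B k) =
      \<P>(\<omega> in M. A (Suc n) \<omega> = C \<bar> A n \<omega> = B n)"
    and transition: "\<And>n B x. finite B \<Longrightarrow> x \<notin> B \<Longrightarrow>
      \<P>(\<omega> in M. A n \<omega> = B) > 0 \<Longrightarrow>
      \<P>(\<omega> in M. A (Suc n) \<omega> = B \<union> {x} \<bar> A n \<omega> = B) =
      (\<Sum>a\<in>B. gluing_measure \<xi> x a B)"

definition diam :: "int set \<Rightarrow> int" where
  "diam A = Max A - Min A"

lemma measurable_walk:
  "walk x \<in> measurable (PiM UNIV (\<lambda>_::nat. measure_pmf \<xi>)) (PiM UNIV (\<lambda>_. count_space UNIV))"
proof (rule measurable_PiM_single')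
  fix n :: nat
  have *: "(\<lambda>s. s i) \<in> measurable (PiM UNIV (\<lambda>_::nat. measure_pmf \<xi>)) (count_space UNIV)" for i
    using measurable_component_singleton[of i UNIV "\<lambda>_::nat. measure_pmf \<xi>"]
    by (simp cong: measurable_cong_sets)
  show "(\<lambda>s. walk x s n) \<in> measurable (PiM UNIV (\<lambda>_::nat. measure_pmf \<xi>)) (count_space UNIV)"
  proof (induction n)
    case 0
    show ?case by (simp add: walk_def)
  next
    case (Suc n)
    have "(\<lambda>s. walk x s (Suc n)) = (\<lambda>s. walk x s n + s n)"
      by (simp add: walk_def add.assoc)
    with Suc *[of n] show ?case by simp
  qed
qed (auto simp: walk_def)

lemma prob_space_walk_law: "prob_space (walk_law \<xi> x)"
proof -
  interpret product_prob_space "\<lambda>_::nat. measure_pmf \<xi>" UNIV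
    by unfold_locales
  show ?thesis
    unfolding walk_law_def by (rule prob_space_distr[OF measurable_walk])
qed

lemma measurable_hit_time:
  "hit_time A \<in> measurable (walk_law \<xi> x) (count_space UNIV)"
proof -
  have "(\<lambda>R. Inf {enat n | n. n > 0 \<and> R n \<in> A}) = (\<lambda>R. INF n. if n > 0 \<and> R n \<in> A then enat n else \<infinity>)"
    (is "_ = ?g")
  proof
    fix R :: "nat \<Rightarrow> int"
    show "Inf {enat n | n. n > 0 \<and> R n \<in> A} = ?g R"
    proof (rule antisym)
      show "Inf {enat n | n. n > 0 \<and> R n \<in> A} \<le> ?g R"
      proof (rule INF_greatest)
        fix n show "Inf {enat n | n. n > 0 \<and> R n \<in> A} \<le> (if n > 0 \<and> R n \<in> A then enat n else \<infinity>)"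
          by (cases "n > 0 \<and> R n \<in> A") (auto intro: Inf_lower)
      qed
      show "?g R \<le> Inf {enat n | n. n > 0 \<and> R n \<in> A}"
      proof (rule Inf_greatest)
        fix z assume "z \<in> {enat n | n. n > 0 \<and> R n \<in> A}"
        then obtain n where "z = enat n" "n > 0 \<and> R n \<in> A" by blast
        then show "?g R \<le> z" using INF_lower[of n UNIV "\<lambda>n. if n > 0 \<and> R n \<in> A then enat n else \<infinity>"]
          by simp
      qed
    qed
  qed
  then have "hit_time A = ?g"
    by (auto simp: hit_time_def fun_eq_iff)
  moreover have [measurable]:
    "(\<lambda>R. R n) \<in> measurable (PiM UNIV (\<lambda>_::nat. count_space (UNIV::int set))) (count_space UNIV)" for n
    by (rule measurable_component_singleton) simp
  moreover have "?g \<in> measurable (PiM UNIV (\<lambda>_::nat. count_space (UNIV::int set))) (count_space UNIV)"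
    by measurable
  ultimately show ?thesis
    by (simp only: walk_law_def measurable_distr_eq1)
qed

end

theory Submission
  imports Defs "HOL-Real_Asymp.Real_Asymp"
begin

text \<open>Let \<open>G\<^sub>A(y, x)\<close> be the Green function of the walk killed on \<open>A\<close>. Since \<open>G\<^sub>A(x, x)\<close> is the inverse
  of the probability of escaping from \<open>x\<close> to \<open>A\<close>, decomposing at the last step before \<open>A\<close> is hit
  identifies the gluing measure with the distribution of this last step for a walk from infinity.
  No mass is lost in the limit because \<open>G\<^sub>A(x, x) \<le> C \<bar>x - a\<bar>\<close> for every \<open>a \<in> A\<close>. The limits at
  infinity exist because a walk from far away enters a half-line with tight overshoot and then
  visits every nearby point before any remote one.

  Hence a particle is attached at \<open>x > max A\<close> through \<open>a\<close> with probability at most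
  \<open>C (x - max A)\<close> times the probability of a step from \<open>x\<close> to \<open>a\<close>. Consider jumps of length about
  \<open>s\<close> in a block of \<open>s\<close> to the power \<open>(\<alpha> - 1) / 2\<close> steps. Once the maximum has advanced by \<open>2 s\<close>,
  old points are out of reach, and the points added during the block are so few that they
  contribute only \<open>O(s)\<close> to the expected advance. Such jumps therefore advance the maximum by
  \<open>O(s + n s powr ((3 - \<alpha>) / 2))\<close> in \<open>n\<close> steps. Summing over dyadic \<open>s \<le> L\<close>, with \<open>L\<close> slightly
  larger than \<open>n powr \<beta>\<close>, gives \<open>O(L log L)\<close>, while longer jumps occur with
  probability \<open>O(n\<^sup>2 L powr (1 - \<alpha>))\<close>. The Borel-Cantelli lemma along dyadic \<open>L\<close> concludes.\<close>

section \<open>Potentials of killed walks\<close>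

text \<open>The attachment bound treats \<open>green \<xi> {z} x x\<close> as an effective
  resistance: it satisfies a triangle inequality, hence is at most linear in the distance, with no
  asymptotics of a potential kernel. Hitting probabilities are \<open>ennreal\<close> potentials,
  for which the strong Markov property is an identity between least solutions;
  \<open>emeasure_hit_time_less\<close> connects them to the path measure.

  The total mass of the gluing measure matters because \<open>dla_process\<close> prescribes only
  the probabilities of one-point extensions; mass \<open>1\<close> makes these the full transition
  law.

  The block length is a balance. A point within reach adds order
  \<open>s powr (2 - \<alpha>)\<close> to the expected advance by jumps of length about
  \<open>s\<close>. The points added in a block of \<open>T\<close> steps add at most
  \<open>T\<^sup>2 * s powr (2 - \<alpha>)\<close>, which is \<open>s\<close> for
  \<open>T = s powr ((\<alpha> - 1) / 2)\<close>. Counting all \<open>n\<close> points throughout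
  would give \<open>n\<^sup>2 * s powr (2 - \<alpha>)\<close>, too much for small \<open>s\<close>.
  At \<open>s = L\<close> one block fills about \<open>n\<close> steps, whence the exponent
  \<open>2 / (\<alpha> - 1)\<close>.\<close>

definition step_op :: "int pmf \<Rightarrow> (int \<Rightarrow> ennreal) \<Rightarrow> int \<Rightarrow> ennreal" where
  "step_op \<xi> f y = (\<integral>\<^sup>+k. f (y + k) \<partial>measure_pmf \<xi>)"

definition killed_op :: "int pmf \<Rightarrow> int set \<Rightarrow> (int \<Rightarrow> ennreal) \<Rightarrow> int \<Rightarrow> ennreal" where
  "killed_op \<xi> D f = step_op \<xi> (\<lambda>w. indicator (- D) w * f w)"

text \<open>Killing is tested only at positive times, like \<^const>\<open>hit_time\<close>: the starting point may lie in
  \<open>D\<close>.\<close>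

definition potential :: "int pmf \<Rightarrow> int set \<Rightarrow> (int \<Rightarrow> ennreal) \<Rightarrow> int \<Rightarrow> ennreal" where
  "potential \<xi> D g y = (\<Sum>n. (killed_op \<xi> D ^^ n) g y)"

definition green :: "int pmf \<Rightarrow> int set \<Rightarrow> int \<Rightarrow> int \<Rightarrow> ennreal" where
  "green \<xi> D y x = potential \<xi> D (indicator {x}) y"

text \<open>The \<open>n\<close>th term is the probability that times \<open>1\<close> to
  \<open>n\<close> avoid \<open>B \<union> D\<close> and time \<open>n + 1\<close> lies in
  \<open>B\<close>.\<close>

definition hit_before :: "int pmf \<Rightarrow> int set \<Rightarrow> int set \<Rightarrow> int \<Rightarrow> ennreal" where
  "hit_before \<xi> B D = potential \<xi> (B \<union> D) (step_op \<xi> (indicator B))"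

section \<open>Linearity, monotonicity and the Poisson equation\<close>

lemma step_op_mono: "(\<And>w. f w \<le> g w) \<Longrightarrow> step_op \<xi> f y \<le> step_op \<xi> g y"
  unfolding step_op_def by (intro nn_integral_mono) auto

lemma step_op_add: "step_op \<xi> (\<lambda>w. f w + g w) y = step_op \<xi> f y + step_op \<xi> g y"
  unfolding step_op_def by (intro nn_integral_add) auto

lemma step_op_cmult: "step_op \<xi> (\<lambda>w. c * f w) y = c * step_op \<xi> f y"
  unfolding step_op_def by (intro nn_integral_cmult) auto

lemma step_op_const [simp]: "step_op \<xi> (\<lambda>w. c) y = c"
  by (simp add: step_op_def)

lemma step_op_suminf: "step_op \<xi> (\<lambda>w. \<Sum>n. f n w) y = (\<Sum>n. step_op \<xi> (f n) y)"
  unfolding step_op_def by (intro nn_integral_suminf) auto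

lemma step_op_sum: "step_op \<xi> (\<lambda>w. \<Sum>n\<in>I. f n w) y = (\<Sum>n\<in>I. step_op \<xi> (f n) y)"
  unfolding step_op_def by (intro nn_integral_sum) auto

lemma step_op_eq:
  "step_op \<xi> f y = (\<integral>\<^sup>+w. ennreal (pmf \<xi> (w - y)) * f w \<partial>count_space UNIV)"
proof -
  have "bij ((+) y)" by simp
  then show ?thesis
    unfolding step_op_def nn_integral_measure_pmf
    by (subst nn_integral_bij_count_space[symmetric, of "(+) y" UNIV UNIV]) auto
qed

lemma step_op_singleton: "step_op \<xi> (indicator {x}) y = ennreal (pmf \<xi> (x - y))"
proof -
  have "step_op \<xi> (indicator {x}) y = (\<integral>\<^sup>+w. ennreal (pmf \<xi> (x - y)) * indicator {x} w \<partial>count_space UNIV)"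
    unfolding step_op_eq by (intro nn_integral_cong) (auto simp: indicator_def)
  then show ?thesis by simp
qed

lemma killed_op_apply:
  "killed_op \<xi> D f y = (\<integral>\<^sup>+k. indicator (- D) (y + k) * f (y + k) \<partial>measure_pmf \<xi>)"
  by (simp add: killed_op_def step_op_def)

text \<open>The columns of the transition matrix also sum to \<open>1\<close>: counting measure is
  invariant.\<close>

lemma nn_integral_pmf_reflect: "(\<integral>\<^sup>+w. ennreal (pmf \<xi> (x - w)) \<partial>count_space UNIV) = 1" for x :: int
proof -
  have "bij (\<lambda>w. x - w)" by (rule o_bij[of "\<lambda>w. x - w"]) auto
  then have "(\<integral>\<^sup>+w. ennreal (pmf \<xi> (x - w)) \<partial>count_space UNIV) = (\<integral>\<^sup>+w. ennreal (pmf \<xi> w) \<partial>count_space UNIV)"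
    by (rule nn_integral_bij_count_space)
  then show ?thesis by (simp add: nn_integral_pmf)
qed

lemma killed_op_mono: "(\<And>w. f w \<le> g w) \<Longrightarrow> killed_op \<xi> D f y \<le> killed_op \<xi> D g y"
  unfolding killed_op_def by (intro step_op_mono mult_left_mono) auto

lemma killed_op_antimono:
  "D \<subseteq> D' \<Longrightarrow> (\<And>w. f w \<le> g w) \<Longrightarrow> killed_op \<xi> D' f y \<le> killed_op \<xi> D g y"
  unfolding killed_op_def by (intro step_op_mono mult_mono) (auto simp: indicator_def)

lemma killed_op_add: "killed_op \<xi> D (\<lambda>w. f w + g w) y = killed_op \<xi> D f y + killed_op \<xi> D g y"
  unfolding killed_op_def by (simp add: distrib_left step_op_add)

lemma killed_op_cmult: "killed_op \<xi> D (\<lambda>w. c * f w) y = c * killed_op \<xi> D f y"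
  unfolding killed_op_def by (simp add: mult.left_commute step_op_cmult)

lemma killed_op_suminf: "killed_op \<xi> D (\<lambda>w. \<Sum>n. f n w) y = (\<Sum>n. killed_op \<xi> D (f n) y)"
  unfolding killed_op_def
  by (subst step_op_suminf[symmetric]) (simp add: ennreal_suminf_cmult)

lemma killed_op_le_step_op: "killed_op \<xi> D f y \<le> step_op \<xi> f y"
  unfolding killed_op_def by (intro step_op_mono) (auto simp: indicator_def)

lemma killed_op_split:
  "killed_op \<xi> D f y =
    step_op \<xi> (\<lambda>v. indicator (E - D) v * f v) y + killed_op \<xi> (D \<union> E) f y"
  unfolding killed_op_def step_op_add[symmetric]
  by (intro arg_cong[where f = "\<lambda>f. step_op \<xi> f y"] ext) (auto simp: indicator_def)

lemma killed_pow_mono: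
  "D \<subseteq> D' \<Longrightarrow> (\<And>w. f w \<le> g w) \<Longrightarrow> (killed_op \<xi> D' ^^ n) f y \<le> (killed_op \<xi> D ^^ n) g y"
  by (induction n arbitrary: y) (auto intro: killed_op_antimono)

lemma killed_pow_add:
  "(killed_op \<xi> D ^^ n) (\<lambda>w. f w + g w) = (\<lambda>w. (killed_op \<xi> D ^^ n) f w + (killed_op \<xi> D ^^ n) g w)"
  by (induction n) (auto simp: killed_op_add)

lemma killed_pow_cmult:
  "(killed_op \<xi> D ^^ n) (\<lambda>w. c * f w) = (\<lambda>w. c * (killed_op \<xi> D ^^ n) f w)"
  by (induction n) (auto simp: killed_op_cmult)

lemma potential_mono:
  "D \<subseteq> D' \<Longrightarrow> (\<And>w. f w \<le> g w) \<Longrightarrow> potential \<xi> D' f y \<le> potential \<xi> D g y"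
  unfolding potential_def by (intro suminf_le killed_pow_mono) auto

lemma potential_add: "potential \<xi> D (\<lambda>w. f w + g w) y = potential \<xi> D f y + potential \<xi> D g y"
  unfolding potential_def by (simp add: killed_pow_add suminf_add)

lemma potential_cmult: "potential \<xi> D (\<lambda>w. c * f w) y = c * potential \<xi> D f y"
  unfolding potential_def by (simp add: killed_pow_cmult ennreal_suminf_cmult)

lemma potential_unfold: "potential \<xi> D g y = g y + killed_op \<xi> D (potential \<xi> D g) y"
proof -
  have "(\<lambda>n. (killed_op \<xi> D ^^ Suc n) g y) sums (\<Sum>n. (killed_op \<xi> D ^^ Suc n) g y)"
    by (simp add: summable_sums)
  then have "(\<lambda>n. (killed_op \<xi> D ^^ n) g y) sums ((\<Sum>n. (killed_op \<xi> D ^^ Suc n) g y) + g y)"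
    using sums_Suc[of "\<lambda>n. (killed_op \<xi> D ^^ n) g y"] by simp
  then have "potential \<xi> D g y = (\<Sum>n. (killed_op \<xi> D ^^ Suc n) g y) + g y"
    unfolding potential_def by (simp add: sums_iff)
  also have "(\<Sum>n. (killed_op \<xi> D ^^ Suc n) g y) = killed_op \<xi> D (potential \<xi> D g) y"
    unfolding potential_def by (simp add: killed_op_suminf)
  finally show ?thesis by (simp add: add.commute)
qed

text \<open>By induction every supersolution dominates the partial sums. Minimality replaces
  uniqueness of solutions, which can fail in \<open>ennreal\<close>.\<close>

lemma potential_least:
  assumes "\<And>w. g w + killed_op \<xi> D f w \<le> f w"
  shows "potential \<xi> D g y \<le> f y"
proof -
  have "(\<Sum>i<n. (killed_op \<xi> D ^^ i) g y) \<le> f y" for n y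
  proof (induction n arbitrary: y)
    case (Suc n)
    have "(\<Sum>i<Suc n. (killed_op \<xi> D ^^ i) g y) = g y + killed_op \<xi> D (\<lambda>w. \<Sum>i<n. (killed_op \<xi> D ^^ i) g w) y"
      unfolding sum.lessThan_Suc_shift killed_op_def
      by (subst step_op_sum[symmetric] | simp add: killed_op_def sum_distrib_left)+
    also have "\<dots> \<le> g y + killed_op \<xi> D f y"
      by (intro add_left_mono killed_op_mono Suc)
    finally show ?case using assms[of y] by simp
  qed simp
  then show ?thesis
    unfolding potential_def by (intro suminf_le_const) auto
qed

text \<open>Stop the walk on entering \<open>E\<close>: the reward collected so far is kept, and the
  entry point pays out its full potential. Both inequalities come from minimality. The left side is
  a supersolution for the walk killed on \<open>D \<union> E\<close>; with that inequality in hand,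
  the right side is one for the walk killed on \<open>D\<close>.\<close>

lemma potential_strong_markov:
  "potential \<xi> D g y =
    potential \<xi> (D \<union> E) (\<lambda>w. g w + step_op \<xi> (\<lambda>v. indicator (E - D) v * potential \<xi> D g v) w) y"
    (is "?F y = ?f y")
proof (rule antisym)
  have le: "?f w \<le> ?F w" for w
  proof (rule potential_least)
    fix w
    show "g w + step_op \<xi> (\<lambda>v. indicator (E - D) v * ?F v) w + killed_op \<xi> (D \<union> E) ?F w \<le> ?F w"
      by (subst (3) potential_unfold, subst killed_op_split[of \<xi> D _ _ E]) (simp add: add.assoc)
  qed
  then show "?f y \<le> ?F y" .
  show "?F y \<le> ?f y"
  proof (rule potential_least)
    fix w
    have "step_op \<xi> (\<lambda>v. indicator (E - D) v * ?f v) w \<le> step_op \<xi> (\<lambda>v. indicator (E - D) v * ?F v) w"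
      by (intro step_op_mono mult_left_mono le) auto
    then have "g w + killed_op \<xi> D ?f w \<le> g w + step_op \<xi> (\<lambda>v. indicator (E - D) v * ?F v) w + killed_op \<xi> (D \<union> E) ?f w"
      unfolding killed_op_split[of \<xi> D ?f w E] by (simp add: add.assoc add_left_mono add_right_mono)
    also have "\<dots> = ?f w"
      by (subst (3) potential_unfold) simp
    finally show "g w + killed_op \<xi> D ?f w \<le> ?f w" .
  qed
qed

section \<open>Green function and hitting probabilities\<close>

lemma killed_pow_kernel:
  "(killed_op \<xi> D ^^ n) g y = (\<integral>\<^sup>+x. (killed_op \<xi> D ^^ n) (indicator {x}) y * g x \<partial>count_space UNIV)"
proof (induction n arbitrary: y)
  case 0
  have "(\<integral>\<^sup>+x. indicator {x} y * g x \<partial>count_space UNIV) = (\<integral>\<^sup>+x. g y * indicator {y} x \<partial>count_space UNIV)"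
    by (intro nn_integral_cong) (auto simp: indicator_def)
  then show ?case by simp
next
  case (Suc n)
  let ?q = "\<lambda>x k. (killed_op \<xi> D ^^ n) (indicator {x}) (y + k)"
  have "(killed_op \<xi> D ^^ Suc n) g y =
      (\<integral>\<^sup>+k. indicator (- D) (y + k) * (\<integral>\<^sup>+x. ?q x k * g x \<partial>count_space UNIV) \<partial>measure_pmf \<xi>)"
    unfolding Suc[symmetric] by (simp add: killed_op_apply)
  also have "\<dots> = (\<integral>\<^sup>+k. (\<integral>\<^sup>+x. indicator (- D) (y + k) * (?q x k * g x) \<partial>count_space UNIV) \<partial>measure_pmf \<xi>)"
    by (simp add: nn_integral_cmult)
  also have "\<dots> = (\<integral>\<^sup>+x. (\<integral>\<^sup>+k. indicator (- D) (y + k) * (?q x k * g x) \<partial>measure_pmf \<xi>) \<partial>count_space UNIV)"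
    by (rule nn_integral_count_space_nn_integral) auto
  also have "\<dots> = (\<integral>\<^sup>+x. (killed_op \<xi> D ^^ Suc n) (indicator {x}) y * g x \<partial>count_space UNIV)"
    by (simp add: nn_integral_multc[symmetric] mult.assoc killed_op_apply)
  finally show ?case .
qed

lemma potential_kernel:
  "potential \<xi> D g y = (\<integral>\<^sup>+x. green \<xi> D y x * g x \<partial>count_space UNIV)"
  unfolding potential_def green_def
  by (subst killed_pow_kernel)
    (simp add: nn_integral_suminf[symmetric] ennreal_suminf_multc)

text \<open>Visits to \<open>x\<close> are counted by the row recursion. Its partial sums stay below their value
  at the starting point because counting measure is invariant.\<close>

lemma green_le_diag_row: "green \<xi> D y x \<le> green \<xi> D y y"
proof -
  let ?q = "\<lambda>i x. (killed_op \<xi> D ^^ i) (indicator {x}) y"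
  have diag: "(\<Sum>i<n. ?q i y) \<le> green \<xi> D y y" for n
    unfolding green_def potential_def by (intro sum_le_suminf) auto
  have "(\<Sum>i<n. ?q i x) \<le> green \<xi> D y y" for n
  proof (induction n arbitrary: x)
    case (Suc n)
    show ?case
    proof (cases "x = y")
      case False
      \<comment> \<open>Peeling off the last step, not the first, keeps the starting point
        \<open>y\<close> fixed while \<open>x\<close> varies.\<close>
      have "?q (Suc i) x = (\<integral>\<^sup>+w. ?q i w * killed_op \<xi> D (indicator {x}) w \<partial>count_space UNIV)" for i
        by (simp only: funpow_Suc_right o_def killed_pow_kernel[of i, where g = "killed_op \<xi> D (indicator {x})"])
      moreover have "killed_op \<xi> D (indicator {x}) w \<le> ennreal (pmf \<xi> (x - w))" for w
        using killed_op_le_step_op[of \<xi> D "indicator {x}" w] by (simp add: step_op_singleton)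
      ultimately have q: "?q (Suc i) x \<le> (\<integral>\<^sup>+w. ?q i w * ennreal (pmf \<xi> (x - w)) \<partial>count_space UNIV)" for i
        by (simp only:) (intro nn_integral_mono mult_left_mono, auto)
      have "(\<Sum>i<Suc n. ?q i x) = (\<Sum>i<n. ?q (Suc i) x)"
        using False by (simp only: sum.lessThan_Suc_shift) (simp add: indicator_def)
      also have "\<dots> \<le> (\<Sum>i<n. (\<integral>\<^sup>+w. ?q i w * ennreal (pmf \<xi> (x - w)) \<partial>count_space UNIV))"
        by (intro sum_mono q)
      also have "\<dots> = (\<integral>\<^sup>+w. (\<Sum>i<n. ?q i w) * ennreal (pmf \<xi> (x - w)) \<partial>count_space UNIV)"
        by (simp add: nn_integral_sum sum_distrib_right)
      also have "\<dots> \<le> (\<integral>\<^sup>+w. green \<xi> D y y * ennreal (pmf \<xi> (x - w)) \<partial>count_space UNIV)"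
        by (intro nn_integral_mono mult_right_mono Suc) auto
      also have "\<dots> = green \<xi> D y y * (\<integral>\<^sup>+w. ennreal (pmf \<xi> (x - w)) \<partial>count_space UNIV)"
        by (simp add: nn_integral_cmult)
      also have "(\<integral>\<^sup>+w. ennreal (pmf \<xi> (x - w)) \<partial>count_space UNIV) = 1"
        by (rule nn_integral_pmf_reflect)
      finally show ?thesis by simp
    qed (use diag[of "Suc n"] in simp)
  qed simp
  then show ?thesis
    unfolding green_def potential_def[of _ _ "indicator {x}"] by (intro suminf_le_const) auto
qed

text \<open>Visits to a killed point at positive times are discarded, which leaves the one at time
  \<open>0\<close>.\<close>

lemma green_self_killed: "x \<in> D \<Longrightarrow> green \<xi> D y x = indicator {x} y"
proof -
  assume x: "x \<in> D"
  have "killed_op \<xi> D (indicator {x}) = (\<lambda>w. 0)"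
  proof
    fix w
    have "(\<lambda>v. indicator (- D) v * indicator {x} v :: ennreal) = (\<lambda>v. 0)"
      using x by (auto simp: indicator_def)
    then show "killed_op \<xi> D (indicator {x}) w = 0" by (simp add: killed_op_def)
  qed
  then have "potential \<xi> D (indicator {x}) y \<le> indicator {x} y"
    by (intro potential_least) simp
  moreover have "indicator {x} y \<le> potential \<xi> D (indicator {x}) y"
    by (subst potential_unfold) simp
  ultimately show ?thesis by (simp add: green_def)
qed

text \<open>With a single entry point the reward after entry is a constant and factors out of
  \<open>potential_strong_markov\<close>.\<close>

lemma hit_before_strong_markov:
  assumes "x \<notin> D"
  shows "potential \<xi> D g y =
    potential \<xi> (D \<union> {x}) g y + hit_before \<xi> {x} D y * potential \<xi> D g x"
proof -
  have *: "(\<lambda>v. indicator ({x} - D) v * potential \<xi> D g v) = (\<lambda>v. potential \<xi> D g x * indicator {x} v)"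
    using assms by (auto simp: indicator_def)
  show ?thesis
    by (subst potential_strong_markov[where E = "{x}"], subst *)
      (simp add: step_op_cmult[abs_def] potential_add potential_cmult hit_before_def,
        simp add: mult.commute)
qed

lemma green_eq:
  assumes "x \<notin> D"
  shows "green \<xi> D y x = indicator {x} y + hit_before \<xi> {x} D y * green \<xi> D x x"
  using hit_before_strong_markov[OF assms, of \<xi> "indicator {x}" y]
  by (simp add: green_def[symmetric] green_self_killed)

lemma step_op_indicator_Un:
  "B \<inter> D = {} \<Longrightarrow> step_op \<xi> (indicator (B \<union> D)) w = step_op \<xi> (indicator B) w + step_op \<xi> (indicator D) w"
  unfolding step_op_add[symmetric]
  by (intro arg_cong[where f = "\<lambda>f. step_op \<xi> f w"] ext) (auto simp: indicator_def)

lemma hit_before_add: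
  assumes "B \<inter> D = {}"
  shows "hit_before \<xi> B D y + hit_before \<xi> D B y = potential \<xi> (B \<union> D) (step_op \<xi> (indicator (B \<union> D))) y"
  using step_op_indicator_Un[OF assms, abs_def, of \<xi>] unfolding hit_before_def
  by (simp add: Un_commute potential_add)

lemma potential_hit_le_1: "potential \<xi> D (step_op \<xi> (indicator D)) y \<le> 1"
proof (rule potential_least[where f = "\<lambda>_. 1"])
  fix w
  have "(\<lambda>v. indicator D v + indicator (- D) v * 1 :: ennreal) = (\<lambda>v. 1)"
    by (auto simp: indicator_def)
  then show "step_op \<xi> (indicator D) w + killed_op \<xi> D (\<lambda>_. 1) w \<le> 1"
    unfolding killed_op_def step_op_add[symmetric] by simp
qed

lemma hit_before_le_1: "hit_before \<xi> B D y \<le> 1"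
proof -
  have "hit_before \<xi> B D y \<le> potential \<xi> B (step_op \<xi> (indicator B)) y"
    unfolding hit_before_def by (intro potential_mono) auto
  with potential_hit_le_1[of \<xi> B y] show ?thesis by simp
qed

text \<open>The number of visits to \<open>x\<close> is geometric with failure probability
  \<^term>\<open>hit_before \<xi> {x} D x\<close>.\<close>

lemma green_diag:
  assumes x: "x \<notin> D" and u: "hit_before \<xi> {x} D x < 1"
  shows "green \<xi> D x x = ennreal (1 / (1 - enn2real (hit_before \<xi> {x} D x)))"
proof -
  define u where "u = enn2real (hit_before \<xi> {x} D x)"
  have hu: "hit_before \<xi> {x} D x = ennreal u" and u1: "u < 1" and u0: "0 \<le> u"
    using u by (cases "hit_before \<xi> {x} D x"; auto simp: u_def ennreal_less_one_iff)+
  define c where "c = 1 / (1 - u)"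
  have c0: "0 \<le> c" and cc: "1 + c * u = c"
    using u1 by (auto simp: c_def field_simps)
  \<comment> \<open>This is the right side of \<open>green_eq\<close> with \<open>c\<close> in place
    of the unknown diagonal value. As a supersolution it shows that the value is finite, and
    \<open>green_eq\<close> can then be solved in the reals.\<close>
  define f where "f = (\<lambda>w. indicator {x} w + hit_before \<xi> {x} D w * ennreal c)"
  have fx: "f x = ennreal c"
    using u0 c0 cc by (simp add: f_def hu mult.commute flip: ennreal_mult ennreal_1 ennreal_plus)
  have kf: "killed_op \<xi> D f w = hit_before \<xi> {x} D w * ennreal c" for w
  proof -
    have "(\<lambda>v. indicator ({x} - D) v * f v) = (\<lambda>v. ennreal c * indicator {x} v)"
      using x fx by (auto simp: indicator_def)
    moreover have "killed_op \<xi> (D \<union> {x}) f w = killed_op \<xi> (D \<union> {x}) (\<lambda>w. ennreal c * hit_before \<xi> {x} D w) w"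
      unfolding killed_op_def
      by (intro arg_cong[where f = "\<lambda>f. step_op \<xi> f w"] ext) (auto simp: indicator_def f_def mult.commute)
    ultimately have "killed_op \<xi> D f w =
        ennreal c * (step_op \<xi> (indicator {x}) w + killed_op \<xi> (D \<union> {x}) (hit_before \<xi> {x} D) w)"
      by (subst killed_op_split[where E = "{x}"]) (simp add: step_op_cmult killed_op_cmult distrib_left)
    also have "\<dots> = ennreal c * hit_before \<xi> {x} D w"
      unfolding hit_before_def potential_unfold[of \<xi> "{x} \<union> D" "step_op \<xi> (indicator {x})" w]
      by (simp only: Un_commute)
    finally show ?thesis by (simp add: mult.commute)
  qed
  have "green \<xi> D x x \<le> f x"
    unfolding green_def by (rule potential_least) (simp add: kf, simp add: f_def)
  then have le: "green \<xi> D x x \<le> ennreal c" by (simp add: fx)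
  then obtain r where r: "green \<xi> D x x = ennreal r" "0 \<le> r"
    by (cases "green \<xi> D x x") (auto simp: top_unique)
  have "ennreal r = 1 + ennreal u * ennreal r"
    using green_eq[OF x, of \<xi> x] by (simp add: r hu)
  then have "r = 1 + u * r"
    using r u0 by (simp flip: ennreal_mult ennreal_1 ennreal_plus)
  then have "r = c" using u1 by (simp add: c_def field_simps)
  then show ?thesis by (simp add: r c_def u_def)
qed

text \<open>Split the visits to \<open>x\<close> at the first visit to \<open>y\<close>. The earlier
  ones precede \<open>y\<close>, and the later ones number at most
  \<open>green \<xi> {z} y x\<close>, which \<open>green_le_diag_row\<close> bounds by the diagonal
  value at \<open>y\<close>.\<close>

lemma green_triangle:
  assumes "x \<noteq> y" "y \<noteq> z"
  shows "green \<xi> {z} x x \<le> green \<xi> {y} x x + green \<xi> {z} y y"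
proof -
  have "green \<xi> {z} x x = potential \<xi> ({z} \<union> {y}) (indicator {x}) x + hit_before \<xi> {y} {z} x * green \<xi> {z} y x"
    using hit_before_strong_markov[of y "{z}" \<xi> "indicator {x}" x] assms by (simp add: green_def)
  also have "\<dots> \<le> green \<xi> {y} x x + 1 * green \<xi> {z} y y"
    unfolding green_def[of \<xi> "{y}"]
    by (intro add_mono potential_mono mult_mono hit_before_le_1 green_le_diag_row) auto
  finally show ?thesis by simp
qed

section \<open>Translation invariance\<close>

lemma step_op_translate: "step_op \<xi> (\<lambda>w. f (w + t)) y = step_op \<xi> f (y + t)"
  by (simp add: step_op_def algebra_simps)

lemma killed_op_translate: "killed_op \<xi> D (\<lambda>w. f (w + t)) y = killed_op \<xi> ((\<lambda>w. w + t) ` D) f (y + t)"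
proof -
  have "(indicator (- D) w :: ennreal) = indicator (- (\<lambda>w. w + t) ` D) (w + t)" for w
    by (auto simp: indicator_def)
  then show ?thesis
    unfolding killed_op_def by (simp only: step_op_translate[symmetric])
qed

lemma killed_pow_translate:
  "(killed_op \<xi> D ^^ n) (\<lambda>w. f (w + t)) y = (killed_op \<xi> ((\<lambda>w. w + t) ` D) ^^ n) f (y + t)"
proof (induction n arbitrary: y)
  case (Suc n)
  then have "(killed_op \<xi> D ^^ n) (\<lambda>w. f (w + t)) = (\<lambda>w. (killed_op \<xi> ((\<lambda>w. w + t) ` D) ^^ n) f (w + t))"
    by auto
  then show ?case by (simp add: killed_op_translate)
qed simp

lemma potential_translate:
  "potential \<xi> D (\<lambda>w. f (w + t)) y = potential \<xi> ((\<lambda>w. w + t) ` D) f (y + t)"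
  by (simp add: potential_def killed_pow_translate)

lemma indicator_translate:
  "(indicator B :: int \<Rightarrow> ennreal) = (\<lambda>w. indicator ((\<lambda>w. w + t) ` B) (w + t))"
  by (rule ext) (auto simp: indicator_def)

lemma green_translate: "green \<xi> ((\<lambda>w. w + t) ` D) (y + t) (x + t) = green \<xi> D y x"
  unfolding green_def indicator_translate[of "{x}" t] by (simp add: potential_translate)

lemma hit_before_translate:
  "hit_before \<xi> ((\<lambda>w. w + t) ` B) ((\<lambda>w. w + t) ` D) (y + t) = hit_before \<xi> B D y"
proof -
  have "step_op \<xi> (indicator B) = (\<lambda>w. step_op \<xi> (indicator ((\<lambda>w. w + t) ` B)) (w + t))"
    by (subst indicator_translate[of B t]) (simp add: step_op_translate[of _ _ t, abs_def])
  then show ?thesis unfolding hit_before_def by (simp add: potential_translate image_Un)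
qed

section \<open>Recurrence and effective resistance\<close>

lemma killed_op_empty: "killed_op \<xi> {} = step_op \<xi>"
  by (simp add: fun_eq_iff killed_op_def)

text \<open>One-step maximum principle: it makes the set where a hitting probability equals
  \<open>1\<close> closed under steps.\<close>

lemma nn_integral_pmf_eq_1_imp:
  fixes f :: "'a \<Rightarrow> ennreal"
  assumes le: "\<And>k. f k \<le> 1" and int: "(\<integral>\<^sup>+k. f k \<partial>measure_pmf p) = 1" and k: "k \<in> set_pmf p"
  shows "f k = 1"
proof -
  have "(\<integral>\<^sup>+k. 1 - f k \<partial>measure_pmf p) = (\<integral>\<^sup>+k. 1 \<partial>measure_pmf p) - (\<integral>\<^sup>+k. f k \<partial>measure_pmf p)"
    using int le by (intro nn_integral_diff) auto
  then have "(\<integral>\<^sup>+k. 1 - f k \<partial>measure_pmf p) = 0" by (simp add: int)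
  then have "AE k in measure_pmf p. 1 - f k = 0"
    by (subst (asm) nn_integral_0_iff_AE) auto
  then have "1 - f k = 0" using k by (simp add: AE_measure_pmf_iff)
  then show ?thesis using le[of k] by (simp add: ennreal_minus_eq_0 antisym)
qed

text \<open>Irreducibility is phrased through closed sets because the maximum principle produces
  such sets; \<open>aperiodic_walk_irreducible\<close> derives this form.\<close>

locale centered_walk =
  fixes \<xi> :: "int pmf"
  assumes irreducible:
      "\<And>C x. x \<in> C \<Longrightarrow> (\<And>w k. w \<in> C \<Longrightarrow> k \<in> set_pmf \<xi> \<Longrightarrow> w + k \<in> C) \<Longrightarrow> C = (UNIV :: int set)"
    and second_moment: "(\<integral>\<^sup>+k. ennreal ((real_of_int k)\<^sup>2) \<partial>measure_pmf \<xi>) < \<infinity>"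
    and centered: "measure_pmf.expectation \<xi> real_of_int = 0"
begin

abbreviation "\<sigma>2 \<equiv> measure_pmf.expectation \<xi> (\<lambda>k. (real_of_int k)\<^sup>2)"

lemma integrable_square: "integrable (measure_pmf \<xi>) (\<lambda>k. (real_of_int k)\<^sup>2)"
  using second_moment by (intro integrableI_bounded) auto

lemma integrable_id: "integrable (measure_pmf \<xi>) real_of_int"
proof (rule Bochner_Integration.integrable_bound[OF integrable_square])
  have "\<bar>real_of_int k\<bar> \<le> (real_of_int k)\<^sup>2" for k
  proof -
    have "\<bar>k\<bar> \<le> k\<^sup>2"
      using self_le_power[of "\<bar>k\<bar>" 2] by (cases "k = 0") auto
    then have "real_of_int \<bar>k\<bar> \<le> real_of_int (k\<^sup>2)" by (simp only: of_int_le_iff)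
    then show ?thesis by simp
  qed
  then show "AE x in measure_pmf \<xi>. norm (real_of_int x) \<le> norm ((real_of_int x)\<^sup>2)"
    by simp
qed auto

lemma step_op_square: "step_op \<xi> (\<lambda>w. ennreal ((real_of_int w)\<^sup>2 + c)) y = ennreal ((real_of_int y)\<^sup>2 + \<sigma>2 + c)"
  if "c \<ge> 0" for c
proof -
  have eq: "(real_of_int (y + k))\<^sup>2 + c = (real_of_int y)\<^sup>2 + c + (2 * real_of_int y * real_of_int k + (real_of_int k)\<^sup>2)" for k
    by (simp add: power2_eq_square algebra_simps)
  have int: "integrable (measure_pmf \<xi>) (\<lambda>k. (real_of_int (y + k))\<^sup>2 + c)"
    unfolding eq using integrable_square integrable_id by (intro Bochner_Integration.integrable_add) auto
  have "step_op \<xi> (\<lambda>w. ennreal ((real_of_int w)\<^sup>2 + c)) y =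
      ennreal (\<integral>k. (real_of_int (y + k))\<^sup>2 + c \<partial>measure_pmf \<xi>)"
    unfolding step_op_def using that by (intro nn_integral_eq_integral int) auto
  also have "(\<integral>k. (real_of_int (y + k))\<^sup>2 + c \<partial>measure_pmf \<xi>) = (real_of_int y)\<^sup>2 + \<sigma>2 + c"
    unfolding eq using integrable_square integrable_id centered
    by (subst Bochner_Integration.integral_add) (auto simp: measure_pmf.prob_space)
  finally show ?thesis .
qed

lemma step_pow_square: "(step_op \<xi> ^^ n) (\<lambda>w. ennreal ((real_of_int w)\<^sup>2)) = (\<lambda>y. ennreal ((real_of_int y)\<^sup>2 + n * \<sigma>2))"
proof (induction n)
  case (Suc n)
  show ?case
    by (rule ext, simp only: funpow.simps o_def Suc, subst step_op_square)
      (auto simp: algebra_simps intro!: mult_nonneg_nonneg Bochner_Integration.integral_nonneg)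
qed simp

lemma step_pow_one: "(step_op \<xi> ^^ n) (\<lambda>w. 1) = (\<lambda>y. 1)"
  by (induction n) auto

text \<open>Chebyshev's inequality for the position after \<open>n\<close> steps, whose variance is
  \<open>n * \<sigma>2\<close>.\<close>

lemma prob_outside:
  fixes R :: int
  assumes "R > 0"
  shows "(\<integral>\<^sup>+x. (killed_op \<xi> {} ^^ n) (indicator {x}) 0 * indicator {x. \<bar>x\<bar> > R} x \<partial>count_space UNIV)
    \<le> ennreal (n * \<sigma>2 / (real_of_int R)\<^sup>2)"
proof -
  let ?q = "\<lambda>x. (killed_op \<xi> {} ^^ n) (indicator {x}) 0"
  have "(\<integral>\<^sup>+x. ?q x * indicator {x. \<bar>x\<bar> > R} x \<partial>count_space UNIV)
      \<le> (\<integral>\<^sup>+x. ennreal (1 / (real_of_int R)\<^sup>2) * (?q x * ennreal ((real_of_int x)\<^sup>2)) \<partial>count_space UNIV)"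
  proof (rule nn_integral_mono)
    fix x :: int
    have "indicator {x. \<bar>x\<bar> > R} x \<le> ennreal (1 / (real_of_int R)\<^sup>2 * (real_of_int x)\<^sup>2)"
    proof (cases "\<bar>x\<bar> > R")
      case True
      then have "real_of_int R \<le> \<bar>real_of_int x\<bar>" by linarith
      then have "(real_of_int R)\<^sup>2 \<le> (real_of_int x)\<^sup>2"
        using assms by (subst power2_abs[of "real_of_int x", symmetric], intro power_mono) auto
      then show ?thesis using True assms by (auto simp: field_simps)
    qed auto
    then have "?q x * indicator {x. \<bar>x\<bar> > R} x \<le> ?q x * ennreal (1 / (real_of_int R)\<^sup>2 * (real_of_int x)\<^sup>2)"
      by (rule mult_left_mono) auto
    then show "?q x * indicator {x. \<bar>x\<bar> > R} x \<le> ennreal (1 / (real_of_int R)\<^sup>2) * (?q x * ennreal ((real_of_int x)\<^sup>2))"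
      by (simp only: ennreal_mult'' zero_le_power2 mult.left_commute)
  qed
  also have "\<dots> = ennreal (1 / (real_of_int R)\<^sup>2) * (killed_op \<xi> {} ^^ n) (\<lambda>x. ennreal ((real_of_int x)\<^sup>2)) 0"
    by (subst (2) killed_pow_kernel) (simp add: nn_integral_cmult)
  also have "\<dots> = ennreal (1 / (real_of_int R)\<^sup>2 * (n * \<sigma>2))"
    by (subst ennreal_mult') (simp_all add: killed_op_empty step_pow_square)
  finally show ?thesis by simp
qed

text \<open>During \<open>M\<^sup>2\<close> steps the walk is in a window of radius
  \<open>v * M\<close> with probability at least \<open>1/2\<close> each time, so the window
  receives at least \<open>M\<^sup>2 / 2\<close> visits on average. If the Green function were
  finite, \<open>green_le_diag_row\<close> would allow only a multiple of the window length, which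
  is linear in \<open>M\<close>.\<close>

lemma green_infinite: "green \<xi> {} 0 0 = \<infinity>"
proof (rule ccontr)
  assume "green \<xi> {} 0 0 \<noteq> \<infinity>"
  then obtain g where g: "green \<xi> {} 0 0 = ennreal g" "g \<ge> 0"
    by (cases "green \<xi> {} 0 0") auto
  define q where "q = (\<lambda>n x. (killed_op \<xi> {} ^^ n) (indicator {x}) 0)"
  have \<sigma>: "\<sigma>2 \<ge> 0" by (intro Bochner_Integration.integral_nonneg) auto
  \<comment> \<open>Chosen so that \<open>2 * \<sigma>2 \<le> v\<^sup>2\<close>: Chebyshev at radius
    \<open>v * M\<close> then leaves at most \<open>1/2\<close> outside for all
    \<open>n < M\<^sup>2\<close>.\<close>
  obtain v :: nat where v: "2 * \<sigma>2 + 1 \<le> real v" using real_arch_simple by blast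
  then have v1: "1 \<le> real v" using \<sigma> by linarith
  have v2: "2 * \<sigma>2 \<le> (real v)\<^sup>2"
    using v v1 \<sigma> self_le_power[of "real v" 2] by linarith
  have main: "real M ^ 2 / 2 \<le> (2 * (v * M) + 1) * g" if M: "M > 0" for M :: nat
  proof -
    define R where "R = int (v * M)"
    have R0: "R > 0" using M v1 by (simp add: R_def)
    have half: "ennreal (1/2) \<le> (\<integral>\<^sup>+x. q n x * indicator {x. \<bar>x\<bar> \<le> R} x \<partial>count_space UNIV)" (is "_ \<le> ?in") if n: "n < M\<^sup>2" for n
    proof -
      have "real n * \<sigma>2 \<le> (real M)\<^sup>2 * ((real v)\<^sup>2 / 2)"
        using n v2 \<sigma> by (intro mult_mono) (auto simp flip: of_nat_power)
      then have "n * \<sigma>2 / (real_of_int R)\<^sup>2 \<le> 1/2"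
        using M v1 by (simp add: R_def field_simps power_mult_distrib)
      then have out: "(\<integral>\<^sup>+x. q n x * indicator {x. \<bar>x\<bar> > R} x \<partial>count_space UNIV) \<le> ennreal (1/2)" (is "?out \<le> _")
        unfolding q_def by (intro order_trans[OF prob_outside[OF R0]] ennreal_leI)
      have "?out + ?in = (\<integral>\<^sup>+x. q n x * 1 \<partial>count_space UNIV)"
        by (subst nn_integral_add[symmetric]) (auto intro!: nn_integral_cong simp: indicator_def)
      also have "\<dots> = (killed_op \<xi> {} ^^ n) (\<lambda>w. 1) 0"
        unfolding q_def by (rule killed_pow_kernel[symmetric])
      finally have "?out + ?in = 1" by (simp add: killed_op_empty step_pow_one)
      then have "1 \<le> ennreal (1/2) + ?in" using add_right_mono[OF out, of ?in] by simp
      moreover have "(1::ennreal) = ennreal (1/2) + ennreal (1/2)"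
        by (subst ennreal_plus[symmetric]) auto
      ultimately have "ennreal (1/2) + ennreal (1/2) \<le> ennreal (1/2) + ?in" by (simp only:)
      then show ?thesis unfolding ennreal_add_left_cancel_le by simp
    qed
    have "ennreal (real M ^ 2 / 2) = (\<Sum>n<M\<^sup>2. ennreal (1/2))"
      by (subst sum_ennreal) simp_all
    also have "\<dots> \<le> (\<Sum>n<M\<^sup>2. \<integral>\<^sup>+x. q n x * indicator {x. \<bar>x\<bar> \<le> R} x \<partial>count_space UNIV)"
      by (intro sum_mono half) auto
    also have "\<dots> = (\<integral>\<^sup>+x. (\<Sum>n<M\<^sup>2. q n x) * indicator {x. \<bar>x\<bar> \<le> R} x \<partial>count_space UNIV)"
      by (simp only: sum_distrib_right) (rule nn_integral_sum[symmetric], simp)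
    also have "\<dots> \<le> (\<integral>\<^sup>+x. ennreal g * indicator {-R..R} x \<partial>count_space UNIV)"
    proof (intro nn_integral_mono mult_mono)
      fix x
      have "(\<Sum>n<M\<^sup>2. q n x) \<le> green \<xi> {} 0 x"
        unfolding q_def green_def potential_def by (intro sum_le_suminf) auto
      then show "(\<Sum>n<M\<^sup>2. q n x) \<le> ennreal g"
        using green_le_diag_row[of \<xi> "{}" 0 x] g by simp
    qed (auto simp: indicator_def)
    also have "\<dots> = ennreal g * ennreal (2 * (v * M) + 1)"
      using R0 by (subst nn_integral_cmult) (auto simp: R_def ennreal_of_nat_eq_real_of_nat nat_add_distrib nat_mult_distrib mult.commute)
    finally have "ennreal (real M ^ 2 / 2) \<le> ennreal (g * (2 * (v * M) + 1))"
      using g by (simp only: ennreal_mult')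
    then show ?thesis using g by (subst (asm) ennreal_le_iff) (auto simp: mult.commute)
  qed
  obtain M :: nat where M: "2 * (2 * v + 1) * g + 1 \<le> real M" using real_arch_simple by blast
  have "0 \<le> real (2 * (2 * v + 1)) * g" using g by (intro mult_nonneg_nonneg) auto
  then have "real M > 0" using M by linarith
  then have "M > 0" by simp
  have "(2 * (v * M) + 1) * g \<le> (2 * v + 1) * g * M"
    using \<open>M > 0\<close> g by (auto simp: algebra_simps mult_le_cancel_left1)
  moreover have "(2 * (2 * v + 1) * g + 1) * M \<le> real M ^ 2"
    using M \<open>M > 0\<close> by (simp add: power2_eq_square)
  ultimately show False using main[OF \<open>M > 0\<close>] \<open>M > 0\<close> by (simp add: algebra_simps)
qed

text \<open>A return probability below \<open>1\<close> would make the Green function finite by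
  \<open>green_diag\<close>. The maximum principle carries the value \<open>1\<close> from
  \<open>0\<close> to every point.\<close>

lemma hits_zero: "hit_before \<xi> {0} {} y = 1"
proof -
  let ?h = "hit_before \<xi> {0} {}"
  have h0: "?h 0 = 1"
  proof (rule ccontr)
    assume "?h 0 \<noteq> 1"
    then have "?h 0 < 1" using hit_before_le_1[of \<xi> "{0}" "{}" 0] by (simp add: order_less_le)
    from green_diag[OF _ this] green_infinite show False by simp
  qed
  \<comment> \<open>Because \<open>?h 0 = 1\<close> agrees with the boundary value at
    \<open>0\<close>, the function is harmonic there too.\<close>
  have step: "?h w = step_op \<xi> ?h w" for w
  proof -
    have "?h w = step_op \<xi> (indicator {0}) w + killed_op \<xi> {0} ?h w"
      unfolding hit_before_def by (subst potential_unfold) simp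
    also have "\<dots> = step_op \<xi> ?h w"
      unfolding killed_op_def step_op_add[symmetric]
      by (intro arg_cong[where f = "\<lambda>f. step_op \<xi> f w"] ext) (auto simp: indicator_def h0)
    finally show ?thesis .
  qed
  have "{w. ?h w = 1} = UNIV"
  proof (rule irreducible[of 0])
    fix w k assume "w \<in> {w. ?h w = 1}" "k \<in> set_pmf \<xi>"
    then show "w + k \<in> {w. ?h w = 1}"
      using nn_integral_pmf_eq_1_imp[of "\<lambda>k. ?h (w + k)" \<xi> k] step[of w] hit_before_le_1
      by (auto simp: step_op_def)
  qed (use h0 in simp)
  then show ?thesis by auto
qed

lemma hits_point: "hit_before \<xi> {a} {} y = 1"
  using hit_before_translate[of \<xi> a "{0}" "{}" "y - a"] hits_zero by simp

text \<open>Pick \<open>a\<close> in \<open>T\<close> and decompose the certain visit to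
  \<open>a\<close> at the entry into \<open>T\<close>: whichever point is entered, the rest has
  probability \<open>1\<close>.\<close>

lemma hits_set:
  assumes "T \<noteq> {}"
  shows "potential \<xi> T (step_op \<xi> (indicator T)) y = 1"
proof -
  obtain a where a: "a \<in> T" using assms by auto
  have eq: "potential \<xi> {a} (step_op \<xi> (indicator {a})) w = 1" for w
    using hits_point[of a w] by (simp add: hit_before_def)
  have "1 = potential \<xi> ({a} \<union> T) (\<lambda>w. step_op \<xi> (indicator {a}) w + step_op \<xi> (\<lambda>v. indicator (T - {a}) v * 1) w) y"
    using potential_strong_markov[of \<xi> "{a}" "step_op \<xi> (indicator {a})" y T] by (simp add: eq)
  also have "(\<lambda>w. step_op \<xi> (indicator {a}) w + step_op \<xi> (\<lambda>v. indicator (T - {a}) v * 1) w) = step_op \<xi> (indicator T)"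
    unfolding step_op_add[symmetric] using a
    by (intro ext arg_cong[where f = "\<lambda>f. step_op \<xi> f _"]) (auto simp: indicator_def)
  also have "{a} \<union> T = T" using a by auto
  finally show ?thesis by simp
qed

lemma hit_before_complement:
  assumes "B \<inter> D = {}" "B \<noteq> {}"
  shows "hit_before \<xi> B D y + hit_before \<xi> D B y = 1"
  using hit_before_add[OF assms(1), of \<xi> y] hits_set[of "B \<union> D"] assms by simp

text \<open>If the return to \<open>x\<close> before \<open>z\<close> were certain, the set of
  points with value \<open>1\<close> would be closed under steps, hence contain
  \<open>z\<close>.\<close>

lemma hit_before_less_1:
  assumes "x \<noteq> z"
  shows "hit_before \<xi> {x} {z} x < 1"
proof (rule ccontr)
  let ?e = "hit_before \<xi> {x} {z}"
  assume "\<not> ?e x < 1"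
  then have ex: "?e x = 1" using hit_before_le_1[of \<xi> "{x}" "{z}" x] by (simp add: order_less_le)
  \<comment> \<open>Since hitting times are positive, \<open>?e\<close> at \<open>x\<close> and
    \<open>z\<close> is a return probability; \<open>e'\<close> puts in the boundary values
    \<open>1\<close> and \<open>0\<close>.\<close>
  define e' where "e' = (\<lambda>w. if w = x then 1 else if w = z then 0 else ?e w)"
  have step: "?e w = step_op \<xi> e' w" for w
  proof -
    have "?e w = step_op \<xi> (indicator {x}) w + killed_op \<xi> {x, z} ?e w"
      unfolding hit_before_def by (subst potential_unfold) (simp add: insert_commute)
    also have "\<dots> = step_op \<xi> e' w"
      unfolding killed_op_def step_op_add[symmetric]
      by (intro arg_cong[where f = "\<lambda>f. step_op \<xi> f w"] ext) (auto simp: indicator_def e'_def)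
    finally show ?thesis .
  qed
  have e'1: "e' w \<le> 1" for w using hit_before_le_1 by (auto simp: e'_def)
  have "{w. e' w = 1} = UNIV"
  proof (rule irreducible[of x])
    fix w k assume w: "w \<in> {w. e' w = 1}" "k \<in> set_pmf \<xi>"
    then have "?e w = 1" using ex by (auto simp: e'_def split: if_splits)
    then show "w + k \<in> {w. e' w = 1}"
      using nn_integral_pmf_eq_1_imp[of "\<lambda>k. e' (w + k)" \<xi> k] step[of w] e'1 w
      by (auto simp: step_op_def)
  qed (simp add: e'_def)
  then have "e' z = 1" by auto
  then show False using assms by (auto simp: e'_def)
qed

lemma hit_before_point_antimono: "D \<subseteq> D' \<Longrightarrow> hit_before \<xi> B D' y \<le> hit_before \<xi> B D y"
  unfolding hit_before_def by (intro potential_mono) auto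

lemma green_finite: "x \<noteq> z \<Longrightarrow> green \<xi> {z} x x < \<infinity>"
  using green_diag[of x "{z}" \<xi>] hit_before_less_1[of x z] by simp

text \<open>The effective resistance \<^term>\<open>green \<xi> {z} x x\<close> is a subadditive function of \<open>x - z\<close>.\<close>

lemma green_linear:
  obtains C where "C > 0" "\<And>x z. x \<noteq> z \<Longrightarrow> green \<xi> {z} x x \<le> ennreal (C * \<bar>real_of_int (x - z)\<bar>)"
proof -
  define r where "r = (\<lambda>x. green \<xi> {0} x x)"
  have r: "green \<xi> {z} x x = r (x - z)" for x z
    using green_translate[of \<xi> z "{0}" "x - z" "x - z"] by (simp add: r_def)
  have tri: "r (m + n) \<le> r m + r n" if "m \<noteq> 0" "n \<noteq> 0" for m n
    using green_triangle[of "m + n" n 0 \<xi>] that r[of n "m + n"] r[of "m + n" n] by (simp add: r_def)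
  have fin: "r m < \<infinity>" if "m \<noteq> 0" for m
    using green_finite[of m 0] that by (simp add: r_def)
  \<comment> \<open>Subadditivity climbs in steps \<open>1\<close> or \<open>- 1\<close>, so both
    unit values enter; the last summand makes \<open>C\<close> positive.\<close>
  define C where "C = enn2real (r 1) + enn2real (r (- 1)) + 1"
  have C: "C > 0" by (simp add: C_def add_nonneg_pos)
  have r1: "r 1 \<le> ennreal C" "r (- 1) \<le> ennreal C"
    using fin[of 1] fin[of "- 1"] by (cases "r 1"; cases "r (- 1)"; auto simp: C_def intro!: ennreal_leI)+
  have pos: "r (int (Suc n)) \<le> ennreal (C * Suc n)" "r (- int (Suc n)) \<le> ennreal (C * Suc n)" for n
  proof (induction n)
    case (Suc n)
    have "r (int (Suc (Suc n))) \<le> r (int (Suc n)) + r 1" "r (- int (Suc (Suc n))) \<le> r (- int (Suc n)) + r (- 1)"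
      using tri[of "int (Suc n)" 1] tri[of "- int (Suc n)" "- 1"] by (simp_all add: add.commute)
    moreover have "ennreal (C * Suc n) + ennreal C = ennreal (C * Suc (Suc n))"
      using C by (simp add: algebra_simps flip: ennreal_plus)
    ultimately show "r (int (Suc (Suc n))) \<le> ennreal (C * Suc (Suc n))" "r (- int (Suc (Suc n))) \<le> ennreal (C * Suc (Suc n))"
      using Suc r1 add_mono by (metis order_trans)+
  qed (use r1 in simp_all)
  have "green \<xi> {z} x x \<le> ennreal (C * \<bar>real_of_int (x - z)\<bar>)" if "x \<noteq> z" for x z
  proof (cases "x > z")
    case True
    then obtain n where "x - z = int (Suc n)" by (metis zero_less_imp_eq_int diff_gt_0_iff_gt gr0_implies_Suc)
    then show ?thesis using pos(1)[of n] by (simp add: r)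
  next
    case False
    then have "z - x > 0" using that by simp
    then obtain n where "z - x = int (Suc n)" by (metis zero_less_imp_eq_int gr0_implies_Suc)
    then have "x - z = - int (Suc n)" by simp
    then show ?thesis using pos(2)[of n] by (simp add: r add.commute)
  qed
  with C that show thesis by blast
qed

end

section \<open>Hitting times of the path measure\<close>

text \<open>A nonempty set of \<open>enat\<close> attains its infimum. The index
  \<open>Suc n\<close> reflects that only positive times count and matches the \<open>n\<close>th
  term of \<open>hit_before\<close>.\<close>

lemma hit_time_less_iff:
  assumes "B \<inter> D = {}"
  shows "hit_time B R < hit_time D R \<longleftrightarrow> (\<exists>n. R (Suc n) \<in> B \<and> (\<forall>j\<in>{1..n}. R j \<notin> B \<union> D))"
proof
  assume less: "hit_time B R < hit_time D R"
  let ?T = "{enat n | n. n > 0 \<and> R n \<in> B}"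
  have "?T \<noteq> {}"
  proof
    assume "?T = {}"
    then have "hit_time B R = \<infinity>" by (simp only: hit_time_def Inf_empty top_enat_def)
    with less show False by simp
  qed
  then obtain t where "t \<in> ?T" by blast
  then have "Inf ?T \<in> ?T" by (rule wellorder_InfI)
  then obtain N where N: "hit_time B R = enat N" "N > 0" "R N \<in> B" unfolding hit_time_def by auto
  have notB: "R j \<notin> B" if "0 < j" "j < N" for j
  proof
    assume "R j \<in> B"
    then have "hit_time B R \<le> enat j" unfolding hit_time_def using that by (intro Inf_lower) auto
    with N that show False by simp
  qed
  have notD: "R j \<notin> D" if "0 < j" "j < N" for j
  proof
    assume "R j \<in> D"
    then have "hit_time D R \<le> enat j" unfolding hit_time_def using that by (intro Inf_lower) auto
    with less have "hit_time B R < enat j" by (rule less_le_trans)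
    with N that show False by simp
  qed
  show "\<exists>n. R (Suc n) \<in> B \<and> (\<forall>j\<in>{1..n}. R j \<notin> B \<union> D)"
    using N notB notD by (intro exI[of _ "N - 1"]) auto
next
  assume "\<exists>n. R (Suc n) \<in> B \<and> (\<forall>j\<in>{1..n}. R j \<notin> B \<union> D)"
  then obtain n where n: "R (Suc n) \<in> B" "\<And>j. j \<in> {1..n} \<Longrightarrow> R j \<notin> B \<union> D" by blast
  have le: "hit_time B R \<le> enat (Suc n)" unfolding hit_time_def using n by (intro Inf_lower) auto
  have ge: "enat (Suc (Suc n)) \<le> hit_time D R"
    unfolding hit_time_def
  proof (rule Inf_greatest)
    fix t assume "t \<in> {enat n | n. n > 0 \<and> R n \<in> D}"
    then obtain m where m: "t = enat m" "m > 0" "R m \<in> D" by auto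
    have "\<not> m \<le> Suc n"
      using n(1) n(2)[of m] m assms by (cases "m = Suc n") auto
    then show "enat (Suc (Suc n)) \<le> t" using m by simp
  qed
  show "hit_time B R < hit_time D R"
    by (rule le_less_trans[OF le less_le_trans[OF _ ge]]) simp
qed

text \<open>Splitting off the first step by \<open>PiM_iter\<close> turns the event for
  \<open>Suc n\<close> into the one for \<open>n\<close> from the new position, which is the
  recursion of \<open>killed_op\<close>. First entrances at different times are disjoint, hence the
  series.\<close>

lemma emeasure_hit_time_less:
  assumes disj: "B \<inter> D = {}"
  shows "emeasure (walk_law \<xi> y) {R \<in> space (walk_law \<xi> y). hit_time B R < hit_time D R} = hit_before \<xi> B D y"
proof -
  interpret sequence_space "measure_pmf \<xi>" ..
  let ?E = "\<lambda>n y. {s \<in> space S. walk y s (Suc n) \<in> B \<and> (\<forall>j\<in>{1..n}. walk y s j \<notin> B \<union> D)}"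
  have [measurable]: "(\<lambda>s. walk y s n) \<in> measurable S (count_space UNIV)" for y n
    by (rule measurable_compose[OF measurable_walk measurable_component_singleton]) auto
  have E: "?E n y \<in> sets S" for n y by measurable
  have shift: "walk y (case_nat k s) (Suc j) = walk (y + k) s j" for y k s j
    unfolding walk_def sum.lessThan_Suc_shift by simp
  have iter: "emeasure S X = (\<integral>\<^sup>+k. emeasure S {s \<in> space S. case_nat k s \<in> X} \<partial>measure_pmf \<xi>)"
    if [measurable]: "X \<in> sets S" for X
  proof -
    have [measurable]: "(\<lambda>(k, s). case_nat k s) \<in> measurable (measure_pmf \<xi> \<Otimes>\<^sub>M S) S"
      by (simp add: split_beta')
    have "emeasure S X = emeasure (distr (measure_pmf \<xi> \<Otimes>\<^sub>M S) S (\<lambda>(k, s). case_nat k s)) X"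
      by (subst PiM_iter) simp
    also have "\<dots> = emeasure (measure_pmf \<xi> \<Otimes>\<^sub>M S) ((\<lambda>(k, s). case_nat k s) -` X \<inter> space (measure_pmf \<xi> \<Otimes>\<^sub>M S))"
      by (rule emeasure_distr) measurable
    also have "\<dots> = (\<integral>\<^sup>+k. emeasure S (Pair k -` ((\<lambda>(k, s). case_nat k s) -` X \<inter> space (measure_pmf \<xi> \<Otimes>\<^sub>M S))) \<partial>measure_pmf \<xi>)"
      by (rule P.emeasure_pair_measure_alt) measurable
    also have "\<dots> = (\<integral>\<^sup>+k. emeasure S {s \<in> space S. case_nat k s \<in> X} \<partial>measure_pmf \<xi>)"
      by (intro nn_integral_cong arg_cong[where f = "emeasure S"]) (auto simp: space_pair_measure)
    finally show ?thesis .
  qed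
  have space_case: "case_nat k s \<in> space S" if "s \<in> space S" for k s
    by (simp add: space_PiM)
  have walk_0: "walk y s 0 = y" for y s by (simp add: walk_def)
  have main: "emeasure S (?E n y) = (killed_op \<xi> (B \<union> D) ^^ n) (step_op \<xi> (indicator B)) y" for n y
  proof (induction n arbitrary: y)
    case 0
    have "emeasure S (?E 0 y) = (\<integral>\<^sup>+k. emeasure S {s \<in> space S. case_nat k s \<in> ?E 0 y} \<partial>measure_pmf \<xi>)"
      by (rule iter[OF E])
    also have "\<dots> = (\<integral>\<^sup>+k. indicator B (y + k) \<partial>measure_pmf \<xi>)"
    proof (rule nn_integral_cong)
      fix k
      have "{s \<in> space S. case_nat k s \<in> ?E 0 y} = (if y + k \<in> B then space S else {})"
        by (auto simp: space_case walk_def)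
      then show "emeasure S {s \<in> space S. case_nat k s \<in> ?E 0 y} = indicator B (y + k)"
        by (simp add: indicator_def P.emeasure_space_1)
    qed
    finally show ?case by (simp add: step_op_def)
  next
    case (Suc n)
    have "emeasure S (?E (Suc n) y) = (\<integral>\<^sup>+k. emeasure S {s \<in> space S. case_nat k s \<in> ?E (Suc n) y} \<partial>measure_pmf \<xi>)"
      by (rule iter[OF E])
    also have "\<dots> = (\<integral>\<^sup>+k. indicator (- (B \<union> D)) (y + k) * emeasure S (?E n (y + k)) \<partial>measure_pmf \<xi>)"
    proof (rule nn_integral_cong)
      fix k
      have "{1..Suc n} = insert 1 (Suc ` {1..n})"
        by (auto simp: image_Suc_atLeastAtMost)
      then have split: "(\<forall>j\<in>{1..Suc n}. P j) \<longleftrightarrow> P 1 \<and> (\<forall>j\<in>{1..n}. P (Suc j))" for P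
        by (simp only:) blast
      have one: "walk y (case_nat k s) 1 = y + k" for s
        using shift[of y k s 0] by (simp add: walk_0)
      have "case_nat k s \<in> ?E (Suc n) y \<longleftrightarrow> y + k \<notin> B \<union> D \<and> s \<in> ?E n (y + k)" if "s \<in> space S" for s
        using that by (simp only: mem_Collect_eq split) (auto simp: space_case shift walk_0 one simp del: One_nat_def)
      then have "{s \<in> space S. case_nat k s \<in> ?E (Suc n) y} = (if y + k \<in> B \<union> D then {} else ?E n (y + k))"
        by auto
      then show "emeasure S {s \<in> space S. case_nat k s \<in> ?E (Suc n) y} =
          indicator (- (B \<union> D)) (y + k) * emeasure S (?E n (y + k))"
        by (simp add: indicator_def)
    qed
    also have "\<dots> = (killed_op \<xi> (B \<union> D) ^^ Suc n) (step_op \<xi> (indicator B)) y"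
      unfolding Suc by (simp add: killed_op_apply)
    finally show ?case .
  qed
  have disjE: "disjoint_family (\<lambda>n. ?E n y)"
    unfolding disjoint_family_on_def
  proof (intro ballI impI)
    fix m n :: nat assume "m \<noteq> n"
    then consider "m < n" | "n < m" by linarith
    then show "?E m y \<inter> ?E n y = {}" by cases force+
  qed
  have sp: "space (walk_law \<xi> y) = UNIV" by (simp add: walk_law_def space_PiM)
  have "{R. hit_time B R < hit_time D R} \<in> sets (walk_law \<xi> y)"
  proof -
    have [measurable]: "hit_time T \<in> borel_measurable (walk_law \<xi> y)" for T
      using measurable_compose[OF measurable_hit_time borel_measurable_count_space[of "\<lambda>t. t"]] by simp
    have "{R \<in> space (walk_law \<xi> y). hit_time B R < hit_time D R} \<in> sets (walk_law \<xi> y)"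
      by measurable
    then show ?thesis by (simp add: sp)
  qed
  then have "emeasure (walk_law \<xi> y) {R. hit_time B R < hit_time D R} =
      emeasure S (walk y -` {R. hit_time B R < hit_time D R} \<inter> space S)"
    unfolding walk_law_def by (intro emeasure_distr measurable_walk) simp
  also have "walk y -` {R. hit_time B R < hit_time D R} \<inter> space S = (\<Union>n. ?E n y)"
    by (auto simp: hit_time_less_iff[OF disj])
  also have "emeasure S \<dots> = (\<Sum>n. emeasure S (?E n y))"
    using E disjE by (intro suminf_emeasure[symmetric]) auto
  finally show ?thesis by (simp only: main hit_before_def potential_def sp UNIV_I simp_thms)
qed

lemma hit_point_first_eq:
  "x \<notin> A \<Longrightarrow> ennreal (hit_point_first \<xi> x A y) = hit_before \<xi> {x} A y"
  using emeasure_hit_time_less[of "{x}" A \<xi> y] finite_measure.emeasure_eq_measure[OF prob_space.finite_measure[OF prob_space_walk_law[of \<xi> y]]]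
  by (simp add: hit_point_first_def)

lemma hit_set_first_eq:
  "x \<notin> A \<Longrightarrow> ennreal (hit_set_first \<xi> x A y) = hit_before \<xi> A {x} y"
  using emeasure_hit_time_less[of A "{x}" \<xi> y] finite_measure.emeasure_eq_measure[OF prob_space.finite_measure[OF prob_space_walk_law[of \<xi> y]]]
  by (simp add: hit_set_first_def)

text \<open>Almost surely every step lies in the support, so the walk never leaves \<open>C\<close>;
  a point outside would have probability zero at all times.\<close>

lemma aperiodic_walk_irreducible:
  assumes ap: "aperiodic_walk \<xi>" and x: "x \<in> C"
    and closed: "\<And>w k. w \<in> C \<Longrightarrow> k \<in> set_pmf \<xi> \<Longrightarrow> w + k \<in> C"
  shows "C = UNIV"
proof -
  interpret sequence_space "measure_pmf \<xi>" ..
  have "AE s in S. \<forall>i. s i \<in> set_pmf \<xi>"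
    by (subst AE_all_countable)
      (auto intro!: AE_PiM_component measure_pmf.prob_space_axioms simp: AE_measure_pmf)
  then have C: "AE s in S. walk x s n \<in> C" for n
  proof eventually_elim
    case (elim s)
    show ?case
    proof (induction n)
      case (Suc n)
      then show ?case using elim closed[of "walk x s n" "s n"] by (simp add: walk_def add.assoc)
    qed (use x in \<open>simp add: walk_def\<close>)
  qed
  have "y \<in> C" for y
  proof (rule ccontr)
    assume y: "y \<notin> C"
    obtain n where n: "\<P>(R in walk_law \<xi> x. R n = y) \<noteq> 0" using ap by (auto simp: aperiodic_walk_def)
    have [measurable]: "(\<lambda>R. R n) \<in> measurable (PiM UNIV (\<lambda>_::nat. count_space (UNIV::int set))) (count_space UNIV)"
      by (rule measurable_component_singleton) simp
    have "AE R in walk_law \<xi> x. R n \<noteq> y"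
      unfolding walk_law_def
      by (subst AE_distr_iff[OF measurable_walk]) (measurable, use C[of n] y in auto)
    then have "\<P>(R in walk_law \<xi> x. R n = y) = 0"
      by (intro prob_space.prob_eq_0_AE[OF prob_space_walk_law])
    with n show False by simp
  qed
  then show ?thesis by auto
qed

section \<open>Hitting probabilities from infinity\<close>

text \<open>In contrast to \<open>green_le_diag_row\<close> the bound sits at the target, hence is
  uniform in the starting point.\<close>

lemma green_le_diag: "x \<notin> D \<Longrightarrow> green \<xi> D y x \<le> green \<xi> D x x"
proof (cases "y = x")
  case False
  assume "x \<notin> D"
  then have "green \<xi> D y x = hit_before \<xi> {x} D y * green \<xi> D x x"
    using green_eq[of x D \<xi> y] False by simp
  also have "\<dots> \<le> 1 * green \<xi> D x x"
    by (intro mult_right_mono hit_before_le_1) auto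
  finally show ?thesis by simp
qed simp

lemma nn_integral_count_space_dominated:
  fixes u :: "nat \<Rightarrow> 'a \<Rightarrow> ennreal"
  assumes "\<And>m x. u m x \<le> w x" "(\<integral>\<^sup>+x. w x \<partial>count_space UNIV) < \<infinity>" "\<And>x. (\<lambda>m. u m x) \<longlonglongrightarrow> u' x"
  shows "(\<lambda>m. \<integral>\<^sup>+x. u m x \<partial>count_space UNIV) \<longlonglongrightarrow> (\<integral>\<^sup>+x. u' x \<partial>count_space UNIV)"
  using assms by (intro nn_integral_dominated_convergence[where w = w]) auto

lemma step_op_tendsto_0:
  assumes "\<And>m w. f m w \<le> 1" "\<And>w. (\<lambda>m::nat. f m w) \<longlonglongrightarrow> 0"
  shows "(\<lambda>m. step_op \<xi> (f m) y) \<longlonglongrightarrow> 0"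
proof -
  have "(\<lambda>m. \<integral>\<^sup>+k. f m (y + k) \<partial>measure_pmf \<xi>) \<longlonglongrightarrow> (\<integral>\<^sup>+k. 0 \<partial>measure_pmf \<xi>)"
    using assms by (intro nn_integral_dominated_convergence[where w = "\<lambda>_. 1"]) auto
  then show ?thesis by (simp add: step_op_def)
qed

lemma killed_pow_le_1: "(\<And>w. f w \<le> 1) \<Longrightarrow> (killed_op \<xi> D ^^ n) f y \<le> 1"
proof (induction n arbitrary: y)
  case (Suc n)
  have "(killed_op \<xi> D ^^ Suc n) f y \<le> step_op \<xi> ((killed_op \<xi> D ^^ n) f) y"
    by (simp add: killed_op_le_step_op)
  also have "\<dots> \<le> step_op \<xi> (\<lambda>_. 1) y" by (intro step_op_mono Suc)
  finally show ?case by simp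
qed simp

lemma killed_pow_tendsto_0:
  assumes "\<And>m w. f m w \<le> 1" "\<And>w. (\<lambda>m::nat. f m w) \<longlonglongrightarrow> 0"
  shows "(\<lambda>m. (killed_op \<xi> D ^^ n) (f m) y) \<longlonglongrightarrow> 0"
proof (induction n arbitrary: y)
  case (Suc n)
  have "(\<lambda>m. step_op \<xi> ((killed_op \<xi> D ^^ n) (f m)) y) \<longlonglongrightarrow> 0"
    using killed_pow_le_1[of "f _"] assms by (intro step_op_tendsto_0 Suc) auto
  then show ?case
    by (rule tendsto_sandwich[OF _ _ tendsto_const[of 0], rotated 2])
      (auto simp: killed_op_le_step_op)
qed (use assms in simp)

context centered_walk
begin

text \<open>Survival up to time \<open>n\<close> is the complement of the first \<open>n\<close>
  terms of the series in \<open>hits_set\<close>, whose sum is \<open>1\<close>.\<close>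

lemma killed_pow_survival:
  assumes "T \<noteq> {}"
  shows "(\<lambda>n. (killed_op \<xi> T ^^ n) (\<lambda>_. 1) y) \<longlonglongrightarrow> 0"
proof -
  define s where "s = (\<lambda>n. \<Sum>i<n. (killed_op \<xi> T ^^ i) (step_op \<xi> (indicator T)) y)"
  have one: "(\<lambda>_. 1) = (\<lambda>w. step_op \<xi> (indicator T) w + killed_op \<xi> T (\<lambda>_. 1) w)"
    unfolding killed_op_def step_op_add[symmetric]
  proof
    fix w
    have "(\<lambda>v. indicator T v + indicator (- T) v * 1) = (\<lambda>_. 1 :: ennreal)"
      by (auto simp: indicator_def)
    then show "1 = step_op \<xi> (\<lambda>v. indicator T v + indicator (- T) v * 1) w" by simp
  qed
  have sum: "s n + (killed_op \<xi> T ^^ n) (\<lambda>_. 1) y = 1" for n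
  proof (induction n)
    case (Suc n)
    have "(killed_op \<xi> T ^^ n) (\<lambda>_. 1) y =
        (killed_op \<xi> T ^^ n) (step_op \<xi> (indicator T)) y + (killed_op \<xi> T ^^ Suc n) (\<lambda>_. 1) y"
      unfolding funpow_Suc_right o_def by (subst one, subst killed_pow_add) simp
    with Suc show ?case by (simp add: s_def add.assoc)
  qed (simp add: s_def)
  have "s \<longlonglongrightarrow> 1"
    using summable_LIMSEQ[of "\<lambda>i. (killed_op \<xi> T ^^ i) (step_op \<xi> (indicator T)) y"]
      hits_set[OF assms, of y]
    by (simp add: s_def potential_def)
  then have lim: "(\<lambda>n. 1 - s n) \<longlonglongrightarrow> 1 - 1"
    by (intro tendsto_diff_ennreal tendsto_const) auto
  have "1 - s n = (killed_op \<xi> T ^^ n) (\<lambda>_. 1) y" for n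
  proof -
    have "s n \<noteq> top" using sum[of n] by auto
    then have "s n + (killed_op \<xi> T ^^ n) (\<lambda>_. 1) y - s n = (killed_op \<xi> T ^^ n) (\<lambda>_. 1) y"
      by (rule ennreal_add_diff_cancel_left)
    then show ?thesis by (subst (asm) sum[of n])
  qed
  then have "(\<lambda>n. 1 - s n) = (\<lambda>n. (killed_op \<xi> T ^^ n) (\<lambda>_. 1) y)" by (rule ext)
  with lim have "(\<lambda>n. (killed_op \<xi> T ^^ n) (\<lambda>_. 1) y) \<longlonglongrightarrow> 1 - 1" by (simp only:)
  then show ?thesis by simp
qed

text \<open>Cut at a fixed time \<open>K\<close>. Avoiding \<open>0\<close> for \<open>K\<close>
  steps is unlikely by recurrence, and within \<open>K\<close> steps the receding point is reached
  with vanishing probability.\<close>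

lemma hit_far_point_tendsto_0: "(\<lambda>m::nat. hit_before \<xi> {- int m} {0} w) \<longlonglongrightarrow> 0"
proof (rule order_tendstoI)
  fix e :: ennreal assume e: "0 < e"
  obtain K where K: "(killed_op \<xi> {0} ^^ K) (\<lambda>_. 1) w < e"
    using order_tendstoD(2)[OF killed_pow_survival[of "{0}" w] e] by (auto simp: eventually_sequentially)
  define g where "g = (\<lambda>m::nat. step_op \<xi> (indicator {- int m}))"
  have ev: "eventually (\<lambda>m. indicator {- int m} v = (0::ennreal)) sequentially" for v :: int
    using eventually_gt_at_top[of "nat \<bar>v\<bar>"] by eventually_elim (auto simp: indicator_def)
  have g0: "(\<lambda>m. g m v) \<longlonglongrightarrow> 0" for v
    unfolding g_def
    by (rule step_op_tendsto_0, simp add: indicator_def, intro tendsto_eventually ev)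
  have g1: "g m v \<le> 1" for m v
    unfolding g_def using step_op_mono[of "indicator {- int m}" "\<lambda>_. 1" \<xi> v] by (simp add: indicator_def)
  have le: "hit_before \<xi> {- int m} {0} w \<le> (\<Sum>i<K. (killed_op \<xi> {} ^^ i) (g m) w) + (killed_op \<xi> {0} ^^ K) (\<lambda>_. 1) w" for m
  proof -
    let ?k = "killed_op \<xi> ({- int m} \<union> {0})"
    have split: "hit_before \<xi> {- int m} {0} w = (\<Sum>i<K. (?k ^^ i) (g m) w) + (\<Sum>i. (?k ^^ (i + K)) (g m) w)"
      unfolding hit_before_def potential_def g_def by (subst suminf_offset[of _ K]) (auto simp: add.commute)
    \<comment> \<open>What happens after time \<open>K\<close> is a hitting probability restarted
      there, hence at most the survival probability.\<close>
    have "(\<Sum>i. (?k ^^ (i + K)) (g m) w) = (?k ^^ K) (potential \<xi> ({- int m} \<union> {0}) (g m)) w"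
    proof -
      have "(?k ^^ K) (\<lambda>w. \<Sum>i. (?k ^^ i) (g m) w) v = (\<Sum>i. (?k ^^ K) ((?k ^^ i) (g m)) v)" for v
      proof (induction K arbitrary: v)
        case (Suc K)
        have "(?k ^^ K) (\<lambda>w. \<Sum>i. (?k ^^ i) (g m) w) = (\<lambda>v. \<Sum>i. (?k ^^ K) ((?k ^^ i) (g m)) v)"
          by (rule ext) (rule Suc)
        then show ?case by (simp add: killed_op_suminf)
      qed simp
      then show ?thesis by (simp add: potential_def[abs_def] funpow_add add.commute[of _ K])
    qed
    also have "\<dots> \<le> (killed_op \<xi> {0} ^^ K) (\<lambda>_. 1) w"
      using hit_before_le_1[of \<xi> "{- int m}" "{0}"]
      by (intro killed_pow_mono) (auto simp: hit_before_def g_def)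
    finally show ?thesis unfolding split
      by (intro add_mono sum_mono killed_pow_mono) auto
  qed
  have "(\<lambda>m. (\<Sum>i<K. (killed_op \<xi> {} ^^ i) (g m) w) + (killed_op \<xi> {0} ^^ K) (\<lambda>_. 1) w) \<longlonglongrightarrow> (\<Sum>i<K. 0) + (killed_op \<xi> {0} ^^ K) (\<lambda>_. 1) w"
    by (intro tendsto_add tendsto_sum tendsto_const killed_pow_tendsto_0 g0 g1)
  from order_tendstoD(2)[OF this, of e] K
  have "eventually (\<lambda>m. (\<Sum>i<K. (killed_op \<xi> {} ^^ i) (g m) w) + (killed_op \<xi> {0} ^^ K) (\<lambda>_. 1) w < e) sequentially"
    by simp
  then show "eventually (\<lambda>m. hit_before \<xi> {- int m} {0} w < e) sequentially"
    by eventually_elim (use le in \<open>auto intro: le_less_trans\<close>)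
qed simp

text \<open>A walk coming from the right enters the half-line below \<open>0\<close> with a tight overshoot, whatever
  its starting point, and then visits \<open>0\<close> before a far away point.\<close>

lemma hit_far_point_uniform:
  obtains b :: "nat \<Rightarrow> ennreal" where "b \<longlonglongrightarrow> 0"
    "\<And>m y. m \<ge> 1 \<Longrightarrow> y > 0 \<Longrightarrow> hit_before \<xi> {- int m} {0} y \<le> b m"
proof -
  obtain C where C: "C > 0" "\<And>x z. x \<noteq> z \<Longrightarrow> green \<xi> {z} x x \<le> ennreal (C * \<bar>real_of_int (x - z)\<bar>)"
    by (rule green_linear) blast
  \<comment> \<open>Chance that \<open>- m\<close> comes before \<open>0\<close>, given the entry
    point \<open>v\<close> into the half-line: certain at \<open>- m\<close> itself, zero at
    \<open>0\<close>.\<close>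
  define \<phi> where "\<phi> = (\<lambda>(m::nat) v. if v = - int m then 1 else if v < 0 then hit_before \<xi> {- int m} {0} v else 0)"
  \<comment> \<open>Bounds \<open>green \<xi> {..0} y z\<close> uniformly in the start
    \<open>y > 0\<close>, by \<open>green_linear\<close> with the killed point
    \<open>0\<close>.\<close>
  define c where "c = (\<lambda>z. indicator {1..} z * ennreal (C * real_of_int z))"
  define b where "b = (\<lambda>m. \<integral>\<^sup>+z. c z * step_op \<xi> (\<lambda>v. indicator {..<0} v * \<phi> m v) z \<partial>count_space UNIV)"
  have \<phi>1: "\<phi> m v \<le> 1" for m v using hit_before_le_1 by (auto simp: \<phi>_def)
  have \<phi>0: "(\<lambda>m. \<phi> m v) \<longlonglongrightarrow> 0" if "v < 0" for v
  proof -
    have "eventually (\<lambda>m. \<phi> m v = hit_before \<xi> {- int m} {0} v) sequentially"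
      using eventually_gt_at_top[of "nat \<bar>v\<bar>"] by eventually_elim (use that in \<open>auto simp: \<phi>_def\<close>)
    then show ?thesis using hit_far_point_tendsto_0[of v] by (simp add: tendsto_cong)
  qed
  \<comment> \<open>This is the tightness of the overshoot. For a step \<open>k\<close> only the
    positions \<open>z \<le> \<bar>k\<bar>\<close> contribute, each at most
    \<open>C * \<bar>k\<bar>\<close>, so the second moment bounds the sum.\<close>
  have "(\<integral>\<^sup>+z. c z * step_op \<xi> (indicator {..<0}) z \<partial>count_space UNIV) \<le> (\<integral>\<^sup>+k. ennreal C * ennreal ((real_of_int k)\<^sup>2) \<partial>measure_pmf \<xi>)"
  proof -
    have "(\<integral>\<^sup>+z. c z * step_op \<xi> (indicator {..<0}) z \<partial>count_space UNIV) =
        (\<integral>\<^sup>+z. \<integral>\<^sup>+k. c z * indicator {..<0} (z + k) \<partial>measure_pmf \<xi> \<partial>count_space UNIV)"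
      unfolding step_op_def by (simp add: nn_integral_cmult)
    also have "\<dots> = (\<integral>\<^sup>+k. \<integral>\<^sup>+z. c z * indicator {..<0} (z + k) \<partial>count_space UNIV \<partial>measure_pmf \<xi>)"
      by (rule nn_integral_count_space_nn_integral[symmetric]) auto
    also have "\<dots> \<le> (\<integral>\<^sup>+k. ennreal C * ennreal ((real_of_int k)\<^sup>2) \<partial>measure_pmf \<xi>)"
    proof (rule nn_integral_mono)
      fix k :: int
      have "(\<integral>\<^sup>+z. c z * indicator {..<0} (z + k) \<partial>count_space UNIV) \<le>
          (\<integral>\<^sup>+z. ennreal (C * \<bar>real_of_int k\<bar>) * indicator {1..\<bar>k\<bar>} z \<partial>count_space UNIV)"
      proof (rule nn_integral_mono)
        fix z
        show "c z * indicator {..<0} (z + k) \<le> ennreal (C * \<bar>real_of_int k\<bar>) * indicator {1..\<bar>k\<bar>} z"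
        proof (cases "1 \<le> z \<and> z + k < 0")
          case True
          then have "real_of_int z \<le> \<bar>real_of_int k\<bar>" by linarith
          then have "C * real_of_int z \<le> C * \<bar>real_of_int k\<bar>" using C by (intro mult_left_mono) auto
          then have "ennreal (C * real_of_int z) \<le> ennreal (C * \<bar>real_of_int k\<bar>)" by (rule ennreal_leI)
          moreover have "z \<in> {1..\<bar>k\<bar>}" using True by auto
          ultimately show ?thesis using True by (simp add: c_def)
        qed (auto simp: c_def indicator_def)
      qed
      also have "\<dots> = ennreal (C * \<bar>real_of_int k\<bar>) * ennreal \<bar>real_of_int k\<bar>"
        by (subst nn_integral_cmult) (auto simp: ennreal_of_nat_eq_real_of_nat)
      also have "\<dots> = ennreal C * ennreal ((real_of_int k)\<^sup>2)"
        using C by (simp add: power2_eq_square abs_mult_self_eq mult.assoc flip: ennreal_mult ennreal_mult'')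
      finally show "(\<integral>\<^sup>+z. c z * indicator {..<0} (z + k) \<partial>count_space UNIV) \<le> ennreal C * ennreal ((real_of_int k)\<^sup>2)" .
    qed
    finally show ?thesis .
  qed
  also have "\<dots> < \<infinity>"
    using second_moment by (simp add: nn_integral_cmult ennreal_mult_less_top)
  finally have fin: "(\<integral>\<^sup>+z. c z * step_op \<xi> (indicator {..<0}) z \<partial>count_space UNIV) < \<infinity>" .
  have step0: "(\<lambda>m. step_op \<xi> (\<lambda>v. indicator {..<0} v * \<phi> m v) z) \<longlonglongrightarrow> 0" for z
    using \<phi>0 \<phi>1 by (intro step_op_tendsto_0) (auto simp: indicator_def)
  have "b \<longlonglongrightarrow> (\<integral>\<^sup>+z. 0 \<partial>count_space (UNIV :: int set))"
    unfolding b_def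
  proof (rule nn_integral_count_space_dominated[where w = "\<lambda>z. c z * step_op \<xi> (indicator {..<0}) z" and u' = "\<lambda>_. 0", OF _ fin])
    show "c z * step_op \<xi> (\<lambda>v. indicator {..<0} v * \<phi> m v) z \<le> c z * step_op \<xi> (indicator {..<0}) z" for m z
      using \<phi>1 by (intro mult_left_mono step_op_mono) (auto simp: indicator_def)
    show "(\<lambda>m. c z * step_op \<xi> (\<lambda>v. indicator {..<0} v * \<phi> m v) z) \<longlonglongrightarrow> 0" for z
      using ennreal_tendsto_cmult[OF _ step0[of z], of "c z"] by (simp add: c_def ennreal_mult_less_top indicator_def)
  qed
  then have b0: "b \<longlonglongrightarrow> 0" by simp
  have "hit_before \<xi> {- int m} {0} y \<le> b m" if m: "m \<ge> 1" and y: "y > 0" for m :: nat and y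
  proof -
    let ?F = "hit_before \<xi> {- int m} {0}"
    have D: "{- int m} \<union> {0} \<union> {..0} = {..0::int}" by auto
    have "?F y = potential \<xi> {..0} (\<lambda>w. step_op \<xi> (indicator {- int m}) w +
        step_op \<xi> (\<lambda>v. indicator ({..0} - ({- int m} \<union> {0})) v * ?F v) w) y"
      unfolding hit_before_def by (subst potential_strong_markov[where E = "{..0}"]) (simp only: D)
    also have "(\<lambda>w. step_op \<xi> (indicator {- int m}) w +
        step_op \<xi> (\<lambda>v. indicator ({..0} - ({- int m} \<union> {0})) v * ?F v) w) = step_op \<xi> (\<lambda>v. indicator {..<0} v * \<phi> m v)"
      unfolding step_op_add[symmetric] using m
      by (intro ext arg_cong[where f = "\<lambda>f. step_op \<xi> f _"]) (auto simp: indicator_def \<phi>_def)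
    also have "potential \<xi> {..0} (step_op \<xi> (\<lambda>v. indicator {..<0} v * \<phi> m v)) y \<le> b m"
      unfolding potential_kernel b_def
    proof (intro nn_integral_mono mult_right_mono)
      fix z
      show "green \<xi> {..0} y z \<le> c z"
      proof (cases "z \<le> 0")
        case True
        then show ?thesis using y by (simp add: green_self_killed)
      next
        case False
        have "green \<xi> {..0} y z \<le> green \<xi> {0} y z"
          unfolding green_def by (intro potential_mono) auto
        also have "\<dots> \<le> green \<xi> {0} z z" using False by (intro green_le_diag) auto
        also have "\<dots> \<le> ennreal (C * \<bar>real_of_int (z - 0)\<bar>)" using False by (intro C) auto
        finally show ?thesis using False by (simp add: c_def)
      qed
    qed auto
    finally show ?thesis .
  qed
  with b0 that show thesis by blast
qed

lemma hit_before_real: "\<exists>r. hit_before \<xi> B D y = ennreal r \<and> 0 \<le> r \<and> r \<le> 1"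
  using hit_before_le_1[of \<xi> B D y] by (cases "hit_before \<xi> B D y") (auto simp: top_unique)

lemma potential_sum:
  "finite I \<Longrightarrow> potential \<xi> D (\<lambda>w. \<Sum>i\<in>I. f i w) y = (\<Sum>i\<in>I. potential \<xi> D (f i) y)"
proof (induction I rule: finite_induct)
  case empty
  have "potential \<xi> D (\<lambda>w. 0) y \<le> 0" by (rule potential_least) (simp add: killed_op_def)
  then show ?case by simp
qed (simp add: potential_add)

lemma hit_before_le_sum:
  assumes "finite S"
  shows "hit_before \<xi> S D y \<le> (\<Sum>s\<in>S. hit_before \<xi> {s} D y)"
proof -
  have "(indicator S :: int \<Rightarrow> ennreal) = (\<lambda>w. \<Sum>s\<in>S. indicator {s} w)"
    using assms by (auto simp: indicator_def if_distrib sum.delta fun_eq_iff)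
  then have "step_op \<xi> (indicator S) = (\<lambda>w. \<Sum>s\<in>S. step_op \<xi> (indicator {s}) w)"
    by (simp add: step_op_sum[abs_def])
  then have "hit_before \<xi> S D y = (\<Sum>s\<in>S. potential \<xi> (S \<union> D) (step_op \<xi> (indicator {s})) y)"
    unfolding hit_before_def using assms by (simp add: potential_sum)
  also have "\<dots> \<le> (\<Sum>s\<in>S. hit_before \<xi> {s} D y)"
    unfolding hit_before_def by (intro sum_mono potential_mono) auto
  finally show ?thesis .
qed

text \<open>From \<open>y'\<close> the walk either visits \<open>y\<close> before
  \<open>insert x A\<close>, after which the two probabilities agree, or it does not; the second
  case bounds the difference.\<close>

lemma hit_before_oscillation:
  assumes "x \<notin> A" "y \<notin> insert x A"
  shows "\<bar>enn2real (hit_before \<xi> {x} A y') - enn2real (hit_before \<xi> {x} A y)\<bar>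
    \<le> enn2real (hit_before \<xi> (insert x A) {y} y')"
proof -
  let ?S = "insert x A"
  obtain u where u: "hit_before \<xi> {x} A y = ennreal u" "0 \<le> u" "u \<le> 1" using hit_before_real by blast
  obtain u' where u': "hit_before \<xi> {x} A y' = ennreal u'" "0 \<le> u'" "u' \<le> 1" using hit_before_real by blast
  obtain h where h: "hit_before \<xi> ?S {y} y' = ennreal h" "0 \<le> h" "h \<le> 1" using hit_before_real by blast
  obtain g where g: "hit_before \<xi> {y} ?S y' = ennreal g" "0 \<le> g" "g \<le> 1" using hit_before_real by blast
  have "ennreal (h + g) = ennreal 1"
    using hit_before_complement[of ?S "{y}" y'] assms h g by simp
  then have hg: "g = 1 - h" using h g by (subst (asm) ennreal_inj) auto
  define r where "r = potential \<xi> (?S \<union> {y}) (step_op \<xi> (indicator {x})) y'"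
  have rh: "r \<le> ennreal h"
    unfolding r_def h(1)[symmetric] hit_before_def
    by (intro potential_mono step_op_mono) (auto simp: indicator_def)
  then obtain r' where r': "r = ennreal r'" "0 \<le> r'" "r' \<le> h"
    using h by (cases r) (auto simp: top_unique)
  have "hit_before \<xi> {x} A y' = r + hit_before \<xi> {y} ?S y' * hit_before \<xi> {x} A y"
    using hit_before_strong_markov[OF assms(2), of \<xi> "step_op \<xi> (indicator {x})" y']
    by (simp add: r_def hit_before_def)
  then have "ennreal u' = ennreal (r' + g * u)"
    using u u' g r' by (simp add: ennreal_mult)
  then have "u' = r' + g * u" using u u' g r' by (subst (asm) ennreal_inj) auto
  then have "u' - u = r' - h * u" by (simp add: hg algebra_simps)
  moreover have "h * u \<le> h * 1" using u h by (intro mult_left_mono) auto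
  moreover have "0 \<le> h * u" using u h by auto
  ultimately have "\<bar>u' - u\<bar> \<le> h" using r' by linarith
  then show ?thesis using u u' h by simp
qed

text \<open>The values at \<open>n\<close> and at any \<open>k > n\<close> differ by at most the
  probability that a walk from \<open>k\<close> reaches \<open>insert x A\<close> before
  \<open>n\<close>. A union bound over this finite set and a translation by \<open>n\<close> reduce
  it to \<open>hit_far_point_uniform\<close>, uniformly in \<open>k\<close>, so the sequence is
  Cauchy.\<close>

lemma hit_before_convergent_at_top:
  assumes "finite A" "x \<notin> A"
  shows "\<exists>l. ((\<lambda>y. enn2real (hit_before \<xi> {x} A y)) \<longlongrightarrow> l) at_top"
proof -
  obtain b where b: "b \<longlonglongrightarrow> 0" "\<And>m y. m \<ge> 1 \<Longrightarrow> y > 0 \<Longrightarrow> hit_before \<xi> {- int m} {0} y \<le> b m"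
    by (rule hit_far_point_uniform) blast
  let ?S = "insert x A"
  define u where "u = (\<lambda>y. enn2real (hit_before \<xi> {x} A y))"
  define B where "B = (\<lambda>n::nat. \<Sum>s\<in>?S. b (nat (int n - s)))"
  have "filterlim (\<lambda>n::nat. nat (int n - s)) at_top sequentially" for s
    unfolding filterlim_at_top
  proof
    fix Z :: nat
    show "eventually (\<lambda>n. Z \<le> nat (int n - s)) sequentially"
      using eventually_ge_at_top[of "nat \<bar>s\<bar> + Z"] by eventually_elim linarith
  qed
  then have "(\<lambda>n. b (nat (int n - s))) \<longlonglongrightarrow> 0" for s
    by (rule filterlim_compose[OF b(1)])
  then have B0: "B \<longlonglongrightarrow> (\<Sum>s\<in>?S. 0)" unfolding B_def by (intro tendsto_sum)
  \<comment> \<open>From \<open>N\<close> on, every point of \<open>?S\<close> lies strictly to the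
    left of \<open>n\<close>, so the distances \<open>int n - s\<close> are positive.\<close>
  define N where "N = nat (Max ?S + 1)"
  have N: "s < int n" if "s \<in> ?S" "n \<ge> N" for s n
  proof -
    have "s \<le> Max ?S" using assms that by (intro Max_ge) auto
    then show ?thesis using that(2) unfolding N_def by linarith
  qed
  have close: "ennreal \<bar>u (int k) - u (int n)\<bar> \<le> B n" if n: "n \<ge> N" and k: "k \<ge> n" for n k
  proof (cases "k = n")
    case False
    have "int n \<notin> ?S" using N[OF _ n, of "int n"] by auto
    then have "\<bar>u (int k) - u (int n)\<bar> \<le> enn2real (hit_before \<xi> ?S {int n} (int k))"
      unfolding u_def using assms by (intro hit_before_oscillation) auto
    then have "ennreal \<bar>u (int k) - u (int n)\<bar> \<le> hit_before \<xi> ?S {int n} (int k)"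
      using hit_before_real[of ?S "{int n}" "int k"] by (auto simp: ennreal_leI)
    also have "\<dots> \<le> (\<Sum>s\<in>?S. hit_before \<xi> {s} {int n} (int k))"
      using assms by (intro hit_before_le_sum) auto
    also have "\<dots> \<le> B n"
      unfolding B_def
    proof (rule sum_mono)
      fix s assume s: "s \<in> ?S"
      have "hit_before \<xi> {s} {int n} (int k) = hit_before \<xi> {- int (nat (int n - s))} {0} (int k - int n)"
        using hit_before_translate[of \<xi> "int n" "{- int (nat (int n - s))}" "{0}" "int k - int n"] N[OF s n] by simp
      also have "\<dots> \<le> b (nat (int n - s))"
        using N[OF s n] k False by (intro b) auto
      finally show "hit_before \<xi> {s} {int n} (int k) \<le> b (nat (int n - s))" .
    qed
    finally show ?thesis .
  qed simp
  have "Cauchy (\<lambda>n. u (int n))"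
  proof (rule CauchyI')
    fix e :: real assume "0 < e"
    then have "eventually (\<lambda>n. B n < ennreal e) sequentially"
      using order_tendstoD(2)[OF B0, of "ennreal e"] by simp
    then obtain M where M: "\<And>n. n \<ge> M \<Longrightarrow> B n < ennreal e" by (auto simp: eventually_sequentially)
    have "dist (u (int m)) (u (int n)) < e" if "m \<ge> max M N" "n > m" for m n
    proof -
      have "ennreal \<bar>u (int n) - u (int m)\<bar> < ennreal e"
        using close[of m n] M[of m] that by (auto intro: le_less_trans)
      then show ?thesis by (simp add: dist_real_def ennreal_less_iff abs_minus_commute)
    qed
    then show "\<exists>M. \<forall>m\<ge>M. \<forall>n>m. dist (u (int m)) (u (int n)) < e" by blast
  qed
  then obtain l where l: "(\<lambda>n. u (int n)) \<longlonglongrightarrow> l" by (auto simp: Cauchy_convergent_iff convergent_def)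
  have "filterlim nat at_top at_top"
    unfolding filterlim_at_top
  proof
    fix Z :: nat
    show "eventually (\<lambda>n. Z \<le> nat n) at_top"
      using eventually_ge_at_top[of "int Z"] by eventually_elim linarith
  qed
  then have "((\<lambda>y. u (int (nat y))) \<longlongrightarrow> l) at_top"
    by (rule filterlim_compose[OF l])
  moreover have "eventually (\<lambda>y. u (int (nat y)) = u y) at_top"
    using eventually_ge_at_top[of 0] by eventually_elim simp
  ultimately have "(u \<longlongrightarrow> l) at_top" by (simp add: tendsto_cong)
  then show ?thesis unfolding u_def by blast
qed

end

section \<open>Reflection of the walk\<close>

lemma step_op_uminus: "step_op (map_pmf uminus \<xi>) f y = step_op \<xi> (\<lambda>w. f (- w)) (- y)"
  by (simp add: step_op_def)

lemma killed_op_uminus: "killed_op (map_pmf uminus \<xi>) (uminus ` D) f y = killed_op \<xi> D (\<lambda>w. f (- w)) (- y)"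
proof -
  have "(indicator (- uminus ` D) (- w) :: ennreal) = indicator (- D) w" for w
    by (auto simp: indicator_def image_iff)
  then show ?thesis by (simp add: killed_op_def step_op_uminus)
qed

lemma killed_pow_uminus:
  "(killed_op (map_pmf uminus \<xi>) (uminus ` D) ^^ n) f y = (killed_op \<xi> D ^^ n) (\<lambda>w. f (- w)) (- y)"
proof (induction n arbitrary: y)
  case (Suc n)
  have "(\<lambda>w. (killed_op (map_pmf uminus \<xi>) (uminus ` D) ^^ n) f (- w)) = (killed_op \<xi> D ^^ n) (\<lambda>w. f (- w))"
    unfolding Suc by simp
  then show ?case by (simp only: funpow.simps o_def) (subst killed_op_uminus, simp)
qed simp

lemma hit_before_uminus:
  "hit_before (map_pmf uminus \<xi>) (uminus ` B) (uminus ` D) y = hit_before \<xi> B D (- y)"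
proof -
  have ind: "(\<lambda>w. indicator (uminus ` B) (- w)) = (indicator B :: int \<Rightarrow> ennreal)"
    by (auto simp: indicator_def image_iff fun_eq_iff)
  have "(\<lambda>w. step_op (map_pmf uminus \<xi>) (indicator (uminus ` B)) (- w)) = step_op \<xi> (indicator B)"
    by (simp add: step_op_uminus ind)
  then show ?thesis
    unfolding hit_before_def potential_def image_Un[symmetric] by (simp add: killed_pow_uminus)
qed

lemma (in centered_walk) centered_walk_uminus: "centered_walk (map_pmf uminus \<xi>)"
proof
  fix C :: "int set" and x
  assume x: "x \<in> C" and closed: "\<And>w k. w \<in> C \<Longrightarrow> k \<in> set_pmf (map_pmf uminus \<xi>) \<Longrightarrow> w + k \<in> C"
  have "uminus ` C = UNIV"
  proof (rule irreducible)
    show "- x \<in> uminus ` C" using x by blast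
    fix w k assume "w \<in> uminus ` C" and k: "k \<in> set_pmf \<xi>"
    then obtain v where v: "w = - v" "v \<in> C" by blast
    then have "v + - k \<in> C" using closed[of v "- k"] k by auto
    then have "- (v + - k) \<in> uminus ` C" by blast
    then show "w + k \<in> uminus ` C" by (simp add: v)
  qed
  then show "C = UNIV" by (metis (no_types, lifting) UNIV_I UNIV_eq_I add.inverse_inverse image_iff)
next
  show "(\<integral>\<^sup>+k. ennreal ((real_of_int k)\<^sup>2) \<partial>measure_pmf (map_pmf uminus \<xi>)) < \<infinity>"
    using second_moment by simp
  show "measure_pmf.expectation (map_pmf uminus \<xi>) real_of_int = 0"
    using centered by simp
qed

context centered_walk
begin

lemma hit_before_convergent_at_bot:
  assumes "finite A" "x \<notin> A"
  shows "\<exists>l. ((\<lambda>y. enn2real (hit_before \<xi> {x} A y)) \<longlongrightarrow> l) at_bot"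
proof -
  interpret refl: centered_walk "map_pmf uminus \<xi>" by (rule centered_walk_uminus)
  obtain l where "((\<lambda>y. enn2real (hit_before (map_pmf uminus \<xi>) {- x} (uminus ` A) y)) \<longlongrightarrow> l) at_top"
    using refl.hit_before_convergent_at_top[of "uminus ` A" "- x"] assms by (auto simp: image_iff)
  then have "((\<lambda>y. enn2real (hit_before \<xi> {x} A (- y))) \<longlongrightarrow> l) at_top"
    using hit_before_uminus[of \<xi> "{x}" A] by simp
  then show ?thesis by (auto simp: at_bot_mirror filterlim_filtermap)
qed

subsection \<open>The total mass of the gluing measure\<close>

text \<open>\<open>Lim\<close> is unspecified unless a limit exists; convergence turns both terms of
  \<open>hit_point_first_infinity\<close> into genuine limits of probabilities.\<close>

lemma hit_point_first_limits:
  assumes A: "finite A" "x \<notin> A"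
  defines "lp \<equiv> Lim at_top (hit_point_first \<xi> x A)" and "lm \<equiv> Lim at_bot (hit_point_first \<xi> x A)"
  shows "(hit_point_first \<xi> x A \<longlongrightarrow> lp) at_top" "(hit_point_first \<xi> x A \<longlongrightarrow> lm) at_bot"
    "0 \<le> lp" "lp \<le> 1" "0 \<le> lm" "lm \<le> 1"
    "hit_point_first_infinity \<xi> x A = (lp + lm) / 2"
proof -
  have eq: "hit_point_first \<xi> x A = (\<lambda>y. enn2real (hit_before \<xi> {x} A y))"
    using A by (auto simp: hit_point_first_eq[symmetric] hit_point_first_def)
  have bounds: "0 \<le> hit_point_first \<xi> x A y" "hit_point_first \<xi> x A y \<le> 1" for y
    using hit_before_real[of "{x}" A y] by (auto simp: eq)
  have at_bot: "at_bot \<noteq> (bot :: int filter)" by simp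
  show lp: "(hit_point_first \<xi> x A \<longlongrightarrow> lp) at_top"
    using hit_before_convergent_at_top[OF A] tendsto_Lim[of at_top "hit_point_first \<xi> x A"]
    unfolding lp_def eq[symmetric] by auto
  show lm: "(hit_point_first \<xi> x A \<longlongrightarrow> lm) at_bot"
    using hit_before_convergent_at_bot[OF A] tendsto_Lim[of at_bot "hit_point_first \<xi> x A"]
    unfolding lm_def eq[symmetric] by auto
  show "0 \<le> lp" "lp \<le> 1"
    using tendsto_lowerbound[OF lp, of 0] tendsto_upperbound[OF lp, of 1] bounds by auto
  show "0 \<le> lm" "lm \<le> 1"
    using tendsto_lowerbound[OF lm, of 0] tendsto_upperbound[OF lm, of 1] bounds by auto
  show "hit_point_first_infinity \<xi> x A = (lp + lm) / 2"
    by (simp add: hit_point_first_infinity_def lp_def lm_def)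
qed

text \<open>By recurrence, escape is the complement of the return in \<open>green_diag\<close>.
  Positivity keeps the quotient in \<open>gluing_measure\<close> away from division by zero.\<close>

lemma green_eq_inverse_escape:
  assumes "x \<notin> A" "A \<noteq> {}"
  shows "green \<xi> A x x = ennreal (1 / hit_set_first \<xi> x A x)" "hit_set_first \<xi> x A x > 0"
proof -
  obtain u where u: "hit_before \<xi> {x} A x = ennreal u" "0 \<le> u" using hit_before_real by blast
  have s: "ennreal (hit_set_first \<xi> x A x) = hit_before \<xi> A {x} x" "0 \<le> hit_set_first \<xi> x A x"
    using assms by (auto simp: hit_set_first_eq) (simp add: hit_set_first_def)
  obtain a where a: "a \<in> A" using assms by auto
  have less: "hit_before \<xi> {x} A x < 1"
    using hit_before_point_antimono[of "{a}" A "{x}" x] hit_before_less_1[of x a] a assms by (auto intro: le_less_trans)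
  then have u1: "u < 1" using u by (simp add: ennreal_less_one_iff)
  have "ennreal (u + hit_set_first \<xi> x A x) = ennreal 1"
    using hit_before_complement[of "{x}" A x] assms u s by simp
  then have "hit_set_first \<xi> x A x = 1 - u" using u s by (subst (asm) ennreal_inj) auto
  then show "green \<xi> A x x = ennreal (1 / hit_set_first \<xi> x A x)" "hit_set_first \<xi> x A x > 0"
    using green_diag[OF assms(1) less] u u1 by simp_all
qed

lemma gluing_measure_nonneg:
  assumes "finite A" "x \<notin> A"
  shows "0 \<le> gluing_measure \<xi> x a A"
  using hit_point_first_limits[OF assms]
  by (simp add: gluing_measure_def step_prob_def hit_set_first_def)

lemma ennreal_gluing_measure:
  assumes "finite A" "x \<notin> A" "A \<noteq> {}"
  shows "ennreal (gluing_measure \<xi> x a A) =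
    ennreal (hit_point_first_infinity \<xi> x A) * (green \<xi> A x x * ennreal (pmf \<xi> (a - x)))"
proof -
  have "0 \<le> hit_point_first_infinity \<xi> x A" using hit_point_first_limits[OF assms(1,2)] by simp
  then show ?thesis
    using green_eq_inverse_escape[OF assms(2,3)]
    by (simp add: gluing_measure_def step_prob_def ac_simps flip: ennreal_mult ennreal_mult'')
qed

text \<open>Shrinking the killed set to one of its points only increases the Green function, and
  that point \<open>b\<close> is free. It will be the extreme point of \<open>A\<close>, however far
  away \<open>a\<close> is.\<close>

lemma gluing_measure_bound:
  obtains C where "C > 0"
    "\<And>A x a b. finite A \<Longrightarrow> x \<notin> A \<Longrightarrow> b \<in> A \<Longrightarrow>
      gluing_measure \<xi> x a A \<le> C * \<bar>real_of_int (x - b)\<bar> * pmf \<xi> (a - x)"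
proof -
  obtain C where C: "C > 0" "\<And>x z. x \<noteq> z \<Longrightarrow> green \<xi> {z} x x \<le> ennreal (C * \<bar>real_of_int (x - z)\<bar>)"
    by (rule green_linear) blast
  have "gluing_measure \<xi> x a A \<le> C * \<bar>real_of_int (x - b)\<bar> * pmf \<xi> (a - x)"
    if A: "finite A" "x \<notin> A" "b \<in> A" for A x a b
  proof -
    have "hit_point_first_infinity \<xi> x A \<le> 1" using hit_point_first_limits[OF A(1,2)] by simp
    then have "ennreal (gluing_measure \<xi> x a A) \<le> 1 * (green \<xi> A x x * ennreal (pmf \<xi> (a - x)))"
      using A by (subst ennreal_gluing_measure) (blast | rule mult_right_mono | simp)+
    also have "green \<xi> A x x \<le> green \<xi> {b} x x"
      unfolding green_def using A by (intro potential_mono) auto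
    also have "\<dots> \<le> ennreal (C * \<bar>real_of_int (x - b)\<bar>)" using A by (intro C) auto
    finally have "ennreal (gluing_measure \<xi> x a A) \<le> ennreal (C * \<bar>real_of_int (x - b)\<bar>) * ennreal (pmf \<xi> (a - x))"
      by (simp add: mult_right_mono)
    then have "ennreal (gluing_measure \<xi> x a A) \<le> ennreal (C * \<bar>real_of_int (x - b)\<bar> * pmf \<xi> (a - x))"
      by (simp add: ennreal_mult'')
    then show ?thesis using C by (subst (asm) ennreal_le_iff) auto
  qed
  with C that show thesis by blast
qed

lemma step_op_indicator_finite:
  "finite A \<Longrightarrow> step_op \<xi> (indicator A) x = (\<Sum>a\<in>A. ennreal (pmf \<xi> (a - x)))"
proof -
  assume A: "finite A"
  have "(indicator A :: int \<Rightarrow> ennreal) = (\<lambda>w. \<Sum>a\<in>A. indicator {a} w)"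
    using A by (auto simp: indicator_def if_distrib sum.delta fun_eq_iff)
  then show ?thesis by (simp add: step_op_sum step_op_singleton)
qed

lemma first_moment_finite: "(\<integral>\<^sup>+x. ennreal (\<bar>real_of_int (x - a)\<bar> * pmf \<xi> (a - x)) \<partial>count_space UNIV) < \<infinity>"
proof -
  have "bij (\<lambda>x. a - x)" by (rule o_bij[of "\<lambda>x. a - x"]) auto
  then have "(\<integral>\<^sup>+x. ennreal (\<bar>real_of_int (x - a)\<bar> * pmf \<xi> (a - x)) \<partial>count_space UNIV) =
      (\<integral>\<^sup>+x. (\<lambda>k. ennreal (\<bar>real_of_int k\<bar> * pmf \<xi> k)) (a - x) \<partial>count_space UNIV)"
    by (intro nn_integral_cong) (simp add: abs_minus_commute)
  also have "\<dots> = (\<integral>\<^sup>+k. ennreal (\<bar>real_of_int k\<bar> * pmf \<xi> k) \<partial>count_space UNIV)"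
    using \<open>bij _\<close> by (rule nn_integral_bij_count_space)
  also have "\<dots> = (\<integral>\<^sup>+k. ennreal \<bar>real_of_int k\<bar> \<partial>measure_pmf \<xi>)"
    by (simp add: nn_integral_measure_pmf ennreal_mult'' mult.commute)
  also have "\<dots> < \<infinity>" using integrable_id by (simp add: integrable_iff_bounded)
  finally show ?thesis .
qed

text \<open>The weights \<open>w\<close> do not depend on the start and are summable, since the
  resistance is linear in the distance and steps have a finite first moment. So total mass
  \<open>1\<close> passes to the limit; the sequence \<open>Y\<close> is there because dominated
  convergence is sequential.\<close>

lemma sum_hitting_distribution:
  fixes Y :: "nat \<Rightarrow> int" and L :: "int \<Rightarrow> real"
  assumes A: "finite A" "A \<noteq> {}"
    and Y: "filterlim Y F sequentially" and F: "F = at_top \<or> F = at_bot"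
    and L: "\<And>x. x \<notin> A \<Longrightarrow> (hit_point_first \<xi> x A \<longlongrightarrow> L x) F"
  shows "(\<integral>\<^sup>+x. indicator (- A) x * (ennreal (L x) * (green \<xi> A x x * step_op \<xi> (indicator A) x)) \<partial>count_space UNIV) = 1"
proof -
  define w where "w = (\<lambda>x. indicator (- A) x * (green \<xi> A x x * step_op \<xi> (indicator A) x))"
  define I where "I = (\<lambda>y. \<integral>\<^sup>+x. ennreal (hit_point_first \<xi> x A y) * w x \<partial>count_space UNIV)"
  obtain C where C: "C > 0" "\<And>x z. x \<noteq> z \<Longrightarrow> green \<xi> {z} x x \<le> ennreal (C * \<bar>real_of_int (x - z)\<bar>)"
    by (rule green_linear) blast
  have w_le: "w x \<le> (\<Sum>a\<in>A. ennreal C * ennreal (\<bar>real_of_int (x - a)\<bar> * pmf \<xi> (a - x)))" for x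
  proof (cases "x \<in> A")
    case False
    have "green \<xi> A x x * ennreal (pmf \<xi> (a - x)) \<le> ennreal C * ennreal (\<bar>real_of_int (x - a)\<bar> * pmf \<xi> (a - x))" if "a \<in> A" for a
    proof -
      have "green \<xi> A x x \<le> green \<xi> {a} x x" unfolding green_def using that by (intro potential_mono) auto
      also have "\<dots> \<le> ennreal (C * \<bar>real_of_int (x - a)\<bar>)" using False that by (intro C) auto
      finally have "green \<xi> A x x * ennreal (pmf \<xi> (a - x)) \<le> ennreal (C * \<bar>real_of_int (x - a)\<bar>) * ennreal (pmf \<xi> (a - x))"
        by (rule mult_right_mono) auto
      then show ?thesis using C by (simp add: ennreal_mult' ennreal_mult'' mult.assoc)
    qed
    then have "(\<Sum>a\<in>A. green \<xi> A x x * ennreal (pmf \<xi> (a - x))) \<le>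
        (\<Sum>a\<in>A. ennreal C * ennreal (\<bar>real_of_int (x - a)\<bar> * pmf \<xi> (a - x)))"
      by (rule sum_mono)
    then show ?thesis using False A by (simp only: w_def step_op_indicator_finite sum_distrib_left) simp
  qed (simp add: w_def)
  have w_fin: "(\<integral>\<^sup>+x. w x \<partial>count_space UNIV) < \<infinity>"
  proof -
    have "(\<integral>\<^sup>+x. w x \<partial>count_space UNIV) \<le> (\<integral>\<^sup>+x. (\<Sum>a\<in>A. ennreal C * ennreal (\<bar>real_of_int (x - a)\<bar> * pmf \<xi> (a - x))) \<partial>count_space UNIV)"
      by (intro nn_integral_mono w_le)
    also have "\<dots> = (\<Sum>a\<in>A. ennreal C * (\<integral>\<^sup>+x. ennreal (\<bar>real_of_int (x - a)\<bar> * pmf \<xi> (a - x)) \<partial>count_space UNIV))"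
      by (simp add: nn_integral_sum nn_integral_cmult)
    also have "\<dots> < \<infinity>"
      using A first_moment_finite by (simp add: ennreal_mult_less_top)
    finally show ?thesis .
  qed
  \<comment> \<open>The extra term is a walk entering \<open>A\<close> with its first step; it stems
    from the visit at time \<open>0\<close> in \<open>green_eq\<close>.\<close>
  have mass: "step_op \<xi> (indicator A) y + I y = 1" if y: "y \<notin> A" for y
  proof -
    have "1 = (\<integral>\<^sup>+x. green \<xi> A y x * step_op \<xi> (indicator A) x \<partial>count_space UNIV)"
      using hits_set[of A y] A by (simp add: potential_kernel[symmetric])
    also have "\<dots> = (\<integral>\<^sup>+x. step_op \<xi> (indicator A) y * indicator {y} x + ennreal (hit_point_first \<xi> x A y) * w x \<partial>count_space UNIV)"
    proof (rule nn_integral_cong)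
      fix x
      show "green \<xi> A y x * step_op \<xi> (indicator A) x = step_op \<xi> (indicator A) y * indicator {y} x + ennreal (hit_point_first \<xi> x A y) * w x"
      proof (cases "x \<in> A")
        case True
        then show ?thesis using y by (auto simp: green_self_killed w_def indicator_def)
      next
        case False
        then show ?thesis
          by (auto simp: green_eq[OF False, of \<xi> y] w_def hit_point_first_eq distrib_right mult.assoc indicator_def)
      qed
    qed
    also have "\<dots> = step_op \<xi> (indicator A) y + I y"
      by (simp add: nn_integral_add nn_integral_cmult I_def)
    finally show ?thesis by simp
  qed
  have YA: "eventually (\<lambda>n. Y n \<noteq> a) sequentially" for a
  proof -
    have "eventually (\<lambda>y. y \<noteq> a) F"
      using F eventually_gt_at_top[of a] eventually_gt_at_bot[of a] by (auto elim!: eventually_mono)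
    then show ?thesis using Y by (auto simp: filterlim_iff)
  qed
  \<comment> \<open>Moving \<open>Y n\<close> from the start into the indicator lets dominated
    convergence act at the fixed start \<open>0\<close>.\<close>
  have "(\<lambda>n. step_op \<xi> (\<lambda>w. indicator A (w + Y n)) 0) \<longlonglongrightarrow> 0"
  proof (rule step_op_tendsto_0)
    fix w
    have "eventually (\<lambda>n. \<forall>a\<in>A. Y n \<noteq> a - w) sequentially"
      using A YA by (intro eventually_ball_finite) auto
    then have "eventually (\<lambda>n. indicator A (w + Y n) = (0::ennreal)) sequentially"
      by eventually_elim (auto simp: indicator_def)
    then show "(\<lambda>n. indicator A (w + Y n) :: ennreal) \<longlonglongrightarrow> 0" by (rule tendsto_eventually)
  qed (simp add: indicator_def)
  then have S0: "(\<lambda>n. step_op \<xi> (indicator A) (Y n)) \<longlonglongrightarrow> 0"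
    by (simp add: step_op_translate)
  have "(\<lambda>n. I (Y n)) \<longlonglongrightarrow> (\<integral>\<^sup>+x. ennreal (L x) * w x \<partial>count_space UNIV)"
    unfolding I_def
  proof (rule nn_integral_count_space_dominated[where w = w, OF _ w_fin])
    fix n x
    show "ennreal (hit_point_first \<xi> x A (Y n)) * w x \<le> w x"
    proof (cases "x \<in> A")
      case False
      then have "ennreal (hit_point_first \<xi> x A (Y n)) * w x \<le> 1 * w x"
        using hit_before_le_1 by (intro mult_right_mono) (auto simp: hit_point_first_eq)
      then show ?thesis by simp
    qed (simp add: w_def)
  next
    fix x
    show "(\<lambda>n. ennreal (hit_point_first \<xi> x A (Y n)) * w x) \<longlonglongrightarrow> ennreal (L x) * w x"
    proof (cases "x \<in> A")
      case False
      have "w x \<le> (\<integral>\<^sup>+x. w x \<partial>count_space UNIV)"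
        by (rule nn_integral_ge_point) auto
      then have "w x < \<infinity>" using w_fin by (rule le_less_trans)
      moreover have "(\<lambda>n. ennreal (hit_point_first \<xi> x A (Y n))) \<longlonglongrightarrow> ennreal (L x)"
        using filterlim_compose[OF L[OF False] Y] by (rule tendsto_ennrealI)
      ultimately have "(\<lambda>n. w x * ennreal (hit_point_first \<xi> x A (Y n))) \<longlonglongrightarrow> w x * ennreal (L x)"
        by (intro ennreal_tendsto_cmult) auto
      then show ?thesis by (simp add: mult.commute)
    qed (simp add: w_def)
  qed
  then have "(\<lambda>n. step_op \<xi> (indicator A) (Y n) + I (Y n)) \<longlonglongrightarrow> 0 + (\<integral>\<^sup>+x. ennreal (L x) * w x \<partial>count_space UNIV)"
    by (intro tendsto_add S0)
  moreover have "(\<lambda>n. step_op \<xi> (indicator A) (Y n) + I (Y n)) \<longlonglongrightarrow> 1"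
  proof (rule tendsto_eventually)
    have "eventually (\<lambda>n. \<forall>a\<in>A. Y n \<noteq> a) sequentially"
      using A YA by (intro eventually_ball_finite) auto
    then show "eventually (\<lambda>n. step_op \<xi> (indicator A) (Y n) + I (Y n) = 1) sequentially"
      by eventually_elim (rule mass, auto)
  qed
  ultimately have "(\<integral>\<^sup>+x. ennreal (L x) * w x \<partial>count_space UNIV) = 1"
    using LIMSEQ_unique by fastforce
  then show ?thesis by (simp add: w_def mult.left_commute)
qed

text \<open>Each end of the line gives mass \<open>1\<close>, and
  \<open>hit_point_first_infinity\<close> averages the two ends.\<close>

lemma sum_gluing_measure:
  assumes A: "finite A" "A \<noteq> {}"
  shows "(\<integral>\<^sup>+x. indicator (- A) x * (\<Sum>a\<in>A. ennreal (gluing_measure \<xi> x a A)) \<partial>count_space UNIV) = 1"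
proof -
  define lp where "lp = (\<lambda>x. Lim at_top (hit_point_first \<xi> x A))"
  define lm where "lm = (\<lambda>x. Lim at_bot (hit_point_first \<xi> x A))"
  define w where "w = (\<lambda>x. green \<xi> A x x * step_op \<xi> (indicator A) x)"
  have lim: "(hit_point_first \<xi> x A \<longlongrightarrow> lp x) at_top" "(hit_point_first \<xi> x A \<longlongrightarrow> lm x) at_bot"
      "0 \<le> lp x" "0 \<le> lm x" "hit_point_first_infinity \<xi> x A = (lp x + lm x) / 2" if "x \<notin> A" for x
    using hit_point_first_limits[OF A(1) that] by (simp_all add: lp_def lm_def)
  have "filterlim (\<lambda>n. - int n) at_bot sequentially"
    unfolding filterlim_at_bot
  proof
    fix Z :: int
    show "eventually (\<lambda>n. - int n \<le> Z) sequentially"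
      using eventually_ge_at_top[of "nat \<bar>Z\<bar>"] by eventually_elim linarith
  qed
  then have m: "(\<integral>\<^sup>+x. indicator (- A) x * (ennreal (lm x) * w x) \<partial>count_space UNIV) = 1"
    unfolding w_def using A lim by (intro sum_hitting_distribution[of A "\<lambda>n. - int n" at_bot]) auto
  have p: "(\<integral>\<^sup>+x. indicator (- A) x * (ennreal (lp x) * w x) \<partial>count_space UNIV) = 1"
    unfolding w_def using A lim filterlim_int_sequentially
    by (intro sum_hitting_distribution[of A int at_top]) auto
  have "(\<integral>\<^sup>+x. indicator (- A) x * (\<Sum>a\<in>A. ennreal (gluing_measure \<xi> x a A)) \<partial>count_space UNIV) =
     (\<integral>\<^sup>+x. ennreal (1/2) * (indicator (- A) x * (ennreal (lp x) * w x)) + ennreal (1/2) * (indicator (- A) x * (ennreal (lm x) * w x)) \<partial>count_space UNIV)"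
  proof (rule nn_integral_cong)
    fix x
    show "indicator (- A) x * (\<Sum>a\<in>A. ennreal (gluing_measure \<xi> x a A)) =
      ennreal (1/2) * (indicator (- A) x * (ennreal (lp x) * w x)) + ennreal (1/2) * (indicator (- A) x * (ennreal (lm x) * w x))"
    proof (cases "x \<in> A")
      case False
      have "(\<Sum>a\<in>A. ennreal (gluing_measure \<xi> x a A)) = ennreal ((lp x + lm x) / 2) * w x"
        by (simp only: ennreal_gluing_measure[OF A(1) False A(2)] lim(5)[OF False]
            w_def step_op_indicator_finite[OF A(1)] sum_distrib_left)
      also have "ennreal ((lp x + lm x) / 2) = ennreal (1/2 * lp x + 1/2 * lm x)"
        by (rule arg_cong[where f = ennreal]) (simp add: field_simps)
      also have "\<dots> = ennreal (1/2 * lp x) + ennreal (1/2 * lm x)"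
        using lim(3,4)[OF False] by (intro ennreal_plus) auto
      also have "ennreal (1/2 * lp x) = ennreal (1/2) * ennreal (lp x)"
        using lim(3)[OF False] by (intro ennreal_mult) auto
      also have "ennreal (1/2 * lm x) = ennreal (1/2) * ennreal (lm x)"
        using lim(4)[OF False] by (intro ennreal_mult) auto
      finally show ?thesis using False by (simp add: distrib_right mult.assoc)
    qed simp
  qed
  also have "\<dots> = ennreal (1/2) * 1 + ennreal (1/2) * 1"
    by (subst nn_integral_add) (simp_all only: nn_integral_cmult borel_measurable_count_space p m)
  also have "\<dots> = 1" by (subst mult_1_right)+ (subst ennreal_plus[symmetric], auto)
  finally show ?thesis .
qed

end

section \<open>Growth of the maximum\<close>

lemma dyadic_scale:
  fixes k :: int
  assumes "1 \<le> k" "k < 2 ^ I"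
  obtains i where "i < I" "2 ^ i \<le> k" "k < 2 * 2 ^ i"
proof -
  have "1 \<le> nat k" using assms by simp
  from ex_power_ivl1[OF _ this, of 2] obtain i where "2 ^ i \<le> nat k" "nat k < 2 ^ (i + 1)" by blast
  then have "int (2 ^ i) \<le> k" "k < int (2 ^ (i + 1))" using assms by linarith+
  then have i': "2 ^ i \<le> k" "k < 2 * 2 ^ i" by simp_all
  have "(2::int) ^ i < 2 ^ I" using i' assms by linarith
  then have "i < I" by (simp add: power_strict_increasing_iff)
  with i' that show thesis by blast
qed

text \<open>\<open>\<nu> B\<close> is the law of the next point, and \<open>\<mu> B a x\<close> the part of its mass at \<open>x\<close> that is due to an
  attachment through \<open>a\<close>. Only the law to the right of \<open>B\<close> is constrained.\<close>

locale growth_chain =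
  fixes \<nu> :: "int set \<Rightarrow> int pmf" and \<mu> :: "int set \<Rightarrow> int \<Rightarrow> int \<Rightarrow> real"
    and \<eta> :: "int pmf" and C c \<alpha> :: real
  assumes rate: "\<And>B x. finite B \<Longrightarrow> B \<noteq> {} \<Longrightarrow> Max B < x \<Longrightarrow> pmf (\<nu> B) x = (\<Sum>a\<in>B. \<mu> B a x)"
    and \<mu>_nonneg: "\<And>B x a. finite B \<Longrightarrow> a \<in> B \<Longrightarrow> Max B < x \<Longrightarrow> 0 \<le> \<mu> B a x"
    and \<mu>_le: "\<And>B x a. finite B \<Longrightarrow> a \<in> B \<Longrightarrow> Max B < x \<Longrightarrow>
      \<mu> B a x \<le> C * real_of_int (x - Max B) * pmf \<eta> (x - a)"
    and C_nonneg: "0 \<le> C" and c_nonneg: "0 \<le> c"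
    and \<alpha>_gt: "2 < \<alpha>" and \<alpha>_le: "\<alpha> \<le> 3"
    and tail: "\<And>s::real. 0 < s \<Longrightarrow> measure_pmf.prob \<eta> {k. s \<le> real_of_int k} \<le> c * s powr (- \<alpha>)"
begin

definition step :: "int set \<Rightarrow> int set pmf" where
  "step B = map_pmf (\<lambda>x. insert x B) (\<nu> B)"

primrec chain :: "nat \<Rightarrow> int set \<Rightarrow> int set pmf" where
  "chain 0 B = return_pmf B"
| "chain (Suc n) B = bind_pmf (chain n B) step"

lemma chain_add: "chain (m + n) B = bind_pmf (chain m B) (chain n)"
  by (induction n) (simp_all add: bind_return_pmf' bind_assoc_pmf)

lemma nn_integral_chain_Suc:
  "(\<integral>\<^sup>+A. f A \<partial>measure_pmf (chain (Suc n) B)) = (\<integral>\<^sup>+A. (\<integral>\<^sup>+x. f (insert x A) \<partial>measure_pmf (\<nu> A)) \<partial>measure_pmf (chain n B))"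
  by (simp add: step_def)

lemma chain_support:
  assumes "A \<in> set_pmf (chain n B)" "finite B"
  shows "finite A \<and> B \<subseteq> A \<and> card (A - B) \<le> n"
  using assms(1)
proof (induction n arbitrary: A)
  case (Suc n)
  then obtain A' x where A': "A' \<in> set_pmf (chain n B)" "A = insert x A'" by (auto simp: step_def)
  note IH = Suc.IH[OF A'(1)]
  have le: "card (A - B) \<le> card (insert x (A' - B))"
    using IH A' by (intro card_mono) auto
  moreover have "card (insert x (A' - B)) \<le> Suc (card (A' - B))" using IH by (simp add: card_insert_if)
  ultimately have "card (A - B) \<le> Suc n" using IH by linarith
  then show ?case using IH A' by blast
qed (use assms in simp)

lemma AE_chain:
  assumes "finite B"
  shows "AE A in measure_pmf (chain n B). finite A \<and> B \<subseteq> A \<and> card (A - B) \<le> n"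
  using chain_support[OF _ assms] by (simp add: AE_measure_pmf_iff)

text \<open>The conditional expectation of the advance of the maximum due to jumps of length in \<open>[s, 2 s)\<close>.\<close>

definition drift :: "int \<Rightarrow> int set \<Rightarrow> ennreal" where
  "drift s A = (\<Sum>a\<in>A. \<integral>\<^sup>+x. ennreal (real_of_int (x - Max A) * \<mu> A a x) *
     indicator {x. Max A < x \<and> a + s \<le> x \<and> x < a + 2 * s} x \<partial>count_space UNIV)"

text \<open>The cap has two uses: at \<open>2 * s\<close> it matches the reach of jumps shorter than
  \<open>2 * s\<close>; at a target level it limits what one long jump can cost.\<close>

definition advance :: "real \<Rightarrow> int set \<Rightarrow> ennreal" where
  "advance K A = (\<integral>\<^sup>+x. ennreal (min (max 0 (real_of_int (x - Max A))) K) \<partial>measure_pmf (\<nu> A))"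

lemma advance_eq:
  assumes A: "finite A" "A \<noteq> {}" and K: "0 \<le> K"
  shows "advance K A = (\<integral>\<^sup>+x. (\<Sum>a\<in>A. ennreal (min (real_of_int (x - Max A)) K * \<mu> A a x) * indicator {Max A<..} x) \<partial>count_space UNIV)"
  unfolding advance_def nn_integral_measure_pmf
proof (rule nn_integral_cong)
  fix x
  show "ennreal (pmf (\<nu> A) x) * ennreal (min (max 0 (real_of_int (x - Max A))) K) =
    (\<Sum>a\<in>A. ennreal (min (real_of_int (x - Max A)) K * \<mu> A a x) * indicator {Max A<..} x)"
  proof (cases "Max A < x")
    case True
    have m: "0 \<le> min (real_of_int (x - Max A)) K" "max 0 (real_of_int (x - Max A)) = real_of_int (x - Max A)"
      using True K by auto
    have "ennreal (pmf (\<nu> A) x) * ennreal (min (max 0 (real_of_int (x - Max A))) K) =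
        ennreal (min (real_of_int (x - Max A)) K * (\<Sum>a\<in>A. \<mu> A a x))"
      unfolding rate[OF A True] m(2) ennreal_mult'[OF m(1)] by (rule mult.commute)
    also have "\<dots> = (\<Sum>a\<in>A. ennreal (min (real_of_int (x - Max A)) K * \<mu> A a x))"
      unfolding sum_distrib_left
      using True K A \<mu>_nonneg by (intro sum_ennreal[symmetric] mult_nonneg_nonneg) auto
    finally show ?thesis using True by simp
  qed (use K in auto)
qed

text \<open>As \<open>a \<le> Max A\<close>, a jump shorter than \<open>2 * s\<close> lands less
  than \<open>2 * s\<close> beyond the maximum, where the cap is inactive.\<close>

lemma drift_le_advance:
  assumes A: "finite A" "A \<noteq> {}" and s: "0 < s"
  shows "drift s A \<le> advance (2 * s) A"
proof -
  have "drift s A = (\<integral>\<^sup>+x. (\<Sum>a\<in>A. ennreal (real_of_int (x - Max A) * \<mu> A a x) *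
     indicator {x. Max A < x \<and> a + s \<le> x \<and> x < a + 2 * s} x) \<partial>count_space UNIV)"
    unfolding drift_def by (rule nn_integral_sum[symmetric]) simp
  also have "\<dots> \<le> (\<integral>\<^sup>+x. (\<Sum>a\<in>A. ennreal (min (real_of_int (x - Max A)) (2 * s) * \<mu> A a x) * indicator {Max A<..} x) \<partial>count_space UNIV)"
  proof (intro nn_integral_mono sum_mono)
    fix x a assume a: "a \<in> A"
    have "a \<le> Max A" using A a by simp
    then have "min (real_of_int (x - Max A)) (2 * s) = real_of_int (x - Max A)" if "x < a + 2 * s"
      using that by (intro min_absorb1) linarith
    then show "ennreal (real_of_int (x - Max A) * \<mu> A a x) * indicator {x. Max A < x \<and> a + s \<le> x \<and> x < a + 2 * s} x
      \<le> ennreal (min (real_of_int (x - Max A)) (2 * s) * \<mu> A a x) * indicator {Max A<..} x"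
      by (auto simp: indicator_def)
  qed
  finally show ?thesis using advance_eq[OF A, of "2 * s"] s by simp
qed

lemma nn_integral_shift_pmf:
  "(\<integral>\<^sup>+x. ennreal (pmf \<eta> (x - a)) * f (x - a) \<partial>count_space UNIV) = (\<integral>\<^sup>+k. f k \<partial>measure_pmf \<eta>)"
proof -
  have "bij (\<lambda>x::int. x - a)" by (rule o_bij[of "\<lambda>x. x + a"]) auto
  then show ?thesis
    unfolding nn_integral_measure_pmf by (rule nn_integral_bij_count_space)
qed

text \<open>A jump in \<open>[s, 2 s)\<close> advances the maximum by at most \<open>2 s\<close>, at
  a rate of at most \<open>2 C s\<close> times its step probability; with the tail bound this gives
  the constant. Points at least \<open>2 s\<close> below the maximum cannot pass it by such a
  jump.\<close>

lemma drift_le_count: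
  assumes A: "finite A" "A \<noteq> {}" and s: "0 < s"
  shows "drift s A \<le> of_nat (card {a \<in> A. Max A - a < 2 * s}) * ennreal (4 * C * c * real_of_int s powr (2 - \<alpha>))"
proof -
  let ?k = "ennreal (4 * C * c * real_of_int s powr (2 - \<alpha>))"
  have one: "(\<integral>\<^sup>+x. ennreal (real_of_int (x - Max A) * \<mu> A a x) *
     indicator {x. Max A < x \<and> a + s \<le> x \<and> x < a + 2 * s} x \<partial>count_space UNIV) \<le> indicator {a. Max A - a < 2 * s} a * ?k"
     (is "?I \<le> _") if a: "a \<in> A" for a
  proof (cases "Max A - a < 2 * s")
    case True
    have aM: "a \<le> Max A" using A a by simp
    have "?I \<le> (\<integral>\<^sup>+x. ennreal (pmf \<eta> (x - a)) * (ennreal (4 * C * (real_of_int s)\<^sup>2) * indicator {k. real_of_int s \<le> real_of_int k} (x - a)) \<partial>count_space UNIV)"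
    proof (rule nn_integral_mono)
      fix x
      show "ennreal (real_of_int (x - Max A) * \<mu> A a x) * indicator {x. Max A < x \<and> a + s \<le> x \<and> x < a + 2 * s} x
        \<le> ennreal (pmf \<eta> (x - a)) * (ennreal (4 * C * (real_of_int s)\<^sup>2) * indicator {k. real_of_int s \<le> real_of_int k} (x - a))"
      proof (cases "Max A < x \<and> a + s \<le> x \<and> x < a + 2 * s")
        case True
        define d where "d = real_of_int (x - Max A)"
        have d: "0 \<le> d" "d \<le> 2 * real_of_int s" using True aM by (auto simp: d_def)
        have "d * \<mu> A a x \<le> d * (C * d * pmf \<eta> (x - a))"
          using \<mu>_le[OF A(1) a] True d by (intro mult_left_mono) (auto simp: d_def)
        also have "\<dots> = C * pmf \<eta> (x - a) * (d * d)" by simp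
        also have "\<dots> \<le> C * pmf \<eta> (x - a) * ((2 * real_of_int s) * (2 * real_of_int s))"
          using d C_nonneg by (intro mult_left_mono mult_mono) auto
        finally have "d * \<mu> A a x \<le> pmf \<eta> (x - a) * (4 * C * (real_of_int s)\<^sup>2)"
          by (simp add: power2_eq_square mult_ac)
        then have "ennreal (d * \<mu> A a x) \<le> ennreal (pmf \<eta> (x - a)) * ennreal (4 * C * (real_of_int s)\<^sup>2)"
          using C_nonneg by (simp add: ennreal_leI flip: ennreal_mult)
        then show ?thesis using True by (simp add: d_def)
      qed simp
    qed
    also have "\<dots> = (\<integral>\<^sup>+k. ennreal (4 * C * (real_of_int s)\<^sup>2) * indicator {k. real_of_int s \<le> real_of_int k} k \<partial>measure_pmf \<eta>)"
      by (rule nn_integral_shift_pmf)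
    also have "\<dots> = ennreal (4 * C * (real_of_int s)\<^sup>2) * ennreal (measure_pmf.prob \<eta> {k. real_of_int s \<le> real_of_int k})"
      by (subst nn_integral_cmult_indicator) (simp_all add: measure_pmf.emeasure_eq_measure)
    also have "\<dots> \<le> ennreal (4 * C * (real_of_int s)\<^sup>2) * ennreal (c * real_of_int s powr (- \<alpha>))"
      using tail[of "real_of_int s"] s by (intro mult_left_mono ennreal_leI) auto
    also have "\<dots> = ennreal (4 * C * c * ((real_of_int s)\<^sup>2 * real_of_int s powr (- \<alpha>)))"
      using C_nonneg c_nonneg by (simp add: mult_ac flip: ennreal_mult)
    also have "(real_of_int s)\<^sup>2 * real_of_int s powr (- \<alpha>) = real_of_int s powr (2 - \<alpha>)"
      using s by (simp add: powr_diff powr_minus divide_inverse)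
    finally show ?thesis using True by simp
  next
    case False
    have "{x. Max A < x \<and> a + s \<le> x \<and> x < a + 2 * s} = {}" using False by auto
    then show ?thesis by simp
  qed
  have "drift s A \<le> (\<Sum>a\<in>A. indicator {a. Max A - a < 2 * s} a * ?k)"
    unfolding drift_def by (intro sum_mono one)
  also have "\<dots> = (\<Sum>a\<in>A. indicator {a. Max A - a < 2 * s} a) * ?k"
    by (simp only: sum_distrib_right)
  also have "(\<Sum>a\<in>A. indicator {a. Max A - a < 2 * s} a :: ennreal) = of_nat (card {a \<in> A. Max A - a < 2 * s})"
    using A by (simp add: indicator_def sum.If_cases Int_def)
  finally show ?thesis .
qed

text \<open>A first moment rather than a probability, because the bound \<open>\<mu>_le\<close>
  carries a factor of the distance.\<close>

definition long_jump :: "nat \<Rightarrow> ennreal" where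
  "long_jump I = (\<integral>\<^sup>+k. ennreal (real_of_int k) * indicator {2 ^ I..} k \<partial>measure_pmf \<eta>)"

text \<open>The jump length \<open>x - a\<close> selects a dyadic scale. Beyond \<open>2 ^ I\<close>
  the advance is replaced by its cap \<open>K\<close>, and the distance to the maximum by the jump
  length.\<close>

lemma advance_le:
  assumes A: "finite A" "A \<noteq> {}" and K: "0 \<le> K"
  shows "advance K A \<le> (\<Sum>i<I. drift (2 ^ i) A) + of_nat (card A) * (ennreal (K * C) * long_jump I)"
proof -
  let ?d = "\<lambda>a x i. ennreal (real_of_int (x - Max A) * \<mu> A a x) *
     indicator {x. Max A < x \<and> a + 2 ^ i \<le> x \<and> x < a + 2 * 2 ^ i} x"
  let ?l = "\<lambda>a x. ennreal (pmf \<eta> (x - a)) * (ennreal (K * C) * (ennreal (real_of_int (x - a)) * indicator {2 ^ I..} (x - a)))"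
  have "ennreal (min (real_of_int (x - Max A)) K * \<mu> A a x) * indicator {Max A<..} x \<le> (\<Sum>i<I. ?d a x i) + ?l a x"
    if a: "a \<in> A" for a x
  proof (cases "Max A < x")
    case x: True
    have aM: "a \<le> Max A" using A a by simp
    have mu: "0 \<le> \<mu> A a x" using \<mu>_nonneg[OF A(1) a x] .
    show ?thesis
    proof (cases "x - a < 2 ^ I")
      case True
      obtain i where i: "i < I" "2 ^ i \<le> x - a" "x - a < 2 * 2 ^ i"
        using dyadic_scale[of "x - a" I] True x aM by auto
      have "ennreal (min (real_of_int (x - Max A)) K * \<mu> A a x) * indicator {Max A<..} x \<le> ennreal (real_of_int (x - Max A) * \<mu> A a x)"
        using x mu by (auto intro!: ennreal_leI mult_right_mono)
      also have "\<dots> = ?d a x i" using i x by (auto simp: indicator_def)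
      also have "\<dots> \<le> (\<Sum>i<I. ?d a x i)" using i by (intro member_le_sum) auto
      also have "\<dots> \<le> (\<Sum>i<I. ?d a x i) + ?l a x" by simp
      finally show ?thesis .
    next
      case False
      have "min (real_of_int (x - Max A)) K * \<mu> A a x \<le> K * (C * real_of_int (x - Max A) * pmf \<eta> (x - a))"
        using mu K \<mu>_le[OF A(1) a x] by (intro mult_mono) auto
      also have "\<dots> \<le> K * (C * real_of_int (x - a) * pmf \<eta> (x - a))"
        using K C_nonneg aM by (intro mult_left_mono mult_right_mono) auto
      finally have "ennreal (min (real_of_int (x - Max A)) K * \<mu> A a x) \<le> ennreal (pmf \<eta> (x - a) * (K * C * real_of_int (x - a)))"
        by (intro ennreal_leI) (simp add: mult_ac)
      also have "\<dots> = ?l a x"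
        using K C_nonneg False aM x by (simp add: ennreal_mult' ennreal_mult'')
      finally show ?thesis using x by (simp add: add_increasing)
    qed
  qed simp
  then have "advance K A \<le> (\<integral>\<^sup>+x. (\<Sum>a\<in>A. (\<Sum>i<I. ?d a x i) + ?l a x) \<partial>count_space UNIV)"
    unfolding advance_eq[OF assms] by (intro nn_integral_mono sum_mono) auto
  also have "\<dots> = (\<Sum>a\<in>A. (\<Sum>i<I. \<integral>\<^sup>+x. ?d a x i \<partial>count_space UNIV) + (\<integral>\<^sup>+x. ?l a x \<partial>count_space UNIV))"
    by (subst nn_integral_sum, simp, intro sum.cong refl, subst nn_integral_add, simp, simp, subst nn_integral_sum, simp_all)
  also have "\<dots> = (\<Sum>i<I. drift (2 ^ i) A) + (\<Sum>a\<in>A. \<integral>\<^sup>+x. ?l a x \<partial>count_space UNIV)"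
    unfolding drift_def sum.distrib by (subst sum.swap) simp
  also have "(\<Sum>a\<in>A. \<integral>\<^sup>+x. ?l a x \<partial>count_space UNIV) = (\<Sum>a\<in>A. ennreal (K * C) * long_jump I)"
    unfolding long_jump_def
    by (subst nn_integral_shift_pmf[where f = "\<lambda>k. ennreal (K * C) * (ennreal (real_of_int k) * indicator {2 ^ I..} k)"])
      (simp add: nn_integral_cmult)
  finally show ?thesis by simp
qed

end

section \<open>Expected advance, scale by scale\<close>

lemma ennreal_le_suminf: "f j \<le> (\<Sum>j. f j :: ennreal)"
  using sum_le_suminf[of f "{j}"] by simp

context growth_chain
begin

lemma long_jump_le: "long_jump I \<le> ennreal (4 * c * (2 ^ I) powr (1 - \<alpha>))"
proof -
  have "long_jump I \<le> (\<integral>\<^sup>+k. (\<Sum>j. ennreal (2 * 2 ^ (I + j)) * indicator {k. 2 ^ (I + j) \<le> real_of_int k} k) \<partial>measure_pmf \<eta>)"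
    unfolding long_jump_def
  proof (rule nn_integral_mono)
    fix k :: int
    let ?f = "\<lambda>j. ennreal (2 * 2 ^ (I + j)) * indicator {k. 2 ^ (I + j) \<le> real_of_int k} k"
    show "ennreal (real_of_int k) * indicator {2 ^ I..} k \<le> (\<Sum>j. ?f j)"
    proof (cases "2 ^ I \<le> k")
      case True
      have "1 \<le> (2::int) ^ I" by simp
      then have k1: "1 \<le> k" using True by linarith
      have "int (nat k) < int (2 ^ nat k)" by (simp only: of_nat_less_iff less_exp)
      then have "k < 2 ^ nat k" using k1 by simp
      then obtain i where i: "2 ^ i \<le> k" "k < 2 * 2 ^ i" using dyadic_scale[OF k1] by blast
      have "(2::int) ^ I < 2 ^ Suc i" using i True by simp
      then have "I < Suc i" by (rule power_less_imp_less_exp[rotated]) simp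
      then have "I \<le> i" by simp
      define j where "j = i - I"
      have ij: "I + j = i" using \<open>I \<le> i\<close> by (simp add: j_def)
      have "real_of_int (2 ^ i) \<le> real_of_int k" "real_of_int k \<le> real_of_int (2 * 2 ^ i)"
        using i by (simp_all only: of_int_le_iff) 
      then have "ennreal (real_of_int k) * indicator {2 ^ I..} k \<le> ?f j"
        using True by (simp add: ij ennreal_leI)
      also have "?f j \<le> (\<Sum>j. ?f j)"
        by (rule ennreal_le_suminf)
      finally show ?thesis .
    qed simp
  qed
  also have "\<dots> = (\<Sum>j. ennreal (2 * 2 ^ (I + j)) * ennreal (measure_pmf.prob \<eta> {k. 2 ^ (I + j) \<le> real_of_int k}))"
    by (subst nn_integral_suminf, simp, subst nn_integral_cmult_indicator) (simp_all add: measure_pmf.emeasure_eq_measure)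
  also have "\<dots> \<le> (\<Sum>j. ennreal (2 * c * (2 ^ I) powr (1 - \<alpha>) * (1/2) ^ j))"
  proof (intro suminf_le allI)
    fix j
    have "2 * 2 ^ (I + j) * measure_pmf.prob \<eta> {k. 2 ^ (I + j) \<le> real_of_int k} \<le> 2 * 2 ^ (I + j) * (c * (2 ^ (I + j)) powr (- \<alpha>))"
      using tail[of "2 ^ (I + j)"] by (intro mult_left_mono) auto
    also have "\<dots> = 2 * c * ((2 ^ (I + j)) powr (1 - \<alpha>))"
      by (simp add: powr_diff powr_minus divide_inverse)
    also have "(2 ^ (I + j)) powr (1 - \<alpha>) = (2 ^ I) powr (1 - \<alpha>) * (2 ^ j) powr (1 - \<alpha>)"
      by (simp add: power_add powr_mult)
    \<comment> \<open>Since \<open>\<alpha> > 2\<close>, the series is dominated by a geometric one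
      with ratio \<open>1/2\<close>, so the constant is independent of
      \<open>\<alpha>\<close>.\<close>
    also have "(2 ^ j) powr (1 - \<alpha>) \<le> (2 ^ j :: real) powr (- 1)"
      using \<alpha>_gt by (intro powr_mono) auto
    also have "(2 ^ j :: real) powr (- 1) = (1/2) ^ j"
      by (simp add: powr_minus_divide power_one_over)
    finally have "2 * 2 ^ (I + j) * measure_pmf.prob \<eta> {k. 2 ^ (I + j) \<le> real_of_int k} \<le> 2 * c * (2 ^ I) powr (1 - \<alpha>) * (1/2) ^ j"
      using c_nonneg by (simp add: mult_left_mono mult.assoc)
    then show "ennreal (2 * 2 ^ (I + j)) * ennreal (measure_pmf.prob \<eta> {k. 2 ^ (I + j) \<le> real_of_int k}) \<le>
        ennreal (2 * c * (2 ^ I) powr (1 - \<alpha>) * (1/2) ^ j)"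
      by (subst ennreal_mult[symmetric]) (auto intro: ennreal_leI)
  qed auto
  also have "\<dots> = ennreal (4 * c * (2 ^ I) powr (1 - \<alpha>))"
  proof -
    have "(\<lambda>j. 2 * c * (2 ^ I) powr (1 - \<alpha>) * (1/2) ^ j) sums (2 * c * (2 ^ I) powr (1 - \<alpha>) * 2)"
      using geometric_sums[of "1/2 :: real"] by (intro sums_mult) simp
    then show ?thesis
      using c_nonneg by (subst suminf_ennreal_eq) (auto simp: mult_ac)
  qed
  finally show ?thesis .
qed

lemma Max_insert_eq: "finite A \<Longrightarrow> A \<noteq> {} \<Longrightarrow> Max (insert x A) = max x (Max A)"
  by simp

text \<open>While the maximum is within \<open>2 s\<close> of its initial value, the drift is paid for by the
  growth of the truncated displacement. Later only the points added during the block can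
  contribute.\<close>

lemma drift_block:
  assumes B: "finite B" "B \<noteq> {}" and s: "0 < s"
  shows "(\<Sum>t<T. \<integral>\<^sup>+A. drift s A \<partial>measure_pmf (chain t B)) \<le>
    ennreal (4 * real_of_int s + real T ^ 2 * (4 * C * c * real_of_int s powr (2 - \<alpha>)))"
proof -
  define \<kappa> where "\<kappa> = 4 * C * c * real_of_int s powr (2 - \<alpha>)"
  have \<kappa>: "0 \<le> \<kappa>" using C_nonneg c_nonneg by (simp add: \<kappa>_def)
  \<comment> \<open>From less than \<open>2 s\<close> above \<open>Max B\<close>, an advance capped
    at \<open>2 s\<close> stays below the truncation level \<open>4 s\<close>. So the expectation of
    \<open>V\<close> grows by at least that of \<open>g\<close> in each step, yet never exceeds
    \<open>4 s\<close>.\<close>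
  define V where "V = (\<lambda>A. ennreal (min (max 0 (real_of_int (Max A - Max B))) (4 * s)))"
  define g where "g = (\<lambda>A. indicator {A. Max A - Max B < 2 * s} A * advance (2 * s) A)"
  have drift_le: "drift s A \<le> g A + ennreal (T * \<kappa>)"
    if A: "finite A" "B \<subseteq> A" "card (A - B) \<le> t" and t: "t < T" for A t
  proof (cases "Max A - Max B < 2 * s")
    case True
    have "drift s A \<le> advance (2 * s) A" using A B s by (intro drift_le_advance) auto
    then show ?thesis using True by (simp add: g_def add_increasing2)
  next
    case False
    \<comment> \<open>All of \<open>B\<close> is now at least \<open>2 s\<close> below the maximum,
      so only the fewer than \<open>T\<close> points added since can be within reach.\<close>
    have "a \<le> Max B" if "a \<in> B" for a using B that by simp
    then have "{a \<in> A. Max A - a < 2 * s} \<subseteq> A - B" using False by force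
    then have "card {a \<in> A. Max A - a < 2 * s} \<le> card (A - B)" using A by (intro card_mono) auto
    then have card: "card {a \<in> A. Max A - a < 2 * s} \<le> T" using A t by linarith
    have "drift s A \<le> of_nat (card {a \<in> A. Max A - a < 2 * s}) * ennreal \<kappa>"
      unfolding \<kappa>_def using A B s by (intro drift_le_count) auto
    also have "\<dots> \<le> of_nat T * ennreal \<kappa>" using card by (intro mult_right_mono) auto
    also have "\<dots> = ennreal (T * \<kappa>)" using \<kappa> by (simp add: ennreal_of_nat_eq_real_of_nat ennreal_mult')
    finally show ?thesis by (simp add: add_increasing)
  qed
  have V_step: "V A + g A \<le> (\<integral>\<^sup>+x. V (insert x A) \<partial>measure_pmf (\<nu> A))"
    if A: "finite A" "B \<subseteq> A" for A
  proof -
    have BA: "Max B \<le> Max A" using A B by (intro Max_mono) auto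
    have A0: "A \<noteq> {}" using A B by auto
    have "V A + g A = (\<integral>\<^sup>+x. V A + indicator {A. Max A - Max B < 2 * s} A * ennreal (min (max 0 (real_of_int (x - Max A))) (2 * s)) \<partial>measure_pmf (\<nu> A))"
      unfolding g_def advance_def by (subst nn_integral_add) (simp_all add: nn_integral_cmult)
    also have "\<dots> \<le> (\<integral>\<^sup>+x. V (insert x A) \<partial>measure_pmf (\<nu> A))"
    proof (rule nn_integral_mono)
      fix x
      show "V A + indicator {A. Max A - Max B < 2 * s} A * ennreal (min (max 0 (real_of_int (x - Max A))) (2 * s)) \<le> V (insert x A)"
      proof (cases "Max A - Max B < 2 * s")
        case True
        have "min (max 0 (real_of_int (Max A - Max B))) (4 * s) + min (max 0 (real_of_int (x - Max A))) (2 * s)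
          \<le> min (max 0 (real_of_int (max x (Max A) - Max B))) (4 * s)"
          using True BA s by (auto simp: min_def max_def)
        then have "ennreal (min (max 0 (real_of_int (Max A - Max B))) (4 * s) + min (max 0 (real_of_int (x - Max A))) (2 * s)) \<le> V (insert x A)"
          unfolding V_def Max_insert_eq[OF A(1) A0] by (rule ennreal_leI)
        also have "ennreal (min (max 0 (real_of_int (Max A - Max B))) (4 * s) + min (max 0 (real_of_int (x - Max A))) (2 * s)) =
            V A + ennreal (min (max 0 (real_of_int (x - Max A))) (2 * s))"
          unfolding V_def by (rule ennreal_plus) (use s in auto)
        finally show ?thesis using True by simp
      next
        case False
        have "min (max 0 (real_of_int (Max A - Max B))) (4 * s) \<le> min (max 0 (real_of_int (max x (Max A) - Max B))) (4 * s)"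
          by (auto simp: min_def max_def)
        then show ?thesis using False
          by (simp add: V_def Max_insert_eq[OF A(1) A0] ennreal_leI del: Max.insert Max_insert)
      qed
    qed
    finally show ?thesis .
  qed
  have g_sum: "(\<Sum>t<n. \<integral>\<^sup>+A. g A \<partial>measure_pmf (chain t B)) \<le> (\<integral>\<^sup>+A. V A \<partial>measure_pmf (chain n B))" for n
  proof (induction n)
    case (Suc n)
    have "(\<Sum>t<Suc n. \<integral>\<^sup>+A. g A \<partial>measure_pmf (chain t B)) \<le> (\<integral>\<^sup>+A. V A \<partial>measure_pmf (chain n B)) + (\<integral>\<^sup>+A. g A \<partial>measure_pmf (chain n B))"
      using Suc by (simp add: add_right_mono)
    also have "\<dots> = (\<integral>\<^sup>+A. V A + g A \<partial>measure_pmf (chain n B))"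
      by (rule nn_integral_add[symmetric]) auto
    also have "\<dots> \<le> (\<integral>\<^sup>+A. (\<integral>\<^sup>+x. V (insert x A) \<partial>measure_pmf (\<nu> A)) \<partial>measure_pmf (chain n B))"
    proof (rule nn_integral_mono_AE)
      show "AE A in measure_pmf (chain n B). V A + g A \<le> (\<integral>\<^sup>+x. V (insert x A) \<partial>measure_pmf (\<nu> A))"
        using AE_chain[OF B(1), of n] by eventually_elim (rule V_step, blast+)
    qed
    also have "\<dots> = (\<integral>\<^sup>+A. V A \<partial>measure_pmf (chain (Suc n) B))"
      by (rule nn_integral_chain_Suc[symmetric])
    finally show ?case .
  qed simp
  have V_le: "(\<integral>\<^sup>+A. V A \<partial>measure_pmf (chain T B)) \<le> ennreal (4 * s)"
  proof -
    have "(\<integral>\<^sup>+A. V A \<partial>measure_pmf (chain T B)) \<le> (\<integral>\<^sup>+A. ennreal (4 * s) \<partial>measure_pmf (chain T B))"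
      unfolding V_def by (intro nn_integral_mono ennreal_leI) simp
    then show ?thesis by simp
  qed
  have "(\<Sum>t<T. \<integral>\<^sup>+A. drift s A \<partial>measure_pmf (chain t B)) \<le> (\<Sum>t<T. \<integral>\<^sup>+A. g A + ennreal (T * \<kappa>) \<partial>measure_pmf (chain t B))"
  proof (rule sum_mono)
    fix t assume "t \<in> {..<T}"
    then have t: "t < T" by simp
    have "AE A in measure_pmf (chain t B). drift s A \<le> g A + ennreal (T * \<kappa>)"
      using AE_chain[OF B(1), of t] by eventually_elim (rule drift_le[OF _ _ _ t], blast+)
    then show "(\<integral>\<^sup>+A. drift s A \<partial>measure_pmf (chain t B)) \<le> (\<integral>\<^sup>+A. g A + ennreal (T * \<kappa>) \<partial>measure_pmf (chain t B))"
      by (rule nn_integral_mono_AE)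
  qed
  also have "\<dots> = (\<Sum>t<T. \<integral>\<^sup>+A. g A \<partial>measure_pmf (chain t B)) + of_nat T * ennreal (T * \<kappa>)"
    by (subst nn_integral_add) (simp_all add: sum.distrib)
  also have "\<dots> \<le> ennreal (4 * s) + of_nat T * ennreal (T * \<kappa>)"
    using order_trans[OF g_sum V_le] by (rule add_right_mono)
  also have "\<dots> = ennreal (4 * real_of_int s + real T ^ 2 * \<kappa>)"
    using \<kappa> s by (simp add: ennreal_of_nat_eq_real_of_nat power2_eq_square mult.assoc flip: ennreal_mult ennreal_plus)
  finally show ?thesis by (simp add: \<kappa>_def)
qed

text \<open>The bound in \<open>drift_block\<close> is uniform in the initial set, so
  \<open>chain_add\<close> lets every block restart from the set reached so far.\<close>

lemma drift_blocks:
  assumes B: "finite B" "B \<noteq> {}" and s: "0 < s"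
  shows "(\<Sum>t<m * T. \<integral>\<^sup>+A. drift s A \<partial>measure_pmf (chain t B)) \<le>
    of_nat m * ennreal (4 * real_of_int s + real T ^ 2 * (4 * C * c * real_of_int s powr (2 - \<alpha>)))" (is "_ \<le> _ * ?K")
proof -
  let ?f = "\<lambda>t B. \<integral>\<^sup>+A. drift s A \<partial>measure_pmf (chain t B)"
  have "(\<Sum>t<m * T. ?f t B) = (\<Sum>j<m. \<Sum>t\<in>{j * T..<j * T + T}. ?f t B)"
    by (rule sum.nat_group[symmetric])
  also have "\<dots> = (\<Sum>j<m. \<Sum>t<T. ?f (j * T + t) B)"
    by (rule sum.cong[OF refl], subst sum.atLeastLessThan_shift_0) (simp add: atLeast0LessThan)
  also have "\<dots> \<le> (\<Sum>j<m. ?K)"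
  proof (rule sum_mono)
    fix j
    have "(\<Sum>t<T. ?f (j * T + t) B) = (\<integral>\<^sup>+A. (\<Sum>t<T. ?f t A) \<partial>measure_pmf (chain (j * T) B))"
      by (simp add: chain_add nn_integral_sum)
    also have "\<dots> \<le> (\<integral>\<^sup>+A. ?K \<partial>measure_pmf (chain (j * T) B))"
    proof (rule nn_integral_mono_AE)
      show "AE A in measure_pmf (chain (j * T) B). (\<Sum>t<T. ?f t A) \<le> ?K"
        using AE_chain[OF B(1), of "j * T"] by eventually_elim (rule drift_block, use B s in auto)
    qed
    finally show "(\<Sum>t<T. ?f (j * T + t) B) \<le> ?K" by simp
  qed
  finally show ?thesis by simp
qed

text \<open>About \<open>n / r + 1\<close> blocks of cost \<open>O(s)\<close> give
  \<open>n * s powr ((3 - \<alpha>) / 2) + s\<close> up to constants. As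
  \<open>\<alpha> \<le> 3\<close>, this is largest at \<open>s = L\<close>, where the hypothesis on
  \<open>n\<close> makes it \<open>O(L)\<close>.\<close>

lemma drift_total:
  assumes B: "finite B" "B \<noteq> {}" and i: "i \<le> I" and n: "real n \<le> (2 ^ I) powr ((\<alpha> - 1) / 2)"
  shows "(\<Sum>t<n. \<integral>\<^sup>+A. drift (2 ^ i) A \<partial>measure_pmf (chain t B)) \<le> ennreal ((8 + 32 * C * c) * 2 ^ I)"
proof -
  define s :: real where "s = 2 ^ i"
  define L :: real where "L = 2 ^ I"
  have s1: "1 \<le> s" and sL: "s \<le> L" using i by (auto simp: s_def L_def intro: power_increasing)
  define r where "r = s powr ((\<alpha> - 1) / 2)"
  have r1: "1 \<le> r" using s1 \<alpha>_gt by (simp add: r_def ge_one_powr_ge_zero)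
  \<comment> \<open>Rounding \<open>r \<ge> 1\<close> up at most doubles it, which costs a factor
    \<open>4\<close> in the square of \<open>T\<close>.\<close>
  define T where "T = nat \<lceil>r\<rceil>"
  define m where "m = nat \<lceil>n / r\<rceil>"
  have "real T = of_int \<lceil>r\<rceil>" "real m = of_int \<lceil>n / r\<rceil>" using r1 by (simp_all add: T_def m_def)
  then have T: "r \<le> T" "T \<le> 2 * r" and m: "n / r \<le> m" "m \<le> n / r + 1"
    using of_int_ceiling_le_add_one[of r] le_of_int_ceiling[of r] r1
      of_int_ceiling_le_add_one[of "n / r"] le_of_int_ceiling[of "n / r"] by linarith+
  have "real n = n / r * r" using r1 by simp
  also have "\<dots> \<le> real m * real T" using m T r1 by (intro mult_mono) auto
  finally have "n \<le> m * T" by (simp flip: of_nat_mult)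
  then have "(\<Sum>t<n. \<integral>\<^sup>+A. drift (2 ^ i) A \<partial>measure_pmf (chain t B)) \<le> (\<Sum>t<m * T. \<integral>\<^sup>+A. drift (2 ^ i) A \<partial>measure_pmf (chain t B))"
    by (intro sum_mono2) auto
  also have "\<dots> \<le> of_nat m * ennreal (4 * s + real T ^ 2 * (4 * C * c * s powr (2 - \<alpha>)))"
    using drift_blocks[OF B, of "2 ^ i" m T] by (simp add: s_def)
  also have "\<dots> = ennreal (m * (4 * s + real T ^ 2 * (4 * C * c * s powr (2 - \<alpha>))))"
    by (simp add: ennreal_of_nat_eq_real_of_nat ennreal_mult')
  also have "m * (4 * s + real T ^ 2 * (4 * C * c * s powr (2 - \<alpha>))) \<le> (8 + 32 * C * c) * L"
  proof -
    have "r ^ 2 * s powr (2 - \<alpha>) = s"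
      using s1 by (simp add: r_def power2_eq_square flip: powr_add)
    moreover have "real T ^ 2 \<le> (2 * r) ^ 2" using T by (intro power_mono) auto
    then have "real T ^ 2 * (4 * C * c * s powr (2 - \<alpha>)) \<le> (2 * r) ^ 2 * (4 * C * c * s powr (2 - \<alpha>))"
      using C_nonneg c_nonneg by (intro mult_right_mono) auto
    ultimately have "4 * s + real T ^ 2 * (4 * C * c * s powr (2 - \<alpha>)) \<le> (4 + 16 * C * c) * s"
      by (simp add: power_mult_distrib algebra_simps)
    then have "m * (4 * s + real T ^ 2 * (4 * C * c * s powr (2 - \<alpha>))) \<le> (n / r + 1) * ((4 + 16 * C * c) * s)"
      using m s1 C_nonneg c_nonneg r1 by (intro mult_mono) auto
    also have "\<dots> = (4 + 16 * C * c) * (n / r * s + s)" by (simp add: algebra_simps)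
    also have "n / r * s \<le> L"
    proof -
      have "s / r = s powr ((3 - \<alpha>) / 2)"
      proof -
        have "s / r = s powr 1 / s powr ((\<alpha> - 1) / 2)" using s1 by (simp add: r_def)
        also have "\<dots> = s powr (1 - (\<alpha> - 1) / 2)" by (simp only: powr_diff)
        also have "1 - (\<alpha> - 1) / 2 = (3 - \<alpha>) / 2" by (simp add: field_simps)
        finally show ?thesis .
      qed
      also have "\<dots> \<le> L powr ((3 - \<alpha>) / 2)" using s1 sL \<alpha>_le by (intro powr_mono2) auto
      finally have "n * (s / r) \<le> L powr ((\<alpha> - 1) / 2) * L powr ((3 - \<alpha>) / 2)"
        using n s1 r1 by (intro mult_mono) (auto simp: L_def)
      also have "\<dots> = L powr 1" unfolding powr_add[symmetric] by (simp add: field_simps)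
      finally show ?thesis using s1 sL by simp
    qed
    finally have "m * (4 * s + real T ^ 2 * (4 * C * c * s powr (2 - \<alpha>))) \<le> (4 + 16 * C * c) * (L + s)"
      using C_nonneg c_nonneg by (simp add: mult_left_mono)
    also have "\<dots> \<le> (4 + 16 * C * c) * (L + L)"
      using sL C_nonneg c_nonneg by (intro mult_left_mono add_mono add_nonneg_nonneg mult_nonneg_nonneg) auto
    finally show ?thesis by (simp add: algebra_simps)
  qed
  finally show ?thesis by (simp add: L_def ennreal_leI)
qed

text \<open>Markov's inequality for the maximum truncated at \<open>K\<close>, whose expectation is
  at most the sum of the capped advances. Long jumps enter with a factor \<open>K\<close> that the
  division cancels, so their term does not depend on the level.\<close>

lemma max_tail:
  assumes n: "1 \<le> n" "real n \<le> (2 ^ I) powr ((\<alpha> - 1) / 2)" and K: "0 < K"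
  shows "measure_pmf.prob (chain n {0}) {A. K \<le> real_of_int (Max A)} \<le>
    real I * (8 + 32 * C * c) * 2 ^ I / K + 4 * C * c * real n ^ 2 * (2 ^ I) powr (1 - \<alpha>)"
proof -
  define W where "W = (\<lambda>A. ennreal (min (max 0 (real_of_int (Max A))) K))"
  define J where "J = 4 * c * (2 ^ I) powr (1 - \<alpha>)"
  have J: "0 \<le> J" using c_nonneg by (simp add: J_def)
  have adv: "(\<integral>\<^sup>+A. W A \<partial>measure_pmf (chain k {0})) \<le> (\<Sum>t<k. \<integral>\<^sup>+A. advance K A \<partial>measure_pmf (chain t {0}))" for k
  proof (induction k)
    case (Suc k)
    have "(\<integral>\<^sup>+A. W A \<partial>measure_pmf (chain (Suc k) {0})) = (\<integral>\<^sup>+A. (\<integral>\<^sup>+x. W (insert x A) \<partial>measure_pmf (\<nu> A)) \<partial>measure_pmf (chain k {0}))"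
      by (rule nn_integral_chain_Suc)
    also have "\<dots> \<le> (\<integral>\<^sup>+A. W A + advance K A \<partial>measure_pmf (chain k {0}))"
    proof (rule nn_integral_mono_AE)
      have W_step: "(\<integral>\<^sup>+x. W (insert x A) \<partial>measure_pmf (\<nu> A)) \<le> W A + advance K A" if A: "finite A" "{0} \<subseteq> A" for A
      proof -
        have A0: "A \<noteq> {}" using A by auto
        have "(\<integral>\<^sup>+x. W (insert x A) \<partial>measure_pmf (\<nu> A)) \<le> (\<integral>\<^sup>+x. W A + ennreal (min (max 0 (real_of_int (x - Max A))) K) \<partial>measure_pmf (\<nu> A))"
        proof (rule nn_integral_mono)
          fix x
          have "min (max 0 (real_of_int (max x (Max A)))) K \<le> min (max 0 (real_of_int (Max A))) K + min (max 0 (real_of_int (x - Max A))) K"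
            using K by (auto simp: min_def max_def)
          then have "W (insert x A) \<le> ennreal (min (max 0 (real_of_int (Max A))) K + min (max 0 (real_of_int (x - Max A))) K)"
            unfolding W_def Max_insert_eq[OF A(1) A0] by (rule ennreal_leI)
          also have "\<dots> = W A + ennreal (min (max 0 (real_of_int (x - Max A))) K)"
            unfolding W_def by (rule ennreal_plus) (use K in auto)
          finally show "W (insert x A) \<le> W A + ennreal (min (max 0 (real_of_int (x - Max A))) K)" .
        qed
        also have "\<dots> = W A + advance K A"
          unfolding advance_def by (subst nn_integral_add) simp_all
        finally show ?thesis .
      qed
      show "AE A in measure_pmf (chain k {0}). (\<integral>\<^sup>+x. W (insert x A) \<partial>measure_pmf (\<nu> A)) \<le> W A + advance K A"
        using AE_chain[of "{0}" k, OF finite.insertI[OF finite.emptyI]] by eventually_elim (rule W_step, blast+)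
    qed
    also have "\<dots> = (\<integral>\<^sup>+A. W A \<partial>measure_pmf (chain k {0})) + (\<integral>\<^sup>+A. advance K A \<partial>measure_pmf (chain k {0}))"
      by (rule nn_integral_add) auto
    also have "\<dots> \<le> (\<Sum>t<Suc k. \<integral>\<^sup>+A. advance K A \<partial>measure_pmf (chain t {0}))"
      using Suc by (simp add: add_right_mono)
    finally show ?case .
  qed (use K in \<open>simp add: W_def\<close>)
  have "ennreal (K * measure_pmf.prob (chain n {0}) {A. K \<le> real_of_int (Max A)}) =
      (\<integral>\<^sup>+A. ennreal K * indicator {A. K \<le> real_of_int (Max A)} A \<partial>measure_pmf (chain n {0}))"
    using K by (simp add: nn_integral_cmult_indicator measure_pmf.emeasure_eq_measure ennreal_mult')
  also have "\<dots> \<le> (\<integral>\<^sup>+A. W A \<partial>measure_pmf (chain n {0}))"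
    using K by (intro nn_integral_mono) (auto simp: W_def indicator_def intro!: ennreal_leI)
  also have "\<dots> \<le> (\<Sum>t<n. \<integral>\<^sup>+A. advance K A \<partial>measure_pmf (chain t {0}))" by (rule adv)
  also have "\<dots> \<le> (\<Sum>t<n. \<integral>\<^sup>+A. (\<Sum>i<I. drift (2 ^ i) A) + ennreal (n * (K * C * J)) \<partial>measure_pmf (chain t {0}))"
  proof (rule sum_mono)
    fix t assume t: "t \<in> {..<n}"
    have adv_le: "advance K A \<le> (\<Sum>i<I. drift (2 ^ i) A) + ennreal (n * (K * C * J))"
      if A: "finite A" "{0} \<subseteq> A" "card (A - {0}) \<le> t" for A
    proof -
      \<comment> \<open>The origin and at most \<open>t < n\<close> further points.\<close>
      have "card A \<le> n" using A t by (simp add: card_Diff_singleton_if)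
      then have "of_nat (card A) * (ennreal (K * C) * long_jump I) \<le> of_nat n * (ennreal (K * C) * ennreal J)"
        using long_jump_le[of I] by (intro mult_mono) (auto simp: J_def)
      also have "\<dots> = ennreal (n * (K * C * J))"
        using K J C_nonneg by (simp add: ennreal_of_nat_eq_real_of_nat ennreal_mult)
      finally have l: "of_nat (card A) * (ennreal (K * C) * long_jump I) \<le> ennreal (n * (K * C * J))" .
      have "advance K A \<le> (\<Sum>i<I. drift (2 ^ i) A) + of_nat (card A) * (ennreal (K * C) * long_jump I)"
        using A K by (intro advance_le) auto
      also have "\<dots> \<le> (\<Sum>i<I. drift (2 ^ i) A) + ennreal (n * (K * C * J))"
        using l by (rule add_left_mono)
      finally show ?thesis .
    qed
    have "AE A in measure_pmf (chain t {0}). advance K A \<le> (\<Sum>i<I. drift (2 ^ i) A) + ennreal (n * (K * C * J))"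
      using AE_chain[of "{0}" t, OF finite.insertI[OF finite.emptyI]] by eventually_elim (rule adv_le, blast+)
    then show "(\<integral>\<^sup>+A. advance K A \<partial>measure_pmf (chain t {0})) \<le>
        (\<integral>\<^sup>+A. (\<Sum>i<I. drift (2 ^ i) A) + ennreal (n * (K * C * J)) \<partial>measure_pmf (chain t {0}))"
      by (rule nn_integral_mono_AE)
  qed
  also have "\<dots> = (\<Sum>i<I. \<Sum>t<n. \<integral>\<^sup>+A. drift (2 ^ i) A \<partial>measure_pmf (chain t {0})) + of_nat n * ennreal (n * (K * C * J))"
    by (subst sum.swap) (simp add: nn_integral_add nn_integral_sum sum.distrib)
  also have "\<dots> \<le> (\<Sum>i<I. ennreal ((8 + 32 * C * c) * 2 ^ I)) + of_nat n * ennreal (n * (K * C * J))"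
    using n by (intro add_right_mono sum_mono drift_total) auto
  also have "\<dots> = ennreal (I * ((8 + 32 * C * c) * 2 ^ I) + n * (n * (K * C * J)))"
    using K J C_nonneg c_nonneg by (simp add: ennreal_of_nat_eq_real_of_nat flip: ennreal_mult ennreal_plus)
  finally have "K * measure_pmf.prob (chain n {0}) {A. K \<le> real_of_int (Max A)} \<le>
      I * ((8 + 32 * C * c) * 2 ^ I) + n * (n * (K * C * J))"
    using K J C_nonneg c_nonneg by (subst (asm) ennreal_le_iff) auto
  then show ?thesis using K by (simp add: J_def field_simps power2_eq_square)
qed

end

section \<open>Transfer from the chain to the random process\<close>

locale growth_process = growth_chain \<nu> \<mu> \<eta> C c \<alpha> + prob_space M
  for \<nu> \<mu> \<eta> C c \<alpha> and M :: "'w measure" +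
  fixes A :: "nat \<Rightarrow> 'w \<Rightarrow> int set"
  assumes fresh: "\<And>B. finite B \<Longrightarrow> B \<noteq> {} \<Longrightarrow> set_pmf (\<nu> B) \<inter> B = {}"
    and random_set: "\<And>n. A n \<in> measurable M (count_space {B. finite B})"
    and initial: "AE \<omega> in M. A 0 \<omega> = {0}"
    and transition: "\<And>n B x. finite B \<Longrightarrow> B \<noteq> {} \<Longrightarrow> x \<notin> B \<Longrightarrow> \<P>(\<omega> in M. A n \<omega> = B) > 0 \<Longrightarrow>
      \<P>(\<omega> in M. A (Suc n) \<omega> = insert x B \<bar> A n \<omega> = B) = pmf (\<nu> B) x"
begin

lemma sets_A: "{\<omega> \<in> space M. A n \<omega> \<in> T} \<in> sets M"
proof -
  have "A n -` (T \<inter> {B. finite B}) \<inter> space M \<in> sets M"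
    by (rule measurable_sets[OF random_set]) auto
  moreover have "finite (A n \<omega>)" if "\<omega> \<in> space M" for \<omega>
    using measurable_space[OF random_set that] by simp
  then have "A n -` (T \<inter> {B. finite B}) \<inter> space M = {\<omega> \<in> space M. A n \<omega> \<in> T}" by auto
  ultimately show ?thesis by simp
qed

lemma sets_A_eq [measurable]: "Measurable.pred M (\<lambda>\<omega>. A n \<omega> = B)"
  using sets_A[of n "{B}"] by (simp add: pred_def)

text \<open>By \<open>fresh\<close> the new point can be read off from the enlarged set, so no two
  atoms of \<open>\<nu> B\<close> merge.\<close>

lemma pmf_step_insert: "finite B \<Longrightarrow> B \<noteq> {} \<Longrightarrow> x \<notin> B \<Longrightarrow> pmf (step B) (insert x B) = pmf (\<nu> B) x"
proof -
  assume B: "finite B" "B \<noteq> {}" and x: "x \<notin> B"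
  have "pmf (step B) (insert x B) = measure_pmf.prob (\<nu> B) ((\<lambda>x. insert x B) -` {insert x B})"
    unfolding step_def by (rule pmf_map)
  also have "\<dots> = measure_pmf.prob (\<nu> B) {x}"
    using fresh[OF B] x by (intro measure_prob_cong_0) (auto simp: set_pmf_iff)
  finally show ?thesis by (simp add: measure_pmf_single)
qed

text \<open>An inequality between the atoms suffices, because the chain already has total mass \<open>1\<close>.\<close>

lemma pmf_chain_le: "ennreal (pmf (chain n {0}) B) \<le> emeasure M {\<omega> \<in> space M. A n \<omega> = B}"
proof (induction n arbitrary: B)
  case 0
  show ?case
  proof (cases "B = {0}")
    case True
    have "emeasure M {\<omega> \<in> space M. A 0 \<omega> = {0}} = 1"
      using initial by (intro emeasure_eq_1_AE) (auto simp: sets_A[of 0 "{{0}}", simplified])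
    then show ?thesis using True by simp
  qed (auto simp: indicator_def)
next
  case (Suc n)
  let ?J = "\<lambda>B'. {\<omega> \<in> space M. A n \<omega> = B' \<and> A (Suc n) \<omega> = B}"
  have joint: "ennreal (pmf (chain n {0}) B') * ennreal (pmf (step B') B) \<le> emeasure M (?J B')" for B'
  proof (cases "pmf (chain n {0}) B' = 0 \<or> pmf (step B') B = 0")
    case False
    then have "B' \<in> set_pmf (chain n {0})" "B \<in> set_pmf (step B')" by (auto simp: set_pmf_iff)
    from chain_support[OF this(1)] this(2) obtain x where
      B': "finite B'" "B' \<noteq> {}" and x: "x \<in> set_pmf (\<nu> B')" "B = insert x B'"
      by (auto simp: step_def)
    have xB: "x \<notin> B'" using fresh[OF B'] x by auto
    \<comment> \<open>\<open>transition\<close> needs a conditioning event of positive probability;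
      the induction hypothesis supplies it at every atom of the chain.\<close>
    have "0 < pmf (chain n {0}) B'" using False by (simp add: less_le)
    moreover have le: "pmf (chain n {0}) B' \<le> \<P>(\<omega> in M. A n \<omega> = B')"
      using Suc[of B'] by (simp add: emeasure_eq_measure)
    ultimately have pos: "0 < \<P>(\<omega> in M. A n \<omega> = B')" by linarith
    from transition[OF B' xB pos]
    have "\<P>(\<omega> in M. A (Suc n) \<omega> = B \<and> A n \<omega> = B') = \<P>(\<omega> in M. A n \<omega> = B') * pmf (\<nu> B') x"
      using pos by (simp add: cond_prob_def x field_simps)
    also have "\<dots> \<ge> pmf (chain n {0}) B' * pmf (step B') B"
      using le by (simp add: x pmf_step_insert[OF B' xB] mult_right_mono)
    finally show ?thesis
      by (simp add: emeasure_eq_measure conj_commute flip: ennreal_mult)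
  qed auto
  have inf: "pmf (chain n {0}) B' = 0" if "infinite B'" for B'
    using chain_support[of B' n "{0}"] that by (auto simp: set_pmf_iff)
  have "ennreal (pmf (chain (Suc n) {0}) B) = (\<integral>\<^sup>+B'. ennreal (pmf (chain n {0}) B') * ennreal (pmf (step B') B) \<partial>count_space UNIV)"
    by (simp add: ennreal_pmf_bind nn_integral_measure_pmf)
  also have "\<dots> = (\<integral>\<^sup>+B'. ennreal (pmf (chain n {0}) B') * ennreal (pmf (step B') B) \<partial>count_space {B. finite B})"
    by (rule nn_integral_count_space_eq) (auto simp: inf)
  also have "\<dots> \<le> (\<integral>\<^sup>+B'. emeasure M (?J B') \<partial>count_space {B. finite B})"
    by (intro nn_integral_mono joint)
  also have "\<dots> = emeasure M (\<Union>(?J ` {B. finite B}))"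
    by (rule emeasure_UN_countable[symmetric])
      (auto simp: disjoint_family_on_def countable_Collect_finite)
  also have "\<dots> \<le> emeasure M {\<omega> \<in> space M. A (Suc n) \<omega> = B}"
    by (intro emeasure_mono) auto
  finally show ?case .
qed

text \<open>Sum the atom inequality over the complement of \<open>T\<close> and subtract from
  \<open>1\<close>, which reverses it. Finite sets are countably many, so the sum over atoms is
  legitimate.\<close>

lemma prob_le_chain:
  "\<P>(\<omega> in M. A n \<omega> \<in> T) \<le> measure_pmf.prob (chain n {0}) T"
proof -
  let ?U = "{B. finite B} - T"
  have cU: "countable ?U" by (rule countable_subset[OF _ countable_Collect_finite]) auto
  have fin: "emeasure (measure_pmf (chain n {0})) (- {B. finite B}) = 0"
  proof -
    have "set_pmf (chain n {0}) \<inter> - {B. finite B} = {}" using chain_support[of _ n "{0}"] by auto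
    then have "measure_pmf.prob (chain n {0}) (- {B. finite B}) = 0" by (simp only: measure_pmf_zero_iff)
    then show ?thesis by (simp only: measure_pmf.emeasure_eq_measure ennreal_0)
  qed
  have "emeasure (measure_pmf (chain n {0})) (- T) \<le> emeasure (measure_pmf (chain n {0})) (?U \<union> - {B. finite B})"
    by (intro emeasure_mono) auto
  also have "\<dots> \<le> emeasure (measure_pmf (chain n {0})) ?U + 0"
    using emeasure_subadditive[of ?U "measure_pmf (chain n {0})" "- {B. finite B}"] by (simp add: fin)
  also have "\<dots> = (\<integral>\<^sup>+B. ennreal (pmf (chain n {0}) B) \<partial>count_space ?U)"
    by (simp add: nn_integral_pmf)
  also have "\<dots> \<le> (\<integral>\<^sup>+B. emeasure M {\<omega> \<in> space M. A n \<omega> = B} \<partial>count_space ?U)"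
    by (intro nn_integral_mono pmf_chain_le)
  also have "\<dots> = emeasure M (\<Union>B\<in>?U. {\<omega> \<in> space M. A n \<omega> = B})"
    by (rule emeasure_UN_countable[symmetric]) (auto simp: disjoint_family_on_def cU)
  also have "\<dots> \<le> emeasure M (space M - {\<omega> \<in> space M. A n \<omega> \<in> T})"
    using sets_A[of n T] by (intro emeasure_mono) auto
  finally have "measure_pmf.prob (chain n {0}) (- T) \<le> prob (space M - {\<omega> \<in> space M. A n \<omega> \<in> T})"
    by (simp add: measure_pmf.emeasure_eq_measure emeasure_eq_measure)
  also have "\<dots> = 1 - prob {\<omega> \<in> space M. A n \<omega> \<in> T}" by (rule prob_compl[OF sets_A])
  also have "measure_pmf.prob (chain n {0}) (- T) = 1 - measure_pmf.prob (chain n {0}) T"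
    using measure_pmf.prob_compl[of T "chain n {0}"] by (simp add: Compl_eq_Diff_UNIV)
  finally show ?thesis by simp
qed

text \<open>For \<open>L = 2 ^ I\<close>, use \<open>max_tail\<close> at time about
  \<open>L powr \<theta>\<close> and level \<open>L powr (1 + \<epsilon>)\<close>. The first term
  decays since \<open>\<epsilon> > 0\<close> beats the number \<open>I\<close> of scales, the second
  since \<open>2 * \<theta> < \<alpha> - 1\<close>.\<close>

lemma eventually_Max_less:
  assumes \<theta>: "0 < \<theta>" "\<theta> < (\<alpha> - 1) / 2" and \<epsilon>: "0 < \<epsilon>"
  shows "AE \<omega> in M. eventually (\<lambda>I.
    real_of_int (Max (A (nat \<lfloor>2 powr (\<theta> * real I)\<rfloor>) \<omega>)) < 2 powr ((1 + \<epsilon>) * real I)) sequentially"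
proof -
  define n where "n = (\<lambda>I::nat. nat \<lfloor>2 powr (\<theta> * real I)\<rfloor>)"
  define K where "K = (\<lambda>I::nat. 2 powr ((1 + \<epsilon>) * real I) :: real)"
  define bad where "bad = (\<lambda>I. {\<omega> \<in> space M. A (n I) \<omega> \<in> {B. K I \<le> real_of_int (Max B)}})"
  \<comment> \<open>\<open>Suc I\<close> instead of \<open>I\<close> matches the derivative of the
    geometric series, which gives summability.\<close>
  define a where "a = (\<lambda>I. (8 + 32 * C * c) * (real (Suc I) * (2 powr (- \<epsilon>)) ^ I) + 4 * C * c * (2 powr (2 * \<theta> + 1 - \<alpha>)) ^ I)"
  have bound: "prob (bad I) \<le> a I" for I
  proof -
    have pow: "(2::real) ^ I = 2 powr real I" by (simp add: powr_realpow)
    have "1 \<le> 2 powr (\<theta> * real I)" using \<theta> by (simp add: ge_one_powr_ge_zero)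
    then have n: "1 \<le> n I" "real (n I) \<le> 2 powr (\<theta> * real I)" by (auto simp: n_def le_nat_iff)
    have "2 powr (\<theta> * real I) \<le> 2 powr ((\<alpha> - 1) / 2 * real I)"
      using \<theta> by (intro powr_mono mult_right_mono) auto
    also have "\<dots> = (2 ^ I) powr ((\<alpha> - 1) / 2)" by (simp add: pow powr_powr mult.commute)
    finally have nL: "real (n I) \<le> (2 ^ I) powr ((\<alpha> - 1) / 2)" using n by linarith
    have "prob (bad I) \<le> measure_pmf.prob (chain (n I) {0}) {B. K I \<le> real_of_int (Max B)}"
      unfolding bad_def by (rule prob_le_chain)
    also have "\<dots> \<le> real I * (8 + 32 * C * c) * 2 ^ I / K I + 4 * C * c * real (n I) ^ 2 * (2 ^ I) powr (1 - \<alpha>)"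
      using n nL by (intro max_tail) (auto simp: K_def)
    also have "\<dots> \<le> a I"
      unfolding a_def
    proof (rule add_mono)
      have eq: "2 ^ I / K I = (2 powr (- \<epsilon>)) ^ I"
        by (simp add: pow K_def powr_power flip: powr_diff) (simp add: algebra_simps)
      have "real I * (8 + 32 * C * c) * 2 ^ I / K I = (8 + 32 * C * c) * (real I * (2 ^ I / K I))"
        by simp
      also have "\<dots> = (8 + 32 * C * c) * (real I * (2 powr (- \<epsilon>)) ^ I)" by (simp only: eq)
      also have "\<dots> \<le> (8 + 32 * C * c) * (real (Suc I) * (2 powr (- \<epsilon>)) ^ I)"
        using C_nonneg c_nonneg by (intro mult_left_mono mult_right_mono) auto
      finally show "real I * (8 + 32 * C * c) * 2 ^ I / K I \<le> (8 + 32 * C * c) * (real (Suc I) * (2 powr (- \<epsilon>)) ^ I)" .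
      have "real (n I) ^ 2 \<le> (2 powr (\<theta> * real I)) ^ 2" using n by (intro power_mono) auto
      then have "4 * C * c * real (n I) ^ 2 * (2 ^ I) powr (1 - \<alpha>) \<le> 4 * C * c * (2 powr (\<theta> * real I)) ^ 2 * (2 ^ I) powr (1 - \<alpha>)"
        using C_nonneg c_nonneg by (intro mult_right_mono mult_left_mono) auto
      also have "\<dots> = 4 * C * c * ((2 powr (\<theta> * real I)) ^ 2 * (2 ^ I) powr (1 - \<alpha>))" by simp
      also have "(2 powr (\<theta> * real I)) ^ 2 * (2 ^ I) powr (1 - \<alpha>) = (2 powr (2 * \<theta> + 1 - \<alpha>)) ^ I"
        by (simp add: pow powr_power powr_powr flip: powr_add) (simp add: algebra_simps)
      finally show "4 * C * c * real (n I) ^ 2 * (2 ^ I) powr (1 - \<alpha>) \<le> 4 * C * c * (2 powr (2 * \<theta> + 1 - \<alpha>)) ^ I" .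
    qed
    finally show ?thesis .
  qed
  have "norm (2 powr (- \<epsilon>) :: real) < 1" "norm (2 powr (2 * \<theta> + 1 - \<alpha>) :: real) < 1"
    using \<epsilon> \<theta> powr_less_mono[of "- \<epsilon>" 0 "2::real"] powr_less_mono[of "2 * \<theta> + 1 - \<alpha>" 0 "2::real"] by auto
  then have "summable a"
    unfolding a_def
    by (intro summable_add summable_mult summable_geometric sums_summable[OF geometric_deriv_sums[where 'a = real, simplified of_nat_id]]) auto
  then have sum: "summable (\<lambda>I. measure M (bad I))"
    by (rule summable_comparison_test'[where N = 0]) (use bound in auto)
  have bad_sets: "bad I \<in> sets M" for I unfolding bad_def by (rule sets_A)
  have "AE \<omega> in M. eventually (\<lambda>I. \<omega> \<in> space M - bad I) sequentially"
    by (rule borel_cantelli_AE1[OF bad_sets _ sum]) (simp add: emeasure_eq_measure)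
  then show ?thesis
    by eventually_elim (auto simp: bad_def n_def K_def not_le elim!: eventually_mono)
qed

end

section \<open>The diameter of the aggregate\<close>

text \<open>By monotonicity \<open>S n\<close> lies inside the set at the checkpoint
  \<open>N (J n)\<close>. Rounding up in \<open>J\<close> overshoots by at most one index, a bounded
  factor that disappears after division by \<open>ln n\<close>.\<close>

lemma limsup_log_diam_le:
  fixes S :: "nat \<Rightarrow> int set"
  assumes fin: "\<And>n. finite (S n)" and S0: "S 0 = {0}" and mono: "\<And>n. S n \<subseteq> S (Suc n)"
    and \<theta>: "0 < \<theta>" and \<epsilon>: "0 < \<epsilon>"
    and right: "eventually (\<lambda>I. real_of_int (Max (S (nat \<lfloor>2 powr (\<theta> * real I)\<rfloor>))) < 2 powr ((1 + \<epsilon>) * real I)) sequentially"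
    and left: "eventually (\<lambda>I. real_of_int (Max (uminus ` S (nat \<lfloor>2 powr (\<theta> * real I)\<rfloor>))) < 2 powr ((1 + \<epsilon>) * real I)) sequentially"
  shows "limsup (\<lambda>n. ereal (ln (real_of_int (diam (S n))) / ln (real n))) \<le> ereal ((1 + \<epsilon>) / \<theta>)"
proof -
  define J where "J = (\<lambda>n::nat. nat \<lceil>log 2 (real n) / \<theta>\<rceil>)"
  define N where "N = (\<lambda>I::nat. nat \<lfloor>2 powr (\<theta> * real I)\<rfloor>)"
  have incr: "S m \<subseteq> S n" if "m \<le> n" for m n using mono that by (rule lift_Suc_mono_le)
  have ne: "S n \<noteq> {}" for n using incr[of 0 n] S0 by auto
  have J_top: "filterlim J at_top sequentially"
    unfolding filterlim_at_top
  proof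
    fix Z :: nat
    show "eventually (\<lambda>n. Z \<le> J n) sequentially"
      using eventually_ge_at_top[of "nat \<lceil>2 powr (\<theta> * real Z)\<rceil>"]
    proof eventually_elim
      case (elim n)
      have pos: "0 < 2 powr (\<theta> * real Z)" by simp
      have le: "2 powr (\<theta> * real Z) \<le> real n" using elim by linarith
      have "0 < real n" using pos le by (rule less_le_trans)
      then have "\<theta> * real Z \<le> log 2 (real n)" using le by (simp add: le_log_iff)
      then have "real Z \<le> log 2 (real n) / \<theta>" using \<theta> by (simp add: field_simps)
      then show ?case unfolding J_def by linarith
    qed
  qed
  have ev: "eventually (\<lambda>n. real_of_int (Max (S (N (J n)))) < 2 powr ((1 + \<epsilon>) * real (J n))) sequentially"
    "eventually (\<lambda>n. real_of_int (Max (uminus ` S (N (J n)))) < 2 powr ((1 + \<epsilon>) * real (J n))) sequentially"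
    using J_top left right unfolding filterlim_iff N_def by auto
  \<comment> \<open>One \<open>ln 2\<close> comes from adding the bounds of the two sides,
    \<open>(1 + \<epsilon>) * ln 2\<close> from the rounding in \<open>J\<close>.\<close>
  have "eventually (\<lambda>n. ln (real_of_int (diam (S n))) / ln (real n) \<le> (2 + \<epsilon>) * ln 2 / ln (real n) + (1 + \<epsilon>) / \<theta>) sequentially"
    using ev eventually_ge_at_top[of 2]
  proof eventually_elim
    case (elim n)
    have n: "2 \<le> real n" using elim by simp
    have log: "0 \<le> log 2 (real n) / \<theta>" using n \<theta> by (auto intro!: divide_nonneg_nonneg)
    then have J: "log 2 (real n) / \<theta> \<le> J n" "J n \<le> log 2 (real n) / \<theta> + 1"
      unfolding J_def by linarith+
    have "log 2 (real n) \<le> \<theta> * J n" using J(1) \<theta> by (simp add: field_simps)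
    then have "2 powr log 2 (real n) \<le> 2 powr (\<theta> * J n)" by (intro powr_mono) auto
    then have "real n \<le> 2 powr (\<theta> * J n)" using n by simp
    then have nN: "n \<le> N (J n)" unfolding N_def by (simp add: le_nat_floor)
    have "Max (S n) \<le> Max (S (N (J n)))"
      using incr[OF nN] ne fin by (intro Max_mono) auto
    then have mx: "real_of_int (Max (S n)) \<le> 2 powr ((1 + \<epsilon>) * real (J n))" using elim by linarith
    have "Min (S n) \<in> S (N (J n))" using incr[OF nN] Min_in[OF fin ne, of n] by auto
    then have "- Min (S n) \<le> Max (uminus ` S (N (J n)))" using fin by (intro Max_ge) auto
    then have mn: "- real_of_int (Min (S n)) \<le> 2 powr ((1 + \<epsilon>) * real (J n))" using elim by linarith
    have "real_of_int (diam (S n)) \<le> 2 * 2 powr ((1 + \<epsilon>) * real (J n))"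
      using mx mn by (simp add: diam_def)
    also have "\<dots> \<le> 2 * 2 powr ((1 + \<epsilon>) * (log 2 (real n) / \<theta> + 1))"
      using J \<epsilon> by (intro mult_left_mono powr_mono) auto
    finally have d: "real_of_int (diam (S n)) \<le> 2 * 2 powr ((1 + \<epsilon>) * (log 2 (real n) / \<theta> + 1))" .
    have "0 \<le> diam (S n)" using Min_le_iff[OF fin ne] Max_in[OF fin ne, of n] fin by (auto simp: diam_def)
    have "ln (real_of_int (diam (S n))) \<le> ln (2 * 2 powr ((1 + \<epsilon>) * (log 2 (real n) / \<theta> + 1)))"
    proof (cases "diam (S n) = 0")
      \<comment> \<open>Here \<open>ln 0 = 0\<close> by convention, so the right side only has to be
        the logarithm of a number at least \<open>1\<close>.\<close>
      case True
      have "1 \<le> 2 powr ((1 + \<epsilon>) * (log 2 (real n) / \<theta> + 1))"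
        using log \<epsilon> by (intro ge_one_powr_ge_zero mult_nonneg_nonneg) auto
      then have "1 \<le> 2 * 2 powr ((1 + \<epsilon>) * (log 2 (real n) / \<theta> + 1))" by linarith
      then show ?thesis unfolding True by (simp only: of_int_0 ln_0 ln_ge_zero)
    next
      case False
      then have "0 < real_of_int (diam (S n))" using \<open>0 \<le> diam (S n)\<close> by simp
      then show ?thesis using d by (intro ln_mono) auto
    qed
    also have "\<dots> = ln 2 + (1 + \<epsilon>) * (log 2 (real n) / \<theta> + 1) * ln 2"
      by (subst ln_mult) (auto simp: ln_powr)
    also have "\<dots> = (2 + \<epsilon>) * ln 2 + (1 + \<epsilon>) / \<theta> * (log 2 (real n) * ln 2)"
      by (simp add: algebra_simps add_divide_distrib)
    also have "log 2 (real n) * ln 2 = ln (real n)" by (simp add: log_def)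
    finally have "ln (real_of_int (diam (S n))) / ln (real n) \<le> ((2 + \<epsilon>) * ln 2 + (1 + \<epsilon>) / \<theta> * ln (real n)) / ln (real n)"
      using n by (intro divide_right_mono) auto
    also have "\<dots> = (2 + \<epsilon>) * ln 2 / ln (real n) + (1 + \<epsilon>) / \<theta>"
      using n by (simp add: add_divide_distrib)
    finally show ?case .
  qed
  then have "limsup (\<lambda>n. ereal (ln (real_of_int (diam (S n))) / ln (real n))) \<le>
      limsup (\<lambda>n. ereal ((2 + \<epsilon>) * ln 2 / ln (real n) + (1 + \<epsilon>) / \<theta>))"
    by (intro Limsup_mono) (auto elim: eventually_mono)
  also have "\<dots> = ereal ((1 + \<epsilon>) / \<theta>)"
  proof (rule lim_imp_Limsup)
    have "(\<lambda>n. (2 + \<epsilon>) * ln 2 / ln (real n)) \<longlonglongrightarrow> 0" by real_asymp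
    then have "(\<lambda>n. (2 + \<epsilon>) * ln 2 / ln (real n) + (1 + \<epsilon>) / \<theta>) \<longlonglongrightarrow> 0 + (1 + \<epsilon>) / \<theta>"
      by (intro tendsto_add tendsto_const)
    then show "(\<lambda>n. ereal ((2 + \<epsilon>) * ln 2 / ln (real n) + (1 + \<epsilon>) / \<theta>)) \<longlonglongrightarrow> ereal ((1 + \<epsilon>) / \<theta>)"
      by simp
  qed simp
  finally show ?thesis .
qed

text \<open>On the dyadic shell from \<open>2 ^ i\<close> the square is at most
  \<open>4 * 4 ^ i\<close>; with the tail bound the series is geometric with ratio
  \<open>2 powr (2 - \<alpha>) < 1\<close>.\<close>

lemma second_moment_finite_if_tail:
  fixes \<xi> :: "int pmf"
  assumes tail: "\<And>s::real. 0 < s \<Longrightarrow> measure_pmf.prob \<xi> {k. s \<le> \<bar>real_of_int k\<bar>} \<le> c * s powr (- \<alpha>)"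
    and \<alpha>: "2 < \<alpha>"
  shows "(\<integral>\<^sup>+k. ennreal ((real_of_int k)\<^sup>2) \<partial>measure_pmf \<xi>) < \<infinity>"
proof -
  have c: "0 \<le> c" using order_trans[OF measure_nonneg tail[of 1]] by simp
  have "(\<integral>\<^sup>+k. ennreal ((real_of_int k)\<^sup>2) \<partial>measure_pmf \<xi>) \<le>
      (\<integral>\<^sup>+k. (\<Sum>i. ennreal (4 * 4 ^ i) * indicator {k. 2 ^ i \<le> \<bar>real_of_int k\<bar>} k) \<partial>measure_pmf \<xi>)"
  proof (rule nn_integral_mono)
    fix k :: int
    let ?f = "\<lambda>i. ennreal (4 * 4 ^ i) * indicator {k. 2 ^ i \<le> \<bar>real_of_int k\<bar>} k"
    show "ennreal ((real_of_int k)\<^sup>2) \<le> (\<Sum>i. ?f i)"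
    proof (cases "k = 0")
      case False
      have "int (nat \<bar>k\<bar>) < int (2 ^ nat \<bar>k\<bar>)" by (simp only: of_nat_less_iff less_exp)
      then have "\<bar>k\<bar> < 2 ^ nat \<bar>k\<bar>" by simp
      moreover have "1 \<le> \<bar>k\<bar>" using False by simp
      ultimately obtain i where i: "2 ^ i \<le> \<bar>k\<bar>" "\<bar>k\<bar> < 2 * 2 ^ i" using dyadic_scale by blast
      have "real_of_int (2 ^ i) \<le> real_of_int \<bar>k\<bar>" "real_of_int \<bar>k\<bar> \<le> real_of_int (2 * 2 ^ i)"
        using i by (simp_all only: of_int_le_iff)
      then have r: "2 ^ i \<le> \<bar>real_of_int k\<bar>" "\<bar>real_of_int k\<bar> \<le> 2 * 2 ^ i" by simp_all
      have "\<bar>real_of_int k\<bar> ^ 2 \<le> (2 * 2 ^ i) ^ 2" using r by (intro power_mono) auto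
      also have "(2 * 2 ^ i) ^ 2 = 4 * (4 ^ i :: real)"
        by (simp add: power_mult_distrib power2_eq_square flip: power_mult_distrib)
      finally have "ennreal ((real_of_int k)\<^sup>2) \<le> ?f i" using r by (simp add: ennreal_leI)
      also have "\<dots> \<le> (\<Sum>i. ?f i)" by (rule ennreal_le_suminf)
      finally show ?thesis .
    qed simp
  qed
  also have "\<dots> = (\<Sum>i. ennreal (4 * 4 ^ i) * ennreal (measure_pmf.prob \<xi> {k. 2 ^ i \<le> \<bar>real_of_int k\<bar>}))"
    by (subst nn_integral_suminf, simp, subst nn_integral_cmult_indicator) (simp_all add: measure_pmf.emeasure_eq_measure)
  also have "\<dots> \<le> (\<Sum>i. ennreal (4 * c * (2 powr (2 - \<alpha>)) ^ i))"
  proof (intro suminf_le allI)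
    fix i
    have "4 * 4 ^ i * measure_pmf.prob \<xi> {k. 2 ^ i \<le> \<bar>real_of_int k\<bar>} \<le> 4 * 4 ^ i * (c * (2 ^ i) powr (- \<alpha>))"
      using tail[of "2 ^ i"] by (intro mult_left_mono) auto
    also have "\<dots> = 4 * c * (4 ^ i * (2 ^ i) powr (- \<alpha>))" by simp
    also have "(4::real) ^ i * (2 ^ i) powr (- \<alpha>) = (2 powr (2 - \<alpha>)) ^ i"
    proof -
      have "(4::real) ^ i = 2 powr (2 * real i)"
        by (simp add: powr_powr[symmetric] powr_realpow)
      moreover have "(2 ^ i :: real) = 2 powr real i" by (simp add: powr_realpow)
      ultimately show ?thesis
        by (simp add: powr_powr powr_power flip: powr_add) (simp add: algebra_simps)
    qed
    finally show "ennreal (4 * 4 ^ i) * ennreal (measure_pmf.prob \<xi> {k. 2 ^ i \<le> \<bar>real_of_int k\<bar>}) \<le> ennreal (4 * c * (2 powr (2 - \<alpha>)) ^ i)"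
      by (subst ennreal_mult[symmetric]) (auto intro: ennreal_leI)
  qed auto
  also have "\<dots> < \<infinity>"
  proof -
    have "norm (2 powr (2 - \<alpha>) :: real) < 1"
      using \<alpha> powr_less_mono[of "2 - \<alpha>" 0 "2::real"] by auto
    then have "summable (\<lambda>i. 4 * c * (2 powr (2 - \<alpha>)) ^ i)"
      by (intro summable_mult summable_geometric)
    then show ?thesis using c by (subst suminf_ennreal2) auto
  qed
  finally show ?thesis .
qed

section \<open>The aggregate and its mirror image as growth processes\<close>

context centered_walk
begin

text \<open>Meaningful for finite nonempty \<open>A\<close>, where \<open>sum_gluing_measure\<close>
  provides the total mass \<open>1\<close>.\<close>

definition gluing_pmf :: "int set \<Rightarrow> int pmf" where
  "gluing_pmf A = embed_pmf (\<lambda>x. if x \<in> A then 0 else \<Sum>a\<in>A. gluing_measure \<xi> x a A)"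

lemma pmf_gluing_pmf:
  assumes A: "finite A" "A \<noteq> {}"
  shows "pmf (gluing_pmf A) x = (if x \<in> A then 0 else \<Sum>a\<in>A. gluing_measure \<xi> x a A)"
  unfolding gluing_pmf_def
proof (rule pmf_embed_pmf)
  show "0 \<le> (if x \<in> A then 0 else \<Sum>a\<in>A. gluing_measure \<xi> x a A)" for x
    using A gluing_measure_nonneg by (auto intro: sum_nonneg)
  have "(\<integral>\<^sup>+x. ennreal (if x \<in> A then 0 else \<Sum>a\<in>A. gluing_measure \<xi> x a A) \<partial>count_space UNIV) =
      (\<integral>\<^sup>+x. indicator (- A) x * (\<Sum>a\<in>A. ennreal (gluing_measure \<xi> x a A)) \<partial>count_space UNIV)"
    using A gluing_measure_nonneg by (intro nn_integral_cong) (auto simp: sum_ennreal)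
  then show "(\<integral>\<^sup>+x. ennreal (if x \<in> A then 0 else \<Sum>a\<in>A. gluing_measure \<xi> x a A) \<partial>count_space UNIV) = 1"
    using sum_gluing_measure[OF A] by simp
qed

lemma set_gluing_pmf: "finite A \<Longrightarrow> A \<noteq> {} \<Longrightarrow> set_pmf (gluing_pmf A) \<inter> A = {}"
  using pmf_gluing_pmf[of A] by (metis disjoint_iff set_pmf_iff)

end

lemma (in dla_process) transition_insert:
  assumes "centered_walk \<xi>" "finite B" "B \<noteq> {}" "x \<notin> B" "\<P>(\<omega> in M. A n \<omega> = B) > 0"
  shows "\<P>(\<omega> in M. A (Suc n) \<omega> = insert x B \<bar> A n \<omega> = B) = pmf (centered_walk.gluing_pmf \<xi> B) x"
  using transition[of B x n] centered_walk.pmf_gluing_pmf[of \<xi> B x] assms by simp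

text \<open>A particle at \<open>x\<close> is glued by a step from \<open>x\<close> to
  \<open>a\<close>, so the outward jump \<open>x - a\<close> is governed by the law of
  \<open>- \<xi>\<close>. The free point of the attachment bound is \<open>Max B\<close>.\<close>

lemma growth_process_right:
  assumes cw: "centered_walk \<xi>" and dla: "dla_process M \<xi> A"
    and C: "0 < C"
      "\<And>A x a b. finite A \<Longrightarrow> x \<notin> A \<Longrightarrow> b \<in> A \<Longrightarrow> gluing_measure \<xi> x a A \<le> C * \<bar>real_of_int (x - b)\<bar> * pmf \<xi> (a - x)"
    and \<alpha>: "2 < \<alpha>" "\<alpha> \<le> 3"
    and tail: "\<And>s::real. 0 < s \<Longrightarrow> measure_pmf.prob \<xi> {k. s \<le> \<bar>real_of_int k\<bar>} \<le> c * s powr (- \<alpha>)" and c: "0 \<le> c"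
  shows "growth_process (centered_walk.gluing_pmf \<xi>) (\<lambda>B a x. gluing_measure \<xi> x a B) (map_pmf uminus \<xi>) C c \<alpha> M A"
proof -
  interpret centered_walk \<xi> by fact
  interpret dla_process M \<xi> A by fact
  show ?thesis
  proof
    fix B x a assume B: "finite (B :: int set)" and x: "Max B < x"
    then have xB: "x \<notin> B" by (meson Max_ge leD)
    show "pmf (gluing_pmf B) x = (\<Sum>a\<in>B. gluing_measure \<xi> x a B)" if "B \<noteq> {}"
      using B xB that by (simp add: pmf_gluing_pmf)
    assume a: "a \<in> B"
    show "0 \<le> gluing_measure \<xi> x a B" using B xB by (rule gluing_measure_nonneg)
    have "pmf (map_pmf uminus \<xi>) (x - a) = pmf \<xi> (a - x)"
      using pmf_map_inj'[of uminus \<xi> "a - x"] by simp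
    then show "gluing_measure \<xi> x a B \<le> C * real_of_int (x - Max B) * pmf (map_pmf uminus \<xi>) (x - a)"
      using C(2)[OF B xB Max_in[OF B], of a] a x by auto
  next
    fix s :: real assume s: "0 < s"
    have "measure_pmf.prob (map_pmf uminus \<xi>) {k. s \<le> real_of_int k} \<le> measure_pmf.prob \<xi> {k. s \<le> \<bar>real_of_int k\<bar>}"
      by (auto intro!: measure_pmf.finite_measure_mono)
    then show "measure_pmf.prob (map_pmf uminus \<xi>) {k. s \<le> real_of_int k} \<le> c * s powr - \<alpha>"
      using tail[OF s] by linarith
  qed (use C \<alpha> c set_gluing_pmf random_finite_set start transition_insert[OF cw] in auto)
qed

text \<open>In the mirror image the two sign changes cancel and outward jumps follow
  \<open>\<xi>\<close> itself. The free point is \<open>- Max B\<close>, the minimum of the original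
  set.\<close>

lemma growth_process_left:
  assumes cw: "centered_walk \<xi>" and dla: "dla_process M \<xi> A"
    and C: "0 < C"
      "\<And>A x a b. finite A \<Longrightarrow> x \<notin> A \<Longrightarrow> b \<in> A \<Longrightarrow> gluing_measure \<xi> x a A \<le> C * \<bar>real_of_int (x - b)\<bar> * pmf \<xi> (a - x)"
    and \<alpha>: "2 < \<alpha>" "\<alpha> \<le> 3"
    and tail: "\<And>s::real. 0 < s \<Longrightarrow> measure_pmf.prob \<xi> {k. s \<le> \<bar>real_of_int k\<bar>} \<le> c * s powr (- \<alpha>)" and c: "0 \<le> c"
  shows "growth_process (\<lambda>B. map_pmf uminus (centered_walk.gluing_pmf \<xi> (uminus ` B)))
    (\<lambda>B a x. gluing_measure \<xi> (- x) (- a) (uminus ` B)) \<xi> C c \<alpha> M (\<lambda>n \<omega>. uminus ` A n \<omega>)"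
proof -
  interpret centered_walk \<xi> by fact
  interpret dla_process M \<xi> A by fact
  have pmf_neg: "pmf (map_pmf uminus p) x = pmf p (- x)" for p and x :: int
    using pmf_map_inj'[of uminus p "- x"] by simp
  have eq: "uminus ` S = B \<longleftrightarrow> S = uminus ` B" for S B :: "int set"
    by (auto simp: image_image)
  show ?thesis
  proof
    fix B x a assume B: "finite (B :: int set)" and x: "Max B < x"
    then have "x \<notin> B" by (meson Max_ge leD)
    then have xB: "- x \<notin> uminus ` B" by auto
    show "pmf (map_pmf uminus (gluing_pmf (uminus ` B))) x = (\<Sum>a\<in>B. gluing_measure \<xi> (- x) (- a) (uminus ` B))" if "B \<noteq> {}"
      using B xB that by (simp add: pmf_neg pmf_gluing_pmf sum.reindex)
    assume a: "a \<in> B"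
    show "0 \<le> gluing_measure \<xi> (- x) (- a) (uminus ` B)" using B xB by (intro gluing_measure_nonneg) auto
    have "- Max B \<in> uminus ` B" using B a Max_in[of B] by blast
    from C(2)[OF _ xB this, of "- a"]
    show "gluing_measure \<xi> (- x) (- a) (uminus ` B) \<le> C * real_of_int (x - Max B) * pmf \<xi> (x - a)"
      using B x by (simp add: abs_if algebra_simps)
  next
    fix s :: real assume s: "0 < s"
    have "measure_pmf.prob \<xi> {k. s \<le> real_of_int k} \<le> measure_pmf.prob \<xi> {k. s \<le> \<bar>real_of_int k\<bar>}"
      by (auto intro!: measure_pmf.finite_measure_mono)
    then show "measure_pmf.prob \<xi> {k. s \<le> real_of_int k} \<le> c * s powr - \<alpha>"
      using tail[OF s] by linarith
  next
    fix B :: "int set" assume B: "finite B" "B \<noteq> {}"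
    have "y \<in> uminus ` B" if "- y \<in> B" for y using imageI[OF that, of uminus] by simp
    then show "set_pmf (map_pmf uminus (gluing_pmf (uminus ` B))) \<inter> B = {}"
      using set_gluing_pmf[of "uminus ` B"] B by auto
  next
    show "(\<lambda>\<omega>. uminus ` A n \<omega>) \<in> measurable M (count_space {B. finite B})" for n
      by (rule measurable_compose[OF random_finite_set]) auto
    show "AE \<omega> in M. uminus ` A 0 \<omega> = {0}" using start by eventually_elim simp
  next
    fix n B x
    assume B: "finite (B :: int set)" "B \<noteq> {}" "x \<notin> B" and pos: "\<P>(\<omega> in M. uminus ` A n \<omega> = B) > 0"
    have "\<P>(\<omega> in M. A (Suc n) \<omega> = insert (- x) (uminus ` B) \<bar> A n \<omega> = uminus ` B) = pmf (gluing_pmf (uminus ` B)) (- x)"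
      using B pos by (intro transition_insert cw) (auto simp: eq)
    then show "\<P>(\<omega> in M. uminus ` A (Suc n) \<omega> = insert x B \<bar> uminus ` A n \<omega> = B) =
        pmf (map_pmf uminus (gluing_pmf (uminus ` B))) x"
      by (simp add: eq pmf_neg)
  qed (use C \<alpha> c in auto)
qed

theorem theorem5p3:
  fixes \<alpha> \<beta> c :: real
    and \<xi> :: "int pmf"
    and M :: "'w measure"
    and A :: "nat \<Rightarrow> 'w \<Rightarrow> int set"
  assumes "2 < \<alpha>" and "\<alpha> \<le> 3"
    and "\<beta> = 2 / (\<alpha> - 1)"
    and "aperiodic_walk \<xi>"
    and "measure_pmf.expectation \<xi> real_of_int = 0"
    and "\<And>t::real. t > 0 \<Longrightarrow> \<P>(k in measure_pmf \<xi>. real_of_int \<bar>k\<bar> > t) \<le> c * t powr (- \<alpha>)"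
    and "dla_process M \<xi> A"
  shows "AE \<omega> in M.
    limsup (\<lambda>n. ereal (ln (real_of_int (diam (A n \<omega>))) / ln (real n))) \<le> ereal \<beta>"
proof -
  interpret dla_process M \<xi> A by fact
  have c: "0 \<le> c" using order_trans[OF measure_nonneg assms(6)[of 1]] by simp
  \<comment> \<open>The hypothesis bounds a strict tail and the chains use a weak one; halving the
    level bridges this at the cost of \<open>2 powr \<alpha>\<close>.\<close>
  have tail: "measure_pmf.prob \<xi> {k. s \<le> \<bar>real_of_int k\<bar>} \<le> (c * 2 powr \<alpha>) * s powr (- \<alpha>)" if s: "0 < s" for s
  proof -
    have "measure_pmf.prob \<xi> {k. s \<le> \<bar>real_of_int k\<bar>} \<le> \<P>(k in measure_pmf \<xi>. real_of_int \<bar>k\<bar> > s / 2)"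
      using s by (intro measure_pmf.finite_measure_mono) auto
    also have "\<dots> \<le> c * (s / 2) powr (- \<alpha>)" using s by (intro assms(6)) auto
    also have "(s / 2) powr (- \<alpha>) = 2 powr \<alpha> * s powr (- \<alpha>)"
      using s by (simp add: powr_divide powr_minus_divide)
    finally show ?thesis by (simp add: mult.assoc)
  qed
  have cw: "centered_walk \<xi>"
  proof
    fix C :: "int set" and x
    assume "x \<in> C" "\<And>w k. w \<in> C \<Longrightarrow> k \<in> set_pmf \<xi> \<Longrightarrow> w + k \<in> C"
    with assms(4) show "C = UNIV" by (rule aperiodic_walk_irreducible)
  next
    show "(\<integral>\<^sup>+k. ennreal ((real_of_int k)\<^sup>2) \<partial>measure_pmf \<xi>) < \<infinity>"
      using tail assms(1) by (rule second_moment_finite_if_tail)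
  qed (rule assms(5))
  obtain C where C: "C > 0"
    "\<And>A x a b. finite A \<Longrightarrow> x \<notin> A \<Longrightarrow> b \<in> A \<Longrightarrow> gluing_measure \<xi> x a A \<le> C * \<bar>real_of_int (x - b)\<bar> * pmf \<xi> (a - x)"
    using centered_walk.gluing_measure_bound[OF cw] by blast
  have c2: "0 \<le> c * 2 powr \<alpha>" using c by simp
  interpret right: growth_process "centered_walk.gluing_pmf \<xi>" "\<lambda>B a x. gluing_measure \<xi> x a B"
      "map_pmf uminus \<xi>" C "c * 2 powr \<alpha>" \<alpha> M A
    by (rule growth_process_right[OF cw assms(7) C assms(1,2) tail c2])
  interpret left: growth_process "\<lambda>B. map_pmf uminus (centered_walk.gluing_pmf \<xi> (uminus ` B))"
      "\<lambda>B a x. gluing_measure \<xi> (- x) (- a) (uminus ` B)" \<xi> C "c * 2 powr \<alpha>" \<alpha> M "\<lambda>n \<omega>. uminus ` A n \<omega>"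
    by (rule growth_process_left[OF cw assms(7) C assms(1,2) tail c2])
  \<comment> \<open>Countably many parameters allow the null sets to be united, and
    \<open>(1 + \<epsilon> j) / \<theta> j\<close> tends to \<open>\<beta>\<close>. The offset
    \<open>2\<close> in \<open>\<theta>\<close> keeps \<open>\<theta> 0\<close> positive.\<close>
  define \<epsilon> where "\<epsilon> = (\<lambda>j::nat. 1 / (real j + 1))"
  define \<theta> where "\<theta> = (\<lambda>j::nat. (\<alpha> - 1) / 2 * (1 - 1 / (real j + 2)))"
  have \<epsilon>: "0 < \<epsilon> j" for j by (simp add: \<epsilon>_def)
  have \<theta>: "0 < \<theta> j" "\<theta> j < (\<alpha> - 1) / 2" for j
  proof -
    have "0 < 1 - 1 / (real j + 2)" "1 - 1 / (real j + 2) < 1" by (auto simp: field_simps)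
    moreover have "0 < (\<alpha> - 1) / 2" using assms(1) by simp
    ultimately show "0 < \<theta> j" "\<theta> j < (\<alpha> - 1) / 2"
      unfolding \<theta>_def by (auto simp: mult_less_cancel_left1 zero_less_mult_iff)
  qed
  have incr: "AE \<omega> in M. \<forall>n. A n \<omega> \<subseteq> A (Suc n) \<omega>"
    unfolding AE_all_countable
  proof
    show "AE \<omega> in M. A n \<omega> \<subseteq> A (Suc n) \<omega>" for n using increasing[of n] by eventually_elim blast
  qed
  have "AE \<omega> in M. limsup (\<lambda>n. ereal (ln (real_of_int (diam (A n \<omega>))) / ln (real n))) \<le> ereal ((1 + \<epsilon> j) / \<theta> j)" for j
    using right.eventually_Max_less[OF \<theta> \<epsilon>, of j j] left.eventually_Max_less[OF \<theta> \<epsilon>, of j j] start incr AE_space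
  proof eventually_elim
    case (elim \<omega>)
    have "finite (A n \<omega>)" for n using measurable_space[OF random_finite_set elim(5), of n] by simp
    then show ?case using elim \<theta> \<epsilon> by (intro limsup_log_diam_le) auto
  qed
  then have "AE \<omega> in M. \<forall>j. limsup (\<lambda>n. ereal (ln (real_of_int (diam (A n \<omega>))) / ln (real n))) \<le> ereal ((1 + \<epsilon> j) / \<theta> j)"
    by (simp add: AE_all_countable)
  then show ?thesis
  proof eventually_elim
    case (elim \<omega>)
    have 0: "(\<lambda>j. 1 / (real j + 1)) \<longlonglongrightarrow> 0" "(\<lambda>j. 1 / (real j + 2)) \<longlonglongrightarrow> 0"
      by real_asymp+
    have "(\<lambda>j. (1 + \<epsilon> j) / \<theta> j) \<longlonglongrightarrow> (1 + 0) / ((\<alpha> - 1) / 2 * (1 - 0))"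
      unfolding \<epsilon>_def \<theta>_def using assms(1)
      by (intro tendsto_divide tendsto_add tendsto_mult tendsto_diff tendsto_const 0) auto
    then have "(\<lambda>j. ereal ((1 + \<epsilon> j) / \<theta> j)) \<longlonglongrightarrow> ereal \<beta>"
      by (simp add: assms(3))
    then show ?case by (rule LIMSEQ_le_const) (use elim in blast)
  qed
qed

end
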